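(* Assume that the Ideal Case hypothesis (written out in the context) holds. Then for every $\delta>0$, setting $\alpha^*=\frac{1}{3+2\delta}$, there exist nontrivial weak solutions $(v,p)$ of the incompressible Euler equations on $\mathbb{R}\times\mathbb{T}^3$ such that for all $\alpha<\alpha^*$ one has $v\in C^{\alpha}_{t,x}$ and $p\in C^{2\alpha}_{t,x}$, and whose support is contained in a bounded time interval. Furthermore, one can arrange that the energy $E(t)=\frac12\int_{\mathbb{T}^3}|v|^2(t,x)\,dx$ is $C^1$ as a function of $t$. (In particular, the energy increases or decreases in certain time intervals.)
   Context: $\mathbb{T}^3=\mathbb{R}^3/\mathbb{Z}^3$; summation over repeated indices; $\nabla$ denotes derivatives in the spatial variables only; $\|\cdot\|_{C^0}$ is the sup norm (over $\mathbb{R}\times\mathbb{T}^3$, or over $\mathbb{R}$ for functions of $t$). The incompressible Euler equations are $\partial_t v^l+\partial_j(v^jv^l)+\partial^lp=0$, $\partial_jv^j=0$, understood in the sense of distributions. $C^\alpha_{t,x}$ is the Hölder space jointly in $(t,x)$. Nontrivial means not identically zero. A triple $(v,p,R)$ on $\mathbb{R}\times\mathbb{T}^3$, with $v$ a vector field, $p$ a function and $R^{jl}$ a symmetric $(2,0)$ tensor field, solves the Euler–Reynolds system if $\partial_tv^l+\partial_j(v^jv^l)+\partial^lp=\partial_jR^{jl}$ and $\partial_jv^j=0$. Frequency and energy levels. Let $L\ge1$ be an integer, $\Xi\ge2$, and $0<e_R\le e_v$. A solution $(v,p,R)$ of the Euler–Reynolds system has frequency and energy levels below $(\Xi,e_v,e_R)$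 to order $L$ in $C^0$ if $\|\nabla^kv\|_{C^0}\le\Xi^ke_v^{1/2}$ for $k=1,\dots,L$; $\|\nabla^kp\|_{C^0}\le\Xi^ke_v$ for $k=1,\dots,L$; $\|\nabla^kR\|_{C^0}\le\Xi^ke_R$ for $k=0,\dots,L$; and $\|\nabla^k(\partial_t+v\cdot\nabla)R\|_{C^0}\le\Xi^{k+1}e_v^{1/2}e_R$ for $k=0,\dots,L-1$. For $A\subset\mathbb{R}$ and $\theta>0$, $A\pm\theta$ is the set of $t$ within distance $\theta$ of $A$. Ideal Case hypothesis. There is an absolute constant $K$ such that for all integers $L\ge2$ and all $\eta>0$ there is a constant $C=C(\eta,L)$ with the following property. Let $(v,p,R)$ be any solution of the Euler–Reynolds system with frequency and energy levels below $(\Xi,e_v,e_R)$ to order $L$ in $C^0$, let $I$ be a union of nonempty time intervals (possibly unbounded) with $\operatorname{supp}R\subseteq I\times\mathbb{T}^3$, put $\theta=\Xi^{-1}e_v^{-1/2}$, let $e:\mathbb{R}\to\mathbb{R}_{\ge0}$ satisfy $e(t)\ge Ke_R$ for all $t\in I\pm\theta$ and $\|\frac{d^r}{dt^r}e^{1/2}\|_{C^0}\le1000(\Xi e_v^{1/2})^r(Ke_R)^{1/2}$ for $r=0,1,2$, and let $N$ satisfy $N\ge\Xi^\eta$ and $N\ge(e_v/e_R)^{3/2}$. Then there is a solution $(v_1,p_1,R_1)$ of the Euler–Reynolds system, $v_1=v+V$, $p_1=p+P$, with frequency and energy levels below $\big(CN\Xi,\ e_R,\ \frac{e_v^{1/2}e_R^{1/2}}{N}\big)$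 to order $L$ in $C^0$, with $\operatorname{supp}R_1\subseteq(\operatorname{supp}e\pm\theta)\times\mathbb{T}^3$ and $\operatorname{supp}V\cup\operatorname{supp}P\subseteq\operatorname{supp}e\times\mathbb{T}^3$, with $V=\nabla\times W$, and such that $\|V\|_{C^0}\le Ce_R^{1/2}$, $\|\nabla V\|_{C^0}\le CN\Xi e_R^{1/2}$, $\|(\partial_t+v\cdot\nabla)V\|_{C^0}\le C\Xi e_v^{1/2}e_R^{1/2}$, $\|W\|_{C^0}\le C\Xi^{-1}N^{-1}e_R^{1/2}$, $\|\nabla W\|_{C^0}\le Ce_R^{1/2}$, $\|(\partial_t+v\cdot\nabla)W\|_{C^0}\le CN^{-1}e_v^{1/2}e_R^{1/2}$, $\|\int_{\mathbb{T}^3}|V|^2dx-\int_{\mathbb{T}^3}e(t)dx\|_{C^0}\le C\frac{e_R}{N}$, $\|\frac{d}{dt}(\int_{\mathbb{T}^3}|V|^2dx-\int_{\mathbb{T}^3}e(t)dx)\|_{C^0}\le C\frac{\Xi e_v^{1/2}e_R}{N}$, $\|P\|_{C^0}\le Ce_R$, $\|\nabla P\|_{C^0}\le CN\Xi e_R$, $\|(\partial_t+v\cdot\nabla)P\|_{C^0}\le C\Xi e_v^{1/2}e_R$. *)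

theory Defs
  imports "HOL-Analysis.Analysis"
begin

text \<open>
  A function on $R \times T^3$, where $T^3 = R^3 / Z^3$, is represented by its lift: a curried
  function of $t$ and $x$ on $R \times R^3$ that is $Z^3$-periodic in $x$ (\<open>periodic\<close>).
\<close>

type_synonym 'a field = "real \<Rightarrow> real^3 \<Rightarrow> 'a"

definition periodic :: "'a field \<Rightarrow> bool" where
  "periodic f \<longleftrightarrow> (\<forall>t x k. (\<forall>i. k $ i \<in> \<int>) \<longrightarrow> f t (x + k) = f t x)"

definition torus_integral :: "(real^3 \<Rightarrow> real) \<Rightarrow> real" where
  "torus_integral g = integral (cbox 0 1) g"

definition st_support :: "'a::zero field \<Rightarrow> (real \<times> (real^3)) set" where
  "st_support f = closure {(t, x). f t x \<noteq> 0}"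

definition thicken :: "real set \<Rightarrow> real \<Rightarrow> real set" where
  "thicken A \<theta> = {t. \<exists>a\<in>A. \<bar>t - a\<bar> \<le> \<theta>}"


section \<open>Derivatives and regularity classes\<close>

definition dt :: "'a::real_normed_vector field \<Rightarrow> 'a field" where
  "dt f t x = vector_derivative (\<lambda>s. f s x) (at t)"

definition dx :: "3 \<Rightarrow> 'a::real_normed_vector field \<Rightarrow> 'a field" where
  "dx i f t x = frechet_derivative (f t) (at x) (axis i 1)"

text \<open>Advective derivative: $\partial_t f + v \cdot \nabla f$.\<close>

definition advect :: "(real^3) field \<Rightarrow> 'a::real_normed_vector field \<Rightarrow> 'a field" where
  "advect v f t x = dt f t x + (\<Sum>j\<in>UNIV. (v t x $ j) *\<^sub>R dx j f t x)"

definition curl :: "(real^3) field \<Rightarrow> (real^3) field" where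
  "curl W t x = vector
     [dx 2 (\<lambda>t x. W t x $ 3) t x - dx 3 (\<lambda>t x. W t x $ 2) t x,
      dx 3 (\<lambda>t x. W t x $ 1) t x - dx 1 (\<lambda>t x. W t x $ 3) t x,
      dx 1 (\<lambda>t x. W t x $ 2) t x - dx 2 (\<lambda>t x. W t x $ 1) t x]"

text \<open>
  Pointwise Euclidean norm of the full tensor $\nabla^k f$ of spatial derivatives; a list of
  length $k$ is one choice of the $k$ derivative indices.
\<close>

definition nabla_norm :: "nat \<Rightarrow> 'a::real_normed_vector field \<Rightarrow> real field" where
  "nabla_norm k f t x = L2_set (\<lambda>is. norm (foldr dx is f t x)) {is. length is = k}"

text \<open>$\|f\|_{C^0} \le B$. Continuity of \<open>f\<close> is always imposed separately.\<close>

definition C0_le :: "'a::real_normed_vector field \<Rightarrow> real \<Rightarrow> bool" where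
  "C0_le f B \<longleftrightarrow> (\<forall>t x. norm (f t x) \<le> B)"

text \<open>Continuous spatial derivatives up to order \<open>k\<close>; continuity is joint in $(t,x)$.\<close>

primrec Ck_space :: "nat \<Rightarrow> 'a::real_normed_vector field \<Rightarrow> bool" where
  "Ck_space 0 f \<longleftrightarrow> continuous_on UNIV (\<lambda>(t, x). f t x)"
| "Ck_space (Suc k) f \<longleftrightarrow> continuous_on UNIV (\<lambda>(t, x). f t x) \<and>
     (\<forall>t x. f t differentiable (at x)) \<and> (\<forall>i. Ck_space k (dx i f))"

primrec Ck :: "nat \<Rightarrow> ('a::euclidean_space \<Rightarrow> 'b::real_normed_vector) \<Rightarrow> bool" where
  "Ck 0 f \<longleftrightarrow> continuous_on UNIV f"
| "Ck (Suc k) f \<longleftrightarrow> (\<forall>z. f differentiable (at z)) \<and>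
     (\<forall>b\<in>Basis. Ck k (\<lambda>z. frechet_derivative f (at z) b))"

text \<open>$f \in C^k$ jointly in $(t,x)$.\<close>

definition Ck_st :: "nat \<Rightarrow> 'a::real_normed_vector field \<Rightarrow> bool" where
  "Ck_st k f \<longleftrightarrow> Ck k (\<lambda>(t, x). f t x)"

text \<open>
  $f \in C^\alpha_{t,x}$, for $0 < \alpha < 1$. For a periodic lift, the Hoelder condition for the
  Euclidean distance on $R^3$ is the one for the quotient distance on $T^3$.
\<close>

definition holder_st :: "real \<Rightarrow> 'a::real_normed_vector field \<Rightarrow> bool" where
  "holder_st \<alpha> f \<longleftrightarrow> (\<exists>B. C0_le f B \<and>
     (\<forall>t x s y. norm (f t x - f s y) \<le> B * dist (t, x) (s, y) powr \<alpha>))"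


section \<open>Euler and Euler--Reynolds\<close>

definition test_function :: "real field \<Rightarrow> bool" where
  "test_function \<phi> \<longleftrightarrow> periodic \<phi> \<and> (\<forall>k. Ck_st k \<phi>) \<and>
     (\<exists>T. \<forall>t x. \<bar>t\<bar> > T \<longrightarrow> \<phi> t x = 0)"

text \<open>
  Distributional solutions of the Euler equations. The first clauses ($v \in L^2_{loc}$,
  $p \in L^1_{loc}$) make every term a distribution; the last two are the momentum equation,
  component by component, and the incompressibility.
\<close>

definition weak_euler :: "(real^3) field \<Rightarrow> real field \<Rightarrow> bool" where
  "weak_euler v p \<longleftrightarrow> periodic v \<and> periodic p \<and>
     (\<forall>T. (\<lambda>(t, x). v t x) absolutely_integrable_on ({-T..T} \<times> cbox 0 1) \<and>
          (\<lambda>(t, x). (norm (v t x))\<^sup>2) absolutely_integrable_on ({-T..T} \<times> cbox 0 1) \<and>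
          (\<lambda>(t, x). p t x) absolutely_integrable_on ({-T..T} \<times> cbox 0 1)) \<and>
     (\<forall>\<phi> l. test_function \<phi> \<longrightarrow>
        integral (UNIV \<times> cbox 0 1)
          (\<lambda>(t, x). v t x $ l * dt \<phi> t x
                    + (\<Sum>j\<in>UNIV. v t x $ j * v t x $ l * dx j \<phi> t x)
                    + p t x * dx l \<phi> t x) = 0) \<and>
     (\<forall>\<phi>. test_function \<phi> \<longrightarrow>
        integral (UNIV \<times> cbox 0 1) (\<lambda>(t, x). \<Sum>j\<in>UNIV. v t x $ j * dx j \<phi> t x) = 0)"

text \<open>
  Classical solutions of the Euler--Reynolds system. When \<open>v\<close>, \<open>p\<close>, \<open>R\<close> have continuous first
  spatial derivatives, as frequency-energy levels of order at least 1 require, a distributional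
  solution has continuous $\partial_t v$ and is classical, so nothing is lost.
\<close>

definition euler_reynolds ::
  "(real^3) field \<Rightarrow> real field \<Rightarrow> (real^3^3) field \<Rightarrow> bool" where
  "euler_reynolds v p R \<longleftrightarrow>
     periodic v \<and> periodic p \<and> periodic R \<and>
     Ck_st 1 v \<and> Ck_space 1 p \<and> Ck_space 1 R \<and>
     (\<forall>t x j l. R t x $ j $ l = R t x $ l $ j) \<and>
     (\<forall>t x l. dt v t x $ l + (\<Sum>j\<in>UNIV. dx j (\<lambda>t x. v t x $ j * v t x $ l) t x) + dx l p t x
              = (\<Sum>j\<in>UNIV. dx j (\<lambda>t x. R t x $ j $ l) t x)) \<and>
     (\<forall>t x. (\<Sum>j\<in>UNIV. dx j (\<lambda>t x. v t x $ j) t x) = 0)"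

text \<open>
  Frequency and energy levels below $(\Xi, e_v, e_R)$ to order $L$ in $C^0$, including the
  standing restrictions on the parameters.
\<close>

definition levels_below ::
  "nat \<Rightarrow> real \<Rightarrow> real \<Rightarrow> real \<Rightarrow> (real^3) field \<Rightarrow> real field \<Rightarrow> (real^3^3) field \<Rightarrow> bool" where
  "levels_below L \<Xi> e\<^sub>v e\<^sub>R v p R \<longleftrightarrow>
     L \<ge> 1 \<and> \<Xi> \<ge> 2 \<and> 0 < e\<^sub>R \<and> e\<^sub>R \<le> e\<^sub>v \<and>
     euler_reynolds v p R \<and>
     Ck_space L v \<and> Ck_space L p \<and> Ck_space L R \<and>
     Ck_st 1 R \<and> Ck_space (L - 1) (advect v R) \<and>
     (\<forall>k\<in>{1..L}. C0_le (nabla_norm k v) (\<Xi> ^ k * sqrt e\<^sub>v)) \<and>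
     (\<forall>k\<in>{1..L}. C0_le (nabla_norm k p) (\<Xi> ^ k * e\<^sub>v)) \<and>
     (\<forall>k\<in>{0..L}. C0_le (nabla_norm k R) (\<Xi> ^ k * e\<^sub>R)) \<and>
     (\<forall>k\<in>{0..L - 1}. C0_le (nabla_norm k (advect v R)) (\<Xi> ^ (k + 1) * sqrt e\<^sub>v * e\<^sub>R))"


section \<open>The Ideal Case hypothesis\<close>

definition union_of_intervals :: "real set \<Rightarrow> bool" where
  "union_of_intervals I \<longleftrightarrow>
     (\<exists>\<J>. \<J> \<noteq> {} \<and> (\<forall>J\<in>\<J>. J \<noteq> {} \<and> is_interval J) \<and> I = \<Union>\<J>)"

text \<open>Admissible energy profiles; $e^{1/2}$ is required to be $C^2$.\<close>

definition energy_profile ::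
  "real \<Rightarrow> real \<Rightarrow> real \<Rightarrow> real \<Rightarrow> real set \<Rightarrow> (real \<Rightarrow> real) \<Rightarrow> bool" where
  "energy_profile K \<Xi> e\<^sub>v e\<^sub>R I e \<longleftrightarrow>
     (\<forall>t. e t \<ge> 0) \<and>
     (\<forall>t\<in>thicken I (1 / (\<Xi> * sqrt e\<^sub>v)). e t \<ge> K * e\<^sub>R) \<and>
     (\<lambda>t. sqrt (e t)) C1_differentiable_on UNIV \<and>
     deriv (\<lambda>t. sqrt (e t)) C1_differentiable_on UNIV \<and>
     (\<forall>r\<in>{0, 1, 2}. \<forall>t. \<bar>(deriv ^^ r) (\<lambda>t. sqrt (e t)) t\<bar>
                          \<le> 1000 * (\<Xi> * sqrt e\<^sub>v) ^ r * sqrt (K * e\<^sub>R))"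

definition correction_estimates ::
  "real \<Rightarrow> real \<Rightarrow> real \<Rightarrow> real \<Rightarrow> real \<Rightarrow> (real \<Rightarrow> real) \<Rightarrow>
   (real^3) field \<Rightarrow> (real^3) field \<Rightarrow> real field \<Rightarrow> (real^3) field \<Rightarrow> bool" where
  "correction_estimates C N \<Xi> e\<^sub>v e\<^sub>R e v V P W \<longleftrightarrow>
     C0_le V (C * sqrt e\<^sub>R) \<and>
     C0_le (nabla_norm 1 V) (C * N * \<Xi> * sqrt e\<^sub>R) \<and>
     C0_le (advect v V) (C * \<Xi> * sqrt e\<^sub>v * sqrt e\<^sub>R) \<and>
     C0_le W (C * sqrt e\<^sub>R / (\<Xi> * N)) \<and>
     C0_le (nabla_norm 1 W) (C * sqrt e\<^sub>R) \<and>
     C0_le (advect v W) (C * sqrt e\<^sub>v * sqrt e\<^sub>R / N) \<and>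
     (let d = (\<lambda>t. torus_integral (\<lambda>x. (norm (V t x))\<^sup>2) - torus_integral (\<lambda>x. e t)) in
        d C1_differentiable_on UNIV \<and>
        (\<forall>t. \<bar>d t\<bar> \<le> C * e\<^sub>R / N) \<and>
        (\<forall>t. \<bar>deriv d t\<bar> \<le> C * \<Xi> * sqrt e\<^sub>v * e\<^sub>R / N)) \<and>
     C0_le P (C * e\<^sub>R) \<and>
     C0_le (nabla_norm 1 P) (C * N * \<Xi> * e\<^sub>R) \<and>
     C0_le (advect v P) (C * \<Xi> * sqrt e\<^sub>v * e\<^sub>R)"

text \<open>
  The constant $K$ is positive, as is implicit in taking $(K e_R)^{1/2}$. The corrections $V$,
  $P$, $W$ are $C^1$ in $(t,x)$, which is what continuity of their spatial gradients and of their
  advective derivatives along the $C^1$ field $v$ amounts to.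
\<close>

definition ideal_case_hypothesis :: bool where
  "ideal_case_hypothesis \<longleftrightarrow>
     (\<exists>K>0. \<forall>L\<ge>2. \<forall>\<eta>>0. \<exists>C>0.
        \<forall>\<Xi> e\<^sub>v e\<^sub>R v p R I e N.
          levels_below L \<Xi> e\<^sub>v e\<^sub>R v p R \<longrightarrow>
          union_of_intervals I \<longrightarrow>
          st_support R \<subseteq> I \<times> UNIV \<longrightarrow>
          energy_profile K \<Xi> e\<^sub>v e\<^sub>R I e \<longrightarrow>
          N \<ge> \<Xi> powr \<eta> \<longrightarrow>
          N \<ge> (e\<^sub>v / e\<^sub>R) powr (3 / 2) \<longrightarrow>
          (\<exists>V P W R\<^sub>1.
             periodic V \<and> periodic P \<and> periodic W \<and>
             Ck_st 1 V \<and> Ck_st 1 P \<and> Ck_st 1 W \<and>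
             levels_below L (C * N * \<Xi>) e\<^sub>R (sqrt e\<^sub>v * sqrt e\<^sub>R / N)
               (\<lambda>t x. v t x + V t x) (\<lambda>t x. p t x + P t x) R\<^sub>1 \<and>
             st_support R\<^sub>1
               \<subseteq> thicken (closure {t. e t \<noteq> 0}) (1 / (\<Xi> * sqrt e\<^sub>v)) \<times> UNIV \<and>
             st_support V \<union> st_support P \<subseteq> closure {t. e t \<noteq> 0} \<times> UNIV \<and>
             V = curl W \<and>
             correction_estimates C N \<Xi> e\<^sub>v e\<^sub>R e v V P W))"


definition energy :: "(real^3) field \<Rightarrow> real \<Rightarrow> real" where
  "energy v t = 1 / 2 * torus_integral (\<lambda>x. (norm (v t x))\<^sup>2)"

end

theory Submission
  imports Defs
begin

text \<open>
  Iterate the hypothesis from the zero flow. If $q_k$ denotes the ratio $e_v / e_R$ of stage $k$ and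
  $N_k = q_k^{3/2 + \delta}$, then $q_{k+1} = q_k^{1 + \delta}$, so the levels are explicit double exponentials;
  the corrections $V_k$ have size $e_R^{1/2}$ and Lipschitz constant about $N_k \Xi_k e_R^{1/2}$, and interpolation
  makes $\sum_k V_k$ converge in $C^\alpha$ for $\alpha < 1/(3 + 2 \delta)$ (similarly the pressure). The
  Reynolds stresses tend to zero uniformly, so the limit solves the Euler equations weakly.

  The energy increment of stage $k$ is $\frac12 \int |V|^2 + \int v \cdot V$. The derivative of the first term is
  controlled by the energy profile, which is cut off on the summable time scales $2^{-k}$. For the second
  one writes $V = \nabla \times W$ and integrates by parts, so that only $(\partial_t + v \cdot \nabla) W$,
  $|\nabla v|^2 |W|$ and $\nabla R \, V$ remain; all of these are summable, and the energy is $C^1$. The first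
  correction dominates the sum of the others if $q_0$ is large, hence the energy at time $0$ is positive;
  vanishing for large times, it must increase and decrease somewhere.
\<close>

section \<open>Integration by parts on the torus\<close>

text \<open>The quantifiers of the hypothesis shape the parameters: \<open>C\<close> comes after
  \<eta>, so \<eta> may depend on \<delta> only, while \<open>q\<^sub>0\<close> may be taken large
  once \<open>C\<close> is known. This is possible because \<open>Xi k\<close> stays below
  \<open>q k powr M\<close> with an exponent \<open>M\<close> that depends on \<delta> alone.

  The threshold 1 / (3 + 2 \<delta>) is a matter of ratios. Interpolating a bound
  \<open>er k powr \<beta>\<close> with a Lipschitz constant larger by the factor
  \<open>freq_step k * Xi k\<close> leaves the terms of \<open>summable_er_Xi\<close>, which decay
  when \<alpha> (3/2 + \<delta>) < \<beta>. The velocity has \<beta> = 1/2; the pressure has \<beta>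
  = 1 and 2 \<alpha> in place of \<alpha>, hence the same condition.

  Why a vector potential is needed: pairing v directly with the advective derivative of V costs
  about \<open>Xi k * sqrt (ev k) * sqrt (er k)\<close>, whose ratio is a positive power of
  \<open>q k\<close>, so the sum diverges. After the curl has been moved, the largest bound for the
  cross term comes from the stress, \<open>Xi k * er k * sqrt (er k)\<close>, with ratio C
  q^(-\<delta>/2): it is the margin \<delta> > 0 that makes the energy C^1.\<close>

definition per3 :: "(real^3 \<Rightarrow> 'a) \<Rightarrow> bool" where
  "per3 g \<longleftrightarrow> (\<forall>x k. (\<forall>i. k $ i \<in> \<int>) \<longrightarrow> g (x + k) = g x)"

text \<open>The cube shifted by \<open>s\<close> along one axis is cut at x_j = 1, the unit cube at
  x_j = \<open>s\<close>. The two cuts share the piece \<open>cbox c 1\<close>, and the two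
  remaining pieces are translates of each other by a full period.\<close>

lemma cbox_01_halves:
  fixes j :: 3 and s :: real
  assumes "0 \<le> s" "s \<le> 1"
  defines "c \<equiv> s *\<^sub>R axis j 1 :: real^3"
  shows "cbox c (1 + c) \<inter> {x. x $ j \<le> 1} = cbox c 1"
    and "cbox c (1 + c) \<inter> {x. x $ j \<ge> 1} = cbox (axis j 1) (1 + c)"
    and "cbox 0 1 \<inter> {x. x $ j \<ge> s} = cbox c 1"
    and "cbox 0 1 \<inter> {x. x $ j \<le> s} = cbox 0 (1 + c - axis j 1)"
proof -
  show "cbox c (1 + c) \<inter> {x. x $ j \<le> 1} = cbox c 1"
  proof (intro set_eqI iffI)
    fix x assume x: "x \<in> cbox c (1 + c) \<inter> {x. x $ j \<le> 1}"
    show "x \<in> cbox c 1"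
      unfolding mem_box_cart
    proof
      fix i show "c $ i \<le> x $ i \<and> x $ i \<le> 1 $ i"
        using x by (cases "i = j") (auto simp: mem_box_cart c_def axis_def dest!: spec[of _ i])
    qed
  next
    fix x assume x: "x \<in> cbox c 1"
    have "c $ i \<le> x $ i \<and> x $ i \<le> (1 + c) $ i" for i
      using x assms(1) by (cases "i = j") (auto simp: mem_box_cart c_def axis_def dest!: spec[of _ i])
    moreover have "x $ j \<le> 1" using x by (auto simp: mem_box_cart dest!: spec[of _ j])
    ultimately show "x \<in> cbox c (1 + c) \<inter> {x. x $ j \<le> 1}"
      by (auto simp: mem_box_cart)
  qed
  show "cbox c (1 + c) \<inter> {x. x $ j \<ge> 1} = cbox (axis j 1) (1 + c)"
  proof (intro set_eqI iffI)
    fix x assume x: "x \<in> cbox c (1 + c) \<inter> {x. x $ j \<ge> 1}"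
    show "x \<in> cbox (axis j 1) (1 + c)"
      unfolding mem_box_cart
    proof
      fix i show "axis j 1 $ i \<le> x $ i \<and> x $ i \<le> (1+c) $ i"
        using x by (cases "i = j") (auto simp: mem_box_cart c_def axis_def dest!: spec[of _ i])
    qed
  next
    fix x assume x: "x \<in> cbox (axis j 1) (1 + c)"
    have "c $ i \<le> x $ i \<and> x $ i \<le> (1 + c) $ i" for i
      using x assms(2) by (cases "i = j") (auto simp: mem_box_cart c_def axis_def dest!: spec[of _ i])
    moreover have "x $ j \<ge> 1" using x by (auto simp: mem_box_cart axis_def dest!: spec[of _ j])
    ultimately show "x \<in> cbox c (1 + c) \<inter> {x. x $ j \<ge> 1}"
      by (auto simp: mem_box_cart)
  qed
  show "cbox 0 1 \<inter> {x. x $ j \<ge> s} = cbox c 1"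
  proof (intro set_eqI iffI)
    fix x assume x: "x \<in> cbox 0 1 \<inter> {x. x $ j \<ge> s}"
    show "x \<in> cbox c 1"
      unfolding mem_box_cart
    proof
      fix i show "c $ i \<le> x $ i \<and> x $ i \<le> 1 $ i"
        using x by (cases "i = j") (auto simp: mem_box_cart c_def axis_def dest!: spec[of _ i])
    qed
  next
    fix x assume x: "x \<in> cbox c 1"
    have "0 \<le> x $ i \<and> x $ i \<le> 1" for i
      using x assms(1) by (cases "i = j") (auto simp: mem_box_cart c_def axis_def dest!: spec[of _ i])
    moreover have "x $ j \<ge> s" using x by (auto simp: mem_box_cart c_def axis_def dest!: spec[of _ j])
    ultimately show "x \<in> cbox 0 1 \<inter> {x. x $ j \<ge> s}"
      by (auto simp: mem_box_cart)
  qed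
  show "cbox 0 1 \<inter> {x. x $ j \<le> s} = cbox 0 (1 + c - axis j 1)"
  proof (intro set_eqI iffI)
    fix x assume x: "x \<in> cbox 0 1 \<inter> {x. x $ j \<le> s}"
    show "x \<in> cbox 0 (1 + c - axis j 1)"
      unfolding mem_box_cart
    proof
      fix i show "0 $ i \<le> x $ i \<and> x $ i \<le> (1+c - axis j 1) $ i"
        using x by (cases "i = j") (auto simp: mem_box_cart c_def axis_def dest!: spec[of _ i])
    qed
  next
    fix x assume x: "x \<in> cbox 0 (1 + c - axis j 1)"
    have "0 \<le> x $ i \<and> x $ i \<le> 1" for i
      using x assms(2) by (cases "i = j") (auto simp: mem_box_cart c_def axis_def dest!: spec[of _ i])
    moreover have "x $ j \<le> s" using x by (auto simp: mem_box_cart c_def axis_def dest!: spec[of _ j])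
    ultimately show "x \<in> cbox 0 1 \<inter> {x. x $ j \<le> s}"
      by (auto simp: mem_box_cart)
  qed
qed

text \<open>Translation moves one slab across the cube by a full period, where \<open>g\<close>
  takes the same values. Shifts with 0 \<le> \<open>s\<close> \<le> 1 along an axis are enough,
  since only the derivative at \<open>s\<close> = 0 will be taken.\<close>

lemma torus_integral_shift:
  fixes g :: "real^3 \<Rightarrow> real" and j :: 3
  assumes per: "per3 g" and cont: "continuous_on UNIV g" and s: "0 \<le> s" "s \<le> 1"
  shows "torus_integral (\<lambda>x. g (x + s *\<^sub>R axis j 1)) = torus_integral g"
proof -
  define c :: "real^3" where "c = s *\<^sub>R axis j 1"
  have int: "g integrable_on cbox a b" for a b
    by (rule integrable_continuous) (rule continuous_on_subset[OF cont], simp)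
  have B: "axis j 1 \<in> (Basis :: (real^3) set)" by (simp add: axis_in_Basis_iff)
  have "torus_integral (\<lambda>x. g (x + c)) = integral (cbox c (1 + c)) g"
    using integral_shift_cbox[where f=g and a=c and b="1+c" and c=c]
    by (simp add: torus_integral_def)
  also have "\<dots> = integral (cbox c 1) g + integral (cbox (axis j 1) (1 + c)) g"
    using integral_split[OF int B, of c "1 + c" 1] cbox_01_halves(1,2)[OF s, of j]
    by (simp add: c_def inner_axis)
  also have "integral (cbox (axis j 1) (1 + c)) g
      = integral (cbox 0 (1 + c - axis j 1)) (\<lambda>x. g (x + axis j 1))"
    using integral_shift_cbox[where f=g and a="axis j 1" and b="1+c" and c="axis j 1"]
    by simp
  also have "(\<lambda>x. g (x + axis j 1)) = g"
    using per by (auto simp: per3_def axis_def)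
  also have "integral (cbox c 1) g + integral (cbox 0 (1 + c - axis j 1)) g = torus_integral g"
    using integral_split[OF int B, of 0 1 s] cbox_01_halves(3,4)[OF s, of j]
    by (simp add: c_def torus_integral_def inner_axis)
  finally show ?thesis by (simp add: c_def)
qed

section \<open>Partial derivatives of periodic functions of x alone\<close>

definition pd :: "3 \<Rightarrow> (real^3 \<Rightarrow> 'a::real_normed_vector) \<Rightarrow> real^3 \<Rightarrow> 'a" where
  "pd j g x = frechet_derivative g (at x) (axis j 1)"

lemma dx_pd: "dx j f t x = pd j (f t) x"
  by (simp add: dx_def pd_def)

text \<open>The class in which integration by parts on the torus has no boundary terms.
  Differentiability is demanded separately, because \<open>frechet_derivative\<close> carries no
  information at a point where the derivative does not exist.\<close>

definition C1s :: "(real^3 \<Rightarrow> 'a::real_normed_vector) \<Rightarrow> bool" where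
  "C1s g \<longleftrightarrow> per3 g \<and> (\<forall>x. g differentiable at x) \<and> (\<forall>j. continuous_on UNIV (pd j g))"

lemma C1s_continuous: "C1s g \<Longrightarrow> continuous_on UNIV g"
  by (simp add: C1s_def continuous_at_imp_continuous_on differentiable_imp_continuous_within)

lemma has_derivative_pd_line:
  assumes "g differentiable (at (x + s *\<^sub>R axis j 1))"
  shows "((\<lambda>s. g (x + s *\<^sub>R axis j 1)) has_vector_derivative pd j g (x + s *\<^sub>R axis j 1)) (at s within U)"
proof -
  let ?D = "frechet_derivative g (at (x + s *\<^sub>R axis j 1))"
  have D: "(g has_derivative ?D) (at (x + s *\<^sub>R axis j 1))"
    using assms frechet_derivative_works by blast
  have "((\<lambda>s. g (x + s *\<^sub>R axis j 1)) has_derivative (\<lambda>h. ?D (h *\<^sub>R axis j 1))) (at s within U)"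
    by (rule has_derivative_compose[where f="\<lambda>s. x + s *\<^sub>R axis j 1" and g=g, OF _ D])
      (auto intro!: derivative_eq_intros)
  moreover have "?D (h *\<^sub>R axis j 1) = h *\<^sub>R ?D (axis j 1)" for h
    using has_derivative_linear[OF D] linear_cmul by blast
  ultimately show ?thesis by (simp add: has_vector_derivative_def pd_def)
qed

lemma pd_eqI: "(g has_derivative D) (at x) \<Longrightarrow> pd j g x = D (axis j 1)"
  unfolding pd_def by (metis frechet_derivative_at)

text \<open>By translation invariance the integral of \<open>g (x + s *\<^sub>R axis j 1)\<close> is
  constant in \<open>s\<close>; it remains to differentiate under the integral at \<open>s\<close> =
  0. The derivative is taken within \<open>{0..1}\<close>, where the shift lemma applies.\<close>

lemma torus_integral_pd:
  fixes g :: "real^3 \<Rightarrow> real"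
  assumes "C1s g"
  shows "torus_integral (pd j g) = 0"
proof -
  have c: "continuous_on UNIV g" and cp: "continuous_on UNIV (pd j g)" and per: "per3 g"
    and d: "g differentiable at x" for x
    using assms C1s_continuous by (auto simp: C1s_def)
  have "((\<lambda>s. integral (cbox 0 1) (\<lambda>x. g (x + s *\<^sub>R axis j 1))) has_vector_derivative
      integral (cbox 0 1) (\<lambda>x. pd j g (x + 0 *\<^sub>R axis j 1))) (at 0 within {0..1})"
  proof (rule leibniz_rule_vector_derivative)
    show "continuous_on ({0..1} \<times> cbox 0 1) (\<lambda>(s, x). pd j g (x + s *\<^sub>R axis j 1))"
      unfolding split_beta
      by (intro continuous_on_compose2[OF cp] continuous_intros) auto
    show "(\<lambda>x. g (x + s *\<^sub>R axis j 1)) integrable_on cbox 0 1" for s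
      by (intro integrable_continuous continuous_on_compose2[OF c] continuous_intros) auto
  qed (auto intro!: has_derivative_pd_line d)
  moreover have "((\<lambda>s. integral (cbox 0 1) (\<lambda>x. g (x + s *\<^sub>R axis j 1))) has_vector_derivative 0)
      (at 0 within {0..1})"
  proof (rule has_vector_derivative_transform_within[of "\<lambda>_. torus_integral g" 0 0 _ 1])
    show "\<And>s. s \<in> {0..1} \<Longrightarrow> dist s 0 < 1 \<Longrightarrow> torus_integral g = integral (cbox 0 1) (\<lambda>x. g (x + s *\<^sub>R axis j 1))"
      using torus_integral_shift[OF per c] by (auto simp: torus_integral_def)
  qed auto
  ultimately have "integral (cbox 0 1) (\<lambda>x. pd j g (x + 0 *\<^sub>R axis j 1)) = 0"
    by (intro vector_derivative_unique_within_closed_interval[of 0 1 0]) auto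
  then show ?thesis by (simp add: torus_integral_def)
qed

lemma C1sD:
  assumes "C1s g"
  shows "per3 g" "g differentiable at x" "continuous_on UNIV (pd j g)" "continuous_on UNIV g"
  using assms C1s_continuous by (auto simp: C1s_def)

lemma C1s_intro:
  assumes "per3 g" "\<And>x. (g has_derivative D x) (at x)"
    and "\<And>j. continuous_on UNIV (\<lambda>x. D x (axis j 1))"
  shows "C1s g"
proof -
  have "pd j g = (\<lambda>x. D x (axis j 1))" for j using pd_eqI[OF assms(2)] by auto
  then show ?thesis using assms by (auto simp: C1s_def differentiable_def)
qed

lemma has_derivative_C1s: "C1s g \<Longrightarrow> (g has_derivative frechet_derivative g (at x)) (at x)"
  using C1sD(2) frechet_derivative_works by blast

lemma pd_mult:
  fixes f g :: "real^3 \<Rightarrow> real"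
  assumes "f differentiable at x" "g differentiable at x"
  shows "pd j (\<lambda>x. f x * g x) x = f x * pd j g x + pd j f x * g x"
  using pd_eqI[OF has_derivative_mult[OF assms[unfolded frechet_derivative_works]]]
  by (simp add: pd_def)

lemma pd_add:
  assumes "f differentiable at x" "g differentiable at x"
  shows "pd j (\<lambda>x. f x + g x) x = pd j f x + pd j g x"
  using pd_eqI[OF has_derivative_add[OF assms[unfolded frechet_derivative_works]]]
  by (simp add: pd_def)

lemma pd_diff:
  assumes "f differentiable at x" "g differentiable at x"
  shows "pd j (\<lambda>x. f x - g x) x = pd j f x - pd j g x"
  using pd_eqI[OF has_derivative_diff[OF assms[unfolded frechet_derivative_works]]]
  by (simp add: pd_def)

lemma pd_sum:
  assumes "\<And>i. i \<in> I \<Longrightarrow> f i differentiable at x"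
  shows "pd j (\<lambda>x. \<Sum>i\<in>I. f i x) x = (\<Sum>i\<in>I. pd j (f i) x)"
  using pd_eqI[OF has_derivative_sum[OF assms[unfolded frechet_derivative_works]]]
  by (simp add: pd_def)

lemma pd_nth:
  assumes "f differentiable at x"
  shows "pd j (\<lambda>x. f x $ i) x = pd j f x $ i"
  using pd_eqI[OF bounded_linear.has_derivative[OF bounded_linear_vec_nth assms[unfolded frechet_derivative_works]]]
  by (simp add: pd_def)

lemma differentiable_nth: "f differentiable at x \<Longrightarrow> (\<lambda>x. f x $ i) differentiable at x"
  using bounded_linear.has_derivative[OF bounded_linear_vec_nth] unfolding differentiable_def by blast

lemma C1s_mult:
  fixes f g :: "real^3 \<Rightarrow> real"
  assumes "C1s f" "C1s g"
  shows "C1s (\<lambda>x. f x * g x)"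
proof -
  note [continuous_intros] = C1sD(3,4)[OF assms(1)] C1sD(3,4)[OF assms(2)]
  have "pd j (\<lambda>x. f x * g x) = (\<lambda>x. f x * pd j g x + pd j f x * g x)" for j
    using pd_mult C1sD(2)[OF assms(1)] C1sD(2)[OF assms(2)] by blast
  then show ?thesis using assms unfolding C1s_def per3_def
    by (auto intro!: continuous_intros)
qed

lemma C1s_diff:
  assumes "C1s f" "C1s g"
  shows "C1s (\<lambda>x. f x - g x)"
proof -
  note [continuous_intros] = C1sD(3,4)[OF assms(1)] C1sD(3,4)[OF assms(2)]
  have "pd j (\<lambda>x. f x - g x) = (\<lambda>x. pd j f x - pd j g x)" for j
    using pd_diff C1sD(2)[OF assms(1)] C1sD(2)[OF assms(2)] by blast
  then show ?thesis using assms unfolding C1s_def per3_def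
    by (auto intro!: continuous_intros)
qed

lemma C1s_sum:
  assumes "finite I" "\<And>i. i \<in> I \<Longrightarrow> C1s (f i)"
  shows "C1s (\<lambda>x. \<Sum>i\<in>I. f i x)"
proof -
  have "pd j (\<lambda>x. \<Sum>i\<in>I. f i x) = (\<lambda>x. \<Sum>i\<in>I. pd j (f i) x)" for j
    by (intro ext pd_sum C1sD(2) assms(2))
  then show ?thesis using assms unfolding C1s_def per3_def
    by (auto intro!: continuous_intros differentiable_sum sum.cong)
qed

lemma C1s_nth:
  assumes "C1s f"
  shows "C1s (\<lambda>x. f x $ i)"
proof -
  note [continuous_intros] = C1sD(3,4)[OF assms(1)]
  have "pd j (\<lambda>x. f x $ i) = (\<lambda>x. pd j f x $ i)" for j
    using pd_nth C1sD(2)[OF assms(1)] by blast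
  then show ?thesis using assms unfolding C1s_def per3_def
    by (auto intro!: continuous_intros differentiable_nth)
qed

lemma C1s_vec:
  fixes f :: "real^3 \<Rightarrow> real^'n"
  assumes "\<And>i. C1s (\<lambda>x. f x $ i)"
  shows "C1s f"
proof (rule C1s_intro)
  let ?D = "\<lambda>x h. \<chi> i. frechet_derivative (\<lambda>x. f x $ i) (at x) h"
  show "per3 f" using assms by (simp add: C1s_def per3_def vec_eq_iff)
  show "(f has_derivative ?D x) (at x)" for x
    unfolding has_derivative_componentwise_within[of f]
    using has_derivative_C1s[OF assms] by (auto simp: Basis_vec_def inner_axis)
  show "continuous_on UNIV (\<lambda>x. ?D x (axis j 1))" for j
    using C1sD(3)[OF assms, of j] unfolding pd_def by (intro continuous_on_vec_lambda) auto
qed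

section \<open>Integrals of continuous functions over the unit cube\<close>

lemma torus_integrable: "continuous_on UNIV (g :: real^3 \<Rightarrow> real) \<Longrightarrow> g integrable_on cbox 0 1"
  by (rule integrable_continuous) (rule continuous_on_subset, auto)

lemma torus_integral_add:
  assumes "continuous_on UNIV f" "continuous_on UNIV g"
  shows "torus_integral (\<lambda>x. f x + g x) = torus_integral f + torus_integral g"
  unfolding torus_integral_def by (intro Henstock_Kurzweil_Integration.integral_add torus_integrable assms)

lemma torus_integral_diff:
  assumes "continuous_on UNIV f" "continuous_on UNIV g"
  shows "torus_integral (\<lambda>x. f x - g x) = torus_integral f - torus_integral g"
  unfolding torus_integral_def by (intro Henstock_Kurzweil_Integration.integral_diff torus_integrable assms)

lemma torus_integral_cmult: "torus_integral (\<lambda>x. c * f x) = c * torus_integral f"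
  unfolding torus_integral_def by simp

lemma torus_integral_sum:
  assumes "finite I" "\<And>i. i \<in> I \<Longrightarrow> continuous_on UNIV (f i)"
  shows "torus_integral (\<lambda>x. \<Sum>i\<in>I. f i x) = (\<Sum>i\<in>I. torus_integral (f i))"
  unfolding torus_integral_def
  by (intro Henstock_Kurzweil_Integration.integral_sum torus_integrable assms)

lemma torus_integral_sum2:
  fixes f :: "'i::finite \<Rightarrow> 'j::finite \<Rightarrow> real^3 \<Rightarrow> real"
  assumes "\<And>i j. continuous_on UNIV (f i j)"
  shows "torus_integral (\<lambda>x. \<Sum>i\<in>UNIV. \<Sum>j\<in>UNIV. f i j x) = (\<Sum>i\<in>UNIV. \<Sum>j\<in>UNIV. torus_integral (f i j))"
proof -
  have "continuous_on UNIV (\<lambda>x. \<Sum>j\<in>UNIV. f i j x)" for i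
    by (intro continuous_on_sum assms)
  then have "torus_integral (\<lambda>x. \<Sum>i\<in>UNIV. \<Sum>j\<in>UNIV. f i j x)
      = (\<Sum>i\<in>UNIV. torus_integral (\<lambda>x. \<Sum>j\<in>UNIV. f i j x))"
    by (intro torus_integral_sum finite)
  also have "\<dots> = (\<Sum>i\<in>UNIV. \<Sum>j\<in>UNIV. torus_integral (f i j))"
    by (intro sum.cong refl torus_integral_sum finite assms)
  finally show ?thesis .
qed

lemma measure_unit_cube: "measure lborel (cbox 0 (1::real^3)) = 1"
proof -
  have "cbox 0 (1::real^3) \<noteq> {}" by (auto simp: interval_ne_empty_cart)
  then show ?thesis by (simp add: content_cbox_cart)
qed

lemma torus_integral_const: "torus_integral (\<lambda>x. c) = c"
  by (simp add: torus_integral_def measure_unit_cube)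

lemma torus_integral_mono:
  assumes "continuous_on UNIV f" "continuous_on UNIV g" "\<And>x. f x \<le> g x"
  shows "torus_integral f \<le> torus_integral g"
  unfolding torus_integral_def by (intro integral_le torus_integrable assms)

lemma torus_integral_bound:
  assumes "continuous_on UNIV f" "\<And>x. \<bar>f x\<bar> \<le> B"
  shows "\<bar>torus_integral f\<bar> \<le> B"
proof -
  have "f x \<le> B" "- B \<le> f x" for x using assms(2)[of x] by (auto simp: abs_le_iff)
  then have "torus_integral f \<le> torus_integral (\<lambda>x. B)" "torus_integral (\<lambda>x. -B) \<le> torus_integral f"
    by (auto intro!: torus_integral_mono assms continuous_intros)
  then show ?thesis unfolding torus_integral_const by (simp add: abs_le_iff)
qed

lemma torus_integral_by_parts:
  assumes "C1s f" "C1s g"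
  shows "torus_integral (\<lambda>x. f x * pd j g x) = - torus_integral (\<lambda>x. pd j f x * g x)"
proof -
  note [continuous_intros] = C1sD(3,4)[OF assms(1)] C1sD(3,4)[OF assms(2)]
  have "pd j (\<lambda>x. f x * g x) = (\<lambda>x. f x * pd j g x + pd j f x * g x)"
    using pd_mult C1sD(2)[OF assms(1)] C1sD(2)[OF assms(2)] by blast
  then have "0 = torus_integral (\<lambda>x. f x * pd j g x + pd j f x * g x)"
    using torus_integral_pd[OF C1s_mult[OF assms]] by metis
  also have "\<dots> = torus_integral (\<lambda>x. f x * pd j g x) + torus_integral (\<lambda>x. pd j f x * g x)"
    by (intro torus_integral_add continuous_intros)
  finally show ?thesis by simp
qed

section \<open>The curl and its symmetry under the integral\<close>

text \<open>Unlike \<open>curl\<close>, it differentiates the vector field first and takes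
  components afterwards; the two agree wherever the slice is differentiable
  (\<open>curl_eq_scurl\<close>).\<close>

definition scurl :: "(real^3 \<Rightarrow> real^3) \<Rightarrow> real^3 \<Rightarrow> real^3" where
  "scurl U x = vector [pd 2 U x $ 3 - pd 3 U x $ 2, pd 3 U x $ 1 - pd 1 U x $ 3,
     pd 1 U x $ 2 - pd 2 U x $ 1]"

lemma scurl_nth [simp]:
  "scurl U x $ 1 = pd 2 U x $ 3 - pd 3 U x $ 2"
  "scurl U x $ 2 = pd 3 U x $ 1 - pd 1 U x $ 3"
  "scurl U x $ 3 = pd 1 U x $ 2 - pd 2 U x $ 1"
  by (simp_all add: scurl_def)

lemma curl_eq_scurl:
  assumes "W t differentiable at x"
  shows "curl W t x = scurl (W t) x"
  using pd_nth[OF assms] by (simp add: curl_def scurl_def dx_pd)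

lemma continuous_on_scurl:
  assumes "\<And>j. continuous_on S (pd j U)"
  shows "continuous_on S (scurl U)"
proof -
  have c: "continuous_on S (\<lambda>x. pd j U x $ k - pd l U x $ m)" for j k l m
    by (intro continuous_on_diff continuous_on_component assms)
  have "continuous_on S (\<lambda>x. scurl U x $ i)" for i
    using exhaust_3[of i] c by (elim disjE) (simp_all only: scurl_nth)
  then have "continuous_on S (\<lambda>x. \<chi> i. scurl U x $ i)" by (rule continuous_on_vec_lambda)
  then show ?thesis by simp
qed

lemma inner_3: "(a::real^3) \<bullet> b = a $ 1 * b $ 1 + a $ 2 * b $ 2 + a $ 3 * b $ 3"
  by (simp add: inner_vec_def sum_3)

text \<open>The difference of the integrands is a sum of six signed derivatives
  \<open>?P j a w\<close>, one for each permutation of the coordinates, and each has integral zero.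
  Only first derivatives enter, as \<open>W\<close> will be no better than C^1.\<close>

lemma torus_integral_scurl:
  assumes A: "C1s A" and W: "C1s W"
  shows "torus_integral (\<lambda>x. A x \<bullet> scurl W x) = torus_integral (\<lambda>x. scurl A x \<bullet> W x)"
proof -
  note [continuous_intros] = C1sD(3,4)[OF A] C1sD(3,4)[OF W] continuous_on_scurl[OF C1sD(3)]
  let ?P = "\<lambda>j a w x. pd j (\<lambda>x. A x $ a * W x $ w) x"
  have P: "?P j a w x = A x $ a * pd j W x $ w + pd j A x $ a * W x $ w" for j a w x
    using A W by (simp add: pd_mult pd_nth C1sD differentiable_nth)
  have c: "continuous_on UNIV (?P j a w)" for j a w
    unfolding P by (intro continuous_intros)
  have z: "torus_integral (?P j a w) = 0" for j a w
    by (intro torus_integral_pd C1s_mult C1s_nth A W)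
  have "torus_integral (\<lambda>x. A x \<bullet> scurl W x) - torus_integral (\<lambda>x. scurl A x \<bullet> W x)
      = torus_integral (\<lambda>x. A x \<bullet> scurl W x - scurl A x \<bullet> W x)"
    by (subst torus_integral_diff) (auto intro!: continuous_intros A W)
  also have "\<dots> = torus_integral (\<lambda>x. (?P 2 1 3 x - ?P 3 1 2 x) + (?P 3 2 1 x - ?P 1 2 3 x)
      + (?P 1 3 2 x - ?P 2 3 1 x))"
    unfolding P inner_3 scurl_nth by (intro arg_cong[where f=torus_integral] ext) (simp add: algebra_simps)
  also have "\<dots> = torus_integral (\<lambda>x. ?P 2 1 3 x - ?P 3 1 2 x) + torus_integral (\<lambda>x. ?P 3 2 1 x - ?P 1 2 3 x)
      + torus_integral (\<lambda>x. ?P 1 3 2 x - ?P 2 3 1 x)"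
    by (subst torus_integral_add, intro continuous_on_add continuous_on_diff c, rule continuous_on_diff[OF c c])+ (rule refl)
  also have "\<dots> = 0"
    unfolding torus_integral_diff[OF c c] z by simp
  finally show ?thesis by simp
qed

section \<open>Symmetry of second partial derivatives\<close>

lemma has_real_derivative_pd_line:
  "g differentiable (at (x + s *\<^sub>R axis j 1)) \<Longrightarrow>
    ((\<lambda>s. g (x + s *\<^sub>R axis j 1)) has_real_derivative pd j g (x + s *\<^sub>R axis j 1)) (at s within U)"
  by (simp add: has_real_derivative_iff_has_vector_derivative has_derivative_pd_line)

text \<open>The mean value theorem, first in direction \<open>i\<close> and then in direction
  \<open>j\<close>. The left-hand side is symmetric in the two directions, the right-hand side is
  not; \<open>pd_commute\<close> plays one order against the other.\<close>

lemma second_difference_mean_value: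
  fixes f :: "real^3 \<Rightarrow> real"
  assumes f: "\<And>x. f differentiable at x" and fi: "\<And>x. pd i f differentiable at x" and h: "0 < h"
  obtains \<xi> \<eta> where "0 < \<xi>" "\<xi> < h" "0 < \<eta>" "\<eta> < h"
    "f (x + h *\<^sub>R axis i 1 + h *\<^sub>R axis j 1) - f (x + h *\<^sub>R axis i 1) - f (x + h *\<^sub>R axis j 1) + f x
      = h\<^sup>2 * pd j (pd i f) (x + \<xi> *\<^sub>R axis i 1 + \<eta> *\<^sub>R axis j 1)"
proof -
  define \<phi> where "\<phi> s = f ((x + h *\<^sub>R axis j 1) + s *\<^sub>R axis i 1) - f (x + s *\<^sub>R axis i 1)" for s
  define \<phi>' where "\<phi>' s = pd i f ((x + h *\<^sub>R axis j 1) + s *\<^sub>R axis i 1) - pd i f (x + s *\<^sub>R axis i 1)" for s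
  have "(\<phi> has_real_derivative \<phi>' s) (at s)" for s
    unfolding \<phi>_def \<phi>'_def
    by (intro DERIV_diff has_real_derivative_pd_line f)
  from MVT2[of 0 h \<phi>, OF h this] obtain \<xi> where \<xi>: "0 < \<xi>" "\<xi> < h" "\<phi> h - \<phi> 0 = h * \<phi>' \<xi>" by auto
  have "((\<lambda>u. pd i f ((x + \<xi> *\<^sub>R axis i 1) + u *\<^sub>R axis j 1)) has_real_derivative
      pd j (pd i f) ((x + \<xi> *\<^sub>R axis i 1) + u *\<^sub>R axis j 1)) (at u)" for u
    by (intro has_real_derivative_pd_line fi)
  from MVT2[OF h this] obtain \<eta> where \<eta>: "0 < \<eta>" "\<eta> < h"
    "pd i f ((x + \<xi> *\<^sub>R axis i 1) + h *\<^sub>R axis j 1) - pd i f (x + \<xi> *\<^sub>R axis i 1)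
      = h * pd j (pd i f) ((x + \<xi> *\<^sub>R axis i 1) + \<eta> *\<^sub>R axis j 1)" by auto
  show ?thesis
  proof (rule that[OF \<xi>(1,2) \<eta>(1,2)])
    show "f (x + h *\<^sub>R axis i 1 + h *\<^sub>R axis j 1) - f (x + h *\<^sub>R axis i 1) - f (x + h *\<^sub>R axis j 1) + f x
      = h\<^sup>2 * pd j (pd i f) (x + \<xi> *\<^sub>R axis i 1 + \<eta> *\<^sub>R axis j 1)"
      using \<xi>(3) \<eta>(3) unfolding \<phi>_def \<phi>'_def power2_eq_square
      by (simp add: add_ac)
  qed
qed

lemma pd_commute:
  fixes f :: "real^3 \<Rightarrow> real"
  assumes f: "C1s f" and fi: "C1s (pd i f)" and fj: "C1s (pd j f)"
  shows "pd i (pd j f) x = pd j (pd i f) x"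
proof (rule ccontr)
  assume ne: "pd i (pd j f) x \<noteq> pd j (pd i f) x"
  \<comment> \<open>Half of the gap, so that two values within \<open>e\<close> of the two
    derivatives cannot coincide.\<close>
  define e where "e = \<bar>pd i (pd j f) x - pd j (pd i f) x\<bar> / 2"
  have e: "e > 0" using ne by (simp add: e_def)
  have "isCont (pd i (pd j f)) x" "isCont (pd j (pd i f)) x"
    using C1sD(3)[OF fj] C1sD(3)[OF fi] by (auto simp: continuous_on_eq_continuous_at)
  then obtain d1 d2 where d: "d1 > 0" "d2 > 0"
    "\<And>y. dist y x < d1 \<Longrightarrow> dist (pd i (pd j f) y) (pd i (pd j f) x) < e"
    "\<And>y. dist y x < d2 \<Longrightarrow> dist (pd j (pd i f) y) (pd j (pd i f) x) < e"
    using e unfolding continuous_at_eps_delta by metis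
  \<comment> \<open>Both offsets are below \<open>h\<close>, so the displacement is at most 2
    \<open>h\<close>, which is less than either radius.\<close>
  define h where "h = min d1 d2 / 3"
  have h: "h > 0" using d by (simp add: h_def)
  have near: "dist (x + s *\<^sub>R axis i 1 + u *\<^sub>R axis j 1) x < min d1 d2"
    "dist (x + s *\<^sub>R axis j 1 + u *\<^sub>R axis i 1) x < min d1 d2"
    if "0 < s" "s < h" "0 < u" "u < h" for s u
  proof -
    have *: "norm (s *\<^sub>R axis k 1 + u *\<^sub>R axis l (1::real) :: real^3) \<le> 2 * h" for k l
      using norm_triangle_ineq[of "s *\<^sub>R axis k 1" "u *\<^sub>R axis l (1::real)::real^3"] that by simp
    have **: "2 * h < min d1 d2" using d by (auto simp: h_def min_def)
    show "dist (x + s *\<^sub>R axis i 1 + u *\<^sub>R axis j 1) x < min d1 d2"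
      using *[of i j] ** by (simp add: dist_norm add.assoc)
    show "dist (x + s *\<^sub>R axis j 1 + u *\<^sub>R axis i 1) x < min d1 d2"
      using *[of j i] ** by (simp add: dist_norm add.assoc)
  qed
  obtain a b where ab: "0 < a" "a < h" "0 < b" "b < h"
    "f (x + h *\<^sub>R axis i 1 + h *\<^sub>R axis j 1) - f (x + h *\<^sub>R axis i 1) - f (x + h *\<^sub>R axis j 1) + f x
      = h\<^sup>2 * pd j (pd i f) (x + a *\<^sub>R axis i 1 + b *\<^sub>R axis j 1)"
    by (rule second_difference_mean_value[OF C1sD(2)[OF f] C1sD(2)[OF fi] h])
  obtain c k where ck: "0 < c" "c < h" "0 < k" "k < h"
    "f (x + h *\<^sub>R axis j 1 + h *\<^sub>R axis i 1) - f (x + h *\<^sub>R axis j 1) - f (x + h *\<^sub>R axis i 1) + f x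
      = h\<^sup>2 * pd i (pd j f) (x + c *\<^sub>R axis j 1 + k *\<^sub>R axis i 1)"
    by (rule second_difference_mean_value[OF C1sD(2)[OF f] C1sD(2)[OF fj] h])
  have swap: "x + h *\<^sub>R axis j 1 + h *\<^sub>R axis i 1 = x + h *\<^sub>R axis i 1 + h *\<^sub>R axis j 1"
    by (simp add: add_ac)
  have "h\<^sup>2 * pd j (pd i f) (x + a *\<^sub>R axis i 1 + b *\<^sub>R axis j 1)
      = h\<^sup>2 * pd i (pd j f) (x + c *\<^sub>R axis j 1 + k *\<^sub>R axis i 1)"
    using ab(5) ck(5)[unfolded swap] by linarith
  then have "pd j (pd i f) (x + a *\<^sub>R axis i 1 + b *\<^sub>R axis j 1)
      = pd i (pd j f) (x + c *\<^sub>R axis j 1 + k *\<^sub>R axis i 1)"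
    using h by simp
  with d(3)[of "x + c *\<^sub>R axis j 1 + k *\<^sub>R axis i 1"] d(4)[of "x + a *\<^sub>R axis i 1 + b *\<^sub>R axis j 1"]
    near(1)[OF ab(1-4)] near(2)[OF ck(1-4)]
  show False unfolding e_def dist_real_def by (auto simp: abs_if split: if_splits)
qed

section \<open>The curl of the transport term\<close>

definition adv :: "(real^3 \<Rightarrow> real^3) \<Rightarrow> (real^3 \<Rightarrow> 'a::real_normed_vector) \<Rightarrow> real^3 \<Rightarrow> 'a" where
  "adv U X x = (\<Sum>j\<in>UNIV. (U x $ j) *\<^sub>R pd j X x)"

text \<open>The commutator of the curl with \<open>adv U\<close>, applied to \<open>U\<close>.
  Second derivatives have cancelled, so it is bounded by the square of the gradient; for
  divergence-free \<open>U\<close> it is minus the vortex stretching term (curl U . grad) U.\<close>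

definition curl_defect :: "(real^3 \<Rightarrow> real^3) \<Rightarrow> real^3 \<Rightarrow> real^3" where
  "curl_defect U x = vector
     [(\<Sum>j\<in>UNIV. pd 2 U x $ j * pd j U x $ 3 - pd 3 U x $ j * pd j U x $ 2),
      (\<Sum>j\<in>UNIV. pd 3 U x $ j * pd j U x $ 1 - pd 1 U x $ j * pd j U x $ 3),
      (\<Sum>j\<in>UNIV. pd 1 U x $ j * pd j U x $ 2 - pd 2 U x $ j * pd j U x $ 1)]"

lemma C1s_scurl:
  assumes "\<And>i. C1s (pd i U)"
  shows "C1s (scurl U)"
proof (rule C1s_vec)
  fix i :: 3
  have "C1s (\<lambda>x. pd j U x $ k - pd l U x $ m)" for j k l m
    by (intro C1s_diff C1s_nth assms)
  then show "C1s (\<lambda>x. scurl U x $ i)"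
    using exhaust_3[of i] by (elim disjE) (simp_all only: scurl_nth)
qed

lemma C1s_adv:
  fixes U X :: "real^3 \<Rightarrow> real^3"
  assumes "C1s U" "\<And>i. C1s (pd i X)"
  shows "C1s (adv U X)"
  unfolding adv_def by (rule C1s_vec) (auto intro!: C1s_sum C1s_mult C1s_nth assms)

lemma pd_adv_nth:
  fixes U X :: "real^3 \<Rightarrow> real^3"
  assumes U: "C1s U" and X: "\<And>i. C1s (pd i X)"
  shows "pd i (adv U X) x $ l
    = (\<Sum>j\<in>UNIV. U x $ j * pd i (pd j X) x $ l + pd i U x $ j * pd j X x $ l)"
proof -
  have "pd i (adv U X) x $ l = pd i (\<lambda>x. \<Sum>j\<in>UNIV. U x $ j * pd j X x $ l) x"
    using pd_nth[OF C1sD(2)[OF C1s_adv[OF U X]], of i l x] by (simp add: adv_def)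
  also have "\<dots> = (\<Sum>j\<in>UNIV. pd i (\<lambda>x. U x $ j * pd j X x $ l) x)"
    by (rule pd_sum) (intro C1sD(2) C1s_mult C1s_nth U X)
  also have "\<dots> = (\<Sum>j\<in>UNIV. U x $ j * pd i (pd j X) x $ l + pd i U x $ j * pd j X x $ l)"
    using U X by (simp add: pd_mult pd_nth C1sD differentiable_nth)
  finally show ?thesis .
qed

text \<open>By the product rule, the second derivatives assemble to the transport of the curl once
  they have been commuted; the products of first derivatives are what \<open>curl_defect\<close>
  collects.\<close>

lemma scurl_adv:
  assumes U: "C1s U" and U2: "\<And>i. C1s (pd i U)"
  shows "scurl (adv U U) x = adv U (scurl U) x + curl_defect U x"
proof -
  have comm: "pd i (pd j U) x $ l = pd j (pd i U) x $ l" for i j l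
  proof -
    have eq: "pd k (\<lambda>x. U x $ l) = (\<lambda>x. pd k U x $ l)" for k
      using pd_nth[OF C1sD(2)[OF U]] by blast
    have "pd i (pd j (\<lambda>x. U x $ l)) x = pd j (pd i (\<lambda>x. U x $ l)) x"
      by (rule pd_commute) (auto simp: eq intro!: C1s_nth U U2)
    then show ?thesis using U2 by (simp add: eq pd_nth C1sD)
  qed
  have sc: "pd j (scurl U) x $ 1 = pd j (pd 2 U) x $ 3 - pd j (pd 3 U) x $ 2"
       "pd j (scurl U) x $ 2 = pd j (pd 3 U) x $ 1 - pd j (pd 1 U) x $ 3"
       "pd j (scurl U) x $ 3 = pd j (pd 1 U) x $ 2 - pd j (pd 2 U) x $ 1" for j
    using U2 by (simp_all add: pd_nth[symmetric] C1sD(2)[OF C1s_scurl[OF U2]] pd_diff differentiable_nth C1sD)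
  show ?thesis
    unfolding vec_eq_iff forall_3
    by (simp add: pd_adv_nth[OF U U2] curl_defect_def adv_def sc comm[of 2 1] comm[of 3 1] comm[of 3 2]
        sum_3 algebra_simps)
qed

text \<open>The curl is moved off \<open>W\<close>. The transport term of the result contains second
  derivatives of \<open>U\<close>, so it is integrated by parts once more, using that
  \<open>U\<close> is divergence-free. Only first derivatives are left, and \<open>adv U W\<close>
  is the spatial half of the advective derivative of \<open>W\<close>.\<close>

lemma torus_integral_adv_scurl:
  assumes U: "C1s U" and U2: "\<And>i. C1s (pd i U)" and W: "C1s W"
    and div: "\<And>x. (\<Sum>j\<in>UNIV. pd j U x $ j) = 0"
  shows "torus_integral (\<lambda>x. adv U U x \<bullet> scurl W x)
    = torus_integral (\<lambda>x. curl_defect U x \<bullet> W x) - torus_integral (\<lambda>x. scurl U x \<bullet> adv U W x)"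
proof -
  note CS = C1s_scurl[OF U2]
  note [continuous_intros] = C1sD(3,4)[OF U] C1sD(3,4)[OF W] C1sD(3,4)[OF CS]
  have cadv [continuous_intros]: "continuous_on UNIV (adv U X)" if "C1s X" for X :: "real^3 \<Rightarrow> real^3"
    unfolding adv_def using C1sD(3,4)[OF that] by (intro continuous_intros)
  have cd: "curl_defect U x = scurl (adv U U) x - adv U (scurl U) x" for x
    using scurl_adv[OF U U2] by simp
  have ccd [continuous_intros]: "continuous_on UNIV (curl_defect U)"
    unfolding cd by (intro continuous_intros continuous_on_scurl C1sD(3)[OF C1s_adv[OF U U2]] CS)
  have trm: "torus_integral (\<lambda>x. U x $ j * pd j (scurl U) x $ l * W x $ l)
      = - torus_integral (\<lambda>x. pd j U x $ j * (scurl U x $ l * W x $ l))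
        - torus_integral (\<lambda>x. U x $ j * (scurl U x $ l * pd j W x $ l))" for j l
  proof -
    have "torus_integral (\<lambda>x. (U x $ j * W x $ l) * pd j (\<lambda>x. scurl U x $ l) x)
      = - torus_integral (\<lambda>x. pd j (\<lambda>x. U x $ j * W x $ l) x * scurl U x $ l)"
      by (intro torus_integral_by_parts C1s_mult C1s_nth U W CS)
    also have "(\<lambda>x. (U x $ j * W x $ l) * pd j (\<lambda>x. scurl U x $ l) x)
        = (\<lambda>x. U x $ j * pd j (scurl U) x $ l * W x $ l)"
      by (simp add: pd_nth C1sD[OF CS] mult_ac)
    also have "(\<lambda>x. pd j (\<lambda>x. U x $ j * W x $ l) x * scurl U x $ l)
        = (\<lambda>x. pd j U x $ j * (scurl U x $ l * W x $ l) + U x $ j * (scurl U x $ l * pd j W x $ l))"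
      by (simp add: pd_mult pd_nth C1sD[OF U] C1sD[OF W] differentiable_nth algebra_simps)
    also have "torus_integral \<dots> = torus_integral (\<lambda>x. pd j U x $ j * (scurl U x $ l * W x $ l))
        + torus_integral (\<lambda>x. U x $ j * (scurl U x $ l * pd j W x $ l))"
      by (intro torus_integral_add continuous_intros)
    finally show ?thesis by simp
  qed
  have S1: "adv U (scurl U) x \<bullet> W x = (\<Sum>l\<in>UNIV. \<Sum>j\<in>UNIV. U x $ j * pd j (scurl U) x $ l * W x $ l)" for x
    by (simp add: adv_def inner_vec_def sum_distrib_right)
  have S2: "scurl U x \<bullet> adv U W x = (\<Sum>l\<in>UNIV. \<Sum>j\<in>UNIV. U x $ j * (scurl U x $ l * pd j W x $ l))" for x
    by (simp add: adv_def inner_vec_def sum_distrib_left mult_ac)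
  \<comment> \<open>The terms in which the derivative falls on the transporting \<open>U\<close> add
    up to its divergence.\<close>
  have S3: "(\<Sum>l\<in>UNIV. \<Sum>j\<in>UNIV. torus_integral (\<lambda>x. pd j U x $ j * (scurl U x $ l * W x $ l))) = 0"
  proof -
    have "(\<Sum>l\<in>UNIV. \<Sum>j\<in>UNIV. torus_integral (\<lambda>x. pd j U x $ j * (scurl U x $ l * W x $ l)))
       = (\<Sum>l\<in>UNIV. torus_integral (\<lambda>x. \<Sum>j\<in>UNIV. pd j U x $ j * (scurl U x $ l * W x $ l)))"
      by (intro sum.cong refl torus_integral_sum[symmetric] continuous_intros) auto
    also have "\<dots> = 0"
      unfolding sum_distrib_right[symmetric] div by (simp add: torus_integral_const)
    finally show ?thesis .
  qed
  have "torus_integral (\<lambda>x. adv U (scurl U) x \<bullet> W x)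
      = (\<Sum>l\<in>UNIV. \<Sum>j\<in>UNIV. torus_integral (\<lambda>x. U x $ j * pd j (scurl U) x $ l * W x $ l))"
    unfolding S1 by (intro torus_integral_sum2 continuous_intros)
  also have "\<dots> = - (\<Sum>l\<in>UNIV. \<Sum>j\<in>UNIV. torus_integral (\<lambda>x. U x $ j * (scurl U x $ l * pd j W x $ l)))"
    unfolding trm sum_subtractf sum_negf S3 by simp
  also have "\<dots> = - torus_integral (\<lambda>x. scurl U x \<bullet> adv U W x)"
    unfolding S2 by (subst torus_integral_sum2) (intro continuous_intros refl)+
  finally have A: "torus_integral (\<lambda>x. adv U (scurl U) x \<bullet> W x) = - torus_integral (\<lambda>x. scurl U x \<bullet> adv U W x)" .
  have "torus_integral (\<lambda>x. adv U U x \<bullet> scurl W x) = torus_integral (\<lambda>x. scurl (adv U U) x \<bullet> W x)"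
    by (intro torus_integral_scurl C1s_adv U U2 W)
  also have "\<dots> = torus_integral (\<lambda>x. adv U (scurl U) x \<bullet> W x + curl_defect U x \<bullet> W x)"
    by (simp add: scurl_adv[OF U U2] inner_add_left)
  also have "\<dots> = torus_integral (\<lambda>x. adv U (scurl U) x \<bullet> W x) + torus_integral (\<lambda>x. curl_defect U x \<bullet> W x)"
    by (intro torus_integral_add continuous_intros CS)
  finally show ?thesis using A by simp
qed

section \<open>Space-time fields\<close>

text \<open>All slice derivatives are read off the one Frechet derivative \<open>D\<close> of the
  uncurried field; joint continuity of \<open>dt f\<close> and \<open>dx j f\<close> is then the
  continuity of \<open>D\<close> on basis vectors that \<open>Ck\<close> provides.\<close>

lemma Ck_st_1D:
  fixes f :: "'a::real_normed_vector field"
  assumes "Ck_st 1 f"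
  defines "D \<equiv> \<lambda>t x. frechet_derivative (\<lambda>(t, x). f t x) (at (t, x))"
  shows "((\<lambda>(t, x). f t x) has_derivative D t x) (at (t, x))"
    and "((\<lambda>s. f s x) has_vector_derivative dt f t x) (at t)"
    and "f t differentiable at x"
    and "dt f t x = D t x (1, 0)"
    and "dx j f t x = D t x (0, axis j 1)"
    and "continuous_on UNIV (\<lambda>(t, x). f t x)"
    and "continuous_on UNIV (\<lambda>(t, x). dt f t x)"
    and "continuous_on UNIV (\<lambda>(t, x). dx j f t x)"
proof -
  have diff: "(\<lambda>(t, x). f t x) differentiable at z" for z
    using assms(1) unfolding Ck_st_def One_nat_def Ck.simps by blast
  have cD: "continuous_on UNIV (\<lambda>z. frechet_derivative (\<lambda>(t, x). f t x) (at z) b)" if "b \<in> Basis" for b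
    using assms(1) that unfolding Ck_st_def One_nat_def Ck.simps by blast
  have D: "((\<lambda>(t, x). f t x) has_derivative D t x) (at (t, x))" for t x
    using diff[of "(t, x)"] unfolding D_def frechet_derivative_works .
  show "((\<lambda>(t, x). f t x) has_derivative D t x) (at (t, x))" by (rule D)
  have lin: "linear (D t x)" for t x using has_derivative_linear[OF D] .
  have "((\<lambda>s. (\<lambda>(t, x). f t x) (s, x)) has_derivative (\<lambda>h. D t x (h, 0))) (at t)" for t x
    by (rule has_derivative_compose[where f="\<lambda>s. (s, x)" and g="\<lambda>(t, x). f t x", OF _ D])
      (auto intro!: derivative_eq_intros)
  moreover have "(\<lambda>h. D t x (h, 0)) = (\<lambda>h. h *\<^sub>R D t x (1, 0))" for t x
  proof
    fix h show "D t x (h, 0) = h *\<^sub>R D t x (1, 0)"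
      using linear_cmul[OF lin, of t x h "(1, 0)"] by simp
  qed
  ultimately have dtD: "((\<lambda>s. f s x) has_vector_derivative D t x (1, 0)) (at t)" for t x
    by (simp only: has_vector_derivative_def case_prod_conv)
  then show dt: "dt f t x = D t x (1, 0)" for t x
    unfolding dt_def by (rule vector_derivative_at)
  show "((\<lambda>s. f s x) has_vector_derivative dt f t x) (at t)"
    unfolding dt by (rule dtD)
  have dxD: "(f t has_derivative (\<lambda>h. D t x (0, h))) (at x)" for t x
  proof -
    have "((\<lambda>y. (\<lambda>(t, x). f t x) (t, y)) has_derivative (\<lambda>h. D t x (0, h))) (at x)"
      by (rule has_derivative_compose[where f="\<lambda>y. (t, y)" and g="\<lambda>(t, x). f t x", OF _ D])
        (auto intro!: derivative_eq_intros)
    then show ?thesis by (simp only: case_prod_conv)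
  qed
  then show "f t differentiable at x" by (auto simp: differentiable_def)
  show dx: "dx j f t x = D t x (0, axis j 1)" for t x j
    unfolding dx_pd using pd_eqI[OF dxD] .
  have "isCont (\<lambda>(t, x). f t x) z" for z
    using has_derivative_continuous[OF D[of "fst z" "snd z"]] by simp
  then show "continuous_on UNIV (\<lambda>(t, x). f t x)" by (simp add: continuous_at_imp_continuous_on)
  show "continuous_on UNIV (\<lambda>(t, x). dt f t x)"
    using cD[of "(1, 0)"] unfolding dt D_def by (simp add: Basis_prod_def split_beta)
  show "continuous_on UNIV (\<lambda>(t, x). dx j f t x)"
    using cD[of "(0, axis j 1)"] unfolding dx D_def
    by (simp add: Basis_prod_def split_beta axis_in_Basis_iff)
qed

lemma abs_component_dist:
  "\<bar>t - s\<bar> \<le> dist (t, x) (s, y)" "\<bar>x $ j - y $ j\<bar> \<le> dist (t, x) (s, y)" for x y :: "real^3"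
proof -
  show "\<bar>t - s\<bar> \<le> dist (t, x) (s, y)"
    using dist_fst_le[of "(t, x)" "(s, y)"] by (simp add: dist_real_def)
  have "\<bar>x $ j - y $ j\<bar> \<le> dist x y"
    using component_le_norm_cart[of "x - y" j] by (simp add: dist_norm)
  also have "\<dots> \<le> dist (t, x) (s, y)" using dist_snd_le[of "(t, x)" "(s, y)"] by simp
  finally show "\<bar>x $ j - y $ j\<bar> \<le> dist (t, x) (s, y)" .
qed

text \<open>The operator norm of the space-time derivative is estimated by adding the four
  coordinate directions, one in time and three in space, each coordinate of a vector being at most
  its norm.\<close>

lemma Ck_st_1_lipschitz:
  fixes f :: "'a::real_normed_vector field"
  assumes f: "Ck_st 1 f" and B0: "\<And>t x. norm (dt f t x) \<le> B0" and B: "\<And>j t x. norm (dx j f t x) \<le> B"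
  shows "norm (f t x - f s y) \<le> (B0 + 3 * B) * dist (t, x) (s, y)"
proof -
  let ?f = "\<lambda>(t, x). f t x"
  define D where "D = (\<lambda>z. frechet_derivative ?f (at z))"
  have D: "(?f has_derivative D z) (at z)" for z
    using Ck_st_1D(1)[OF f, of "fst z" "snd z"] by (simp add: D_def)
  have "norm (D z h) \<le> (B0 + 3 * B) * norm h" for z h
  proof -
    obtain t x where z: "z = (t, x)" by (cases z)
    obtain a b where h: "h = (a, b)" by (cases h)
    have lin: "linear (D z)" using has_derivative_linear[OF D] .
    have "h = a *\<^sub>R (1, 0) + (\<Sum>j\<in>UNIV. (b $ j) *\<^sub>R (0, axis j 1))"
    proof -
      have "(\<Sum>j\<in>UNIV. (b $ j) *\<^sub>R (0::real, axis j 1::real^3)) = (0, \<Sum>j\<in>UNIV. (b $ j) *\<^sub>R axis j 1)"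
        by (simp add: prod_eq_iff fst_sum snd_sum)
      also have "(\<Sum>j\<in>UNIV. (b $ j) *\<^sub>R axis j 1) = b"
        using basis_expansion[of b] by (simp add: scalar_mult_eq_scaleR)
      finally show ?thesis by (simp add: h)
    qed
    then have "D z h = D z (a *\<^sub>R (1, 0) + (\<Sum>j\<in>UNIV. (b $ j) *\<^sub>R (0, axis j 1)))" by simp
    also have "\<dots> = a *\<^sub>R D z (1, 0) + (\<Sum>j\<in>UNIV. (b $ j) *\<^sub>R D z (0, axis j 1))"
      by (simp only: linear_add[OF lin] linear_sum[OF lin] linear_cmul[OF lin])
    finally have "norm (D z h) = norm (a *\<^sub>R D z (1, 0) + (\<Sum>j\<in>UNIV. (b $ j) *\<^sub>R D z (0, axis j 1)))" by simp
    also have "\<dots> \<le> norm (a *\<^sub>R D z (1, 0)) + (\<Sum>j\<in>UNIV. norm ((b $ j) *\<^sub>R D z (0, axis j 1)))"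
      by (intro norm_triangle_le add_mono order_refl norm_sum)
    also have "\<dots> \<le> norm h * B0 + (\<Sum>j\<in>(UNIV::3 set). norm h * B)"
    proof (intro add_mono sum_mono)
      have n: "\<bar>a\<bar> \<le> norm h" "\<bar>b $ j\<bar> \<le> norm h" for j
        using abs_component_dist[where t=a and s=0 and x=b and y=0] unfolding h by (simp_all add: dist_norm)
      show "norm (a *\<^sub>R D z (1, 0)) \<le> norm h * B0"
        using B0[of t x] n(1) unfolding Ck_st_1D(4)[OF f] norm_scaleR z D_def
        by (intro mult_mono) auto
      show "norm ((b $ j) *\<^sub>R D z (0, axis j 1)) \<le> norm h * B" for j
        using B[of j t x] n(2)[of j] unfolding Ck_st_1D(5)[OF f] norm_scaleR z D_def
        by (intro mult_mono) auto
    qed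
    finally show ?thesis by (simp add: algebra_simps)
  qed
  then have "onorm (D z) \<le> B0 + 3 * B" for z by (rule onorm_le)
  then have "norm (?f (t, x) - ?f (s, y)) \<le> (B0 + 3 * B) * norm ((t, x) - (s, y))"
    by (intro differentiable_bound[where S=UNIV and f'=D]) (auto intro: D)
  then show ?thesis by (simp add: dist_norm)
qed

section \<open>Time slices and differentiation under the torus integral\<close>

lemma continuous_on_slice:
  assumes "continuous_on UNIV (\<lambda>(t, x). X t x)"
  shows "continuous_on UNIV (X t)"
proof -
  have "continuous_on UNIV (\<lambda>x. (t, x))" by (intro continuous_intros)
  from continuous_on_compose2[OF assms this] show ?thesis by simp
qed

lemma torus_integral_leibniz:
  assumes d: "\<And>t x. ((\<lambda>s. X s x) has_vector_derivative X' t x) (at t)"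
    and cX: "continuous_on UNIV (\<lambda>(t, x). X t x)" and cX': "continuous_on UNIV (\<lambda>(t, x). X' t x)"
  shows "((\<lambda>t. torus_integral (X t)) has_vector_derivative torus_integral (X' t)) (at t)"
  unfolding torus_integral_def
proof (rule leibniz_rule_vector_derivative[where U=UNIV])
  show "X s integrable_on cbox 0 1" for s
    by (intro torus_integrable continuous_on_slice[OF cX])
qed (auto intro: d continuous_on_subset[OF cX'])

lemma continuous_on_torus_integral:
  assumes "continuous_on UNIV (\<lambda>(t, x). X t x)"
  shows "continuous_on UNIV (\<lambda>t. torus_integral (X t))"
  unfolding torus_integral_def
  by (rule integral_continuous_on_param) (rule continuous_on_subset[OF assms], simp)

lemma per3_periodic: "periodic f \<Longrightarrow> per3 (f t)"
  by (auto simp: periodic_def per3_def)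

lemma per3_pd:
  assumes p: "per3 g" and d: "\<And>x. g differentiable at x"
  shows "per3 (pd j g)"
  unfolding per3_def
proof (intro allI impI)
  fix x k :: "real^3" assume k: "\<forall>i. k $ i \<in> \<int>"
  have "(g has_derivative frechet_derivative g (at (x + k))) (at (x + k))"
    using d frechet_derivative_works by blast
  then have "((\<lambda>y. g (y + k)) has_derivative frechet_derivative g (at (x + k))) (at x)"
    by (intro has_derivative_compose[where f="\<lambda>y. y + k" and f'="\<lambda>h. h" and g=g and x=x and s=UNIV])
      (auto intro!: derivative_eq_intros)
  moreover have "(\<lambda>y. g (y + k)) = g" using p k by (auto simp: per3_def)
  ultimately show "pd j g (x + k) = pd j g x" by (metis pd_eqI pd_def)
qed

lemma C1s_Ck_st: "periodic f \<Longrightarrow> Ck_st 1 f \<Longrightarrow> C1s (f t)"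
  using Ck_st_1D(3)[of f] continuous_on_slice[OF Ck_st_1D(8)[of f]]
  by (simp add: C1s_def per3_periodic dx_pd)

lemma C1s_Ck_space: "periodic f \<Longrightarrow> Ck_space 1 f \<Longrightarrow> C1s (f t)"
  using continuous_on_slice[of "dx _ f" t]
  by (simp add: C1s_def per3_periodic dx_pd)

text \<open>Order 2 of the levels enters here: the slices of the velocity have C^1 first
  derivatives, as the curl identity \<open>scurl_adv\<close> requires.\<close>

lemma C1s_pd_Ck_space:
  assumes "periodic f" "Ck_space 2 f"
  shows "C1s (f t)" "C1s (pd i (f t))"
proof -
  have c1: "Ck_space 1 f" and c2: "Ck_space 1 (dx i f)" for i
    using assms(2) by (auto simp: numeral_2_eq_2)
  show f: "C1s (f t)" by (rule C1s_Ck_space[OF assms(1) c1])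
  have "periodic (dx i f)"
    using per3_pd[OF C1sD(1,2)[OF C1s_Ck_space[OF assms(1) c1]], where j=i]
    unfolding periodic_def per3_def dx_pd by blast
  then have "C1s (dx i f t)" by (rule C1s_Ck_space[OF _ c2])
  then show "C1s (pd i (f t))" by (simp add: dx_pd[abs_def])
qed

lemma norm_dx_le_nabla: "norm (dx i f t x) \<le> nabla_norm 1 f t x"
proof -
  have "finite {is :: 3 list. length is = 1}" using finite_lists_length_eq[of "UNIV :: 3 set" 1] by (simp only: finite subset_UNIV simp_thms)
  from member_le_L2_set[OF this, of "[i]" "\<lambda>is. norm (foldr dx is f t x)"]
  show ?thesis by (simp add: nabla_norm_def)
qed

lemma norm_le_3:
  fixes a :: "real^3"
  assumes "\<And>l. \<bar>a $ l\<bar> \<le> B"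
  shows "norm a \<le> 3 * B"
  using norm_le_l1_cart[of a] sum_mono[of UNIV "\<lambda>l. \<bar>a $ l\<bar>" "\<lambda>_. B"] assms by auto

section \<open>The cross term of the energy\<close>

definition divR :: "(real^3^3) field \<Rightarrow> (real^3) field" where
  "divR R t x = (\<chi> l. \<Sum>j\<in>UNIV. dx j R t x $ j $ l)"

text \<open>Incompressibility turns the divergence form of the nonlinearity into v . grad v.\<close>

lemma euler_reynolds_dt:
  assumes "euler_reynolds v p R"
  shows "dt v t x $ l = - adv (v t) (v t) x $ l - pd l (p t) x + divR R t x $ l"
proof -
  have per: "periodic v" "periodic p" "periodic R" and cv: "Ck_st 1 v" and cR: "Ck_space 1 R"
    and eq: "dt v t x $ l + (\<Sum>j\<in>UNIV. dx j (\<lambda>t x. v t x $ j * v t x $ l) t x) + dx l p t x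
              = (\<Sum>j\<in>UNIV. dx j (\<lambda>t x. R t x $ j $ l) t x)"
    and div: "(\<Sum>j\<in>UNIV. dx j (\<lambda>t x. v t x $ j) t x) = 0"
    using assms by (auto simp: euler_reynolds_def)
  have V: "C1s (v t)" and R: "C1s (R t)" by (intro C1s_Ck_st C1s_Ck_space per cv cR)+
  have "dx j (\<lambda>t x. v t x $ j * v t x $ l) t x = v t x $ j * dx j v t x $ l + dx j (\<lambda>t x. v t x $ j) t x * v t x $ l" for j
    using V by (simp add: dx_pd pd_mult pd_nth C1sD differentiable_nth)
  then have "(\<Sum>j\<in>UNIV. dx j (\<lambda>t x. v t x $ j * v t x $ l) t x)
      = (\<Sum>j\<in>UNIV. v t x $ j * dx j v t x $ l) + (\<Sum>j\<in>UNIV. dx j (\<lambda>t x. v t x $ j) t x) * v t x $ l"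
    by (simp add: sum.distrib sum_distrib_right)
  also have "\<dots> = adv (v t) (v t) x $ l" using div by (simp add: adv_def dx_pd)
  finally have A: "(\<Sum>j\<in>UNIV. dx j (\<lambda>t x. v t x $ j * v t x $ l) t x) = adv (v t) (v t) x $ l" .
  have "dx j (\<lambda>t x. R t x $ j $ l) t x = dx j R t x $ j $ l" for j
    using R by (simp add: dx_pd pd_nth differentiable_nth C1sD)
  then have "(\<Sum>j\<in>UNIV. dx j (\<lambda>t x. R t x $ j $ l) t x) = divR R t x $ l" by (simp add: divR_def)
  with eq A show ?thesis by (simp add: dx_pd)
qed

lemma euler_reynolds_div:
  assumes "euler_reynolds v p R"
  shows "(\<Sum>j\<in>UNIV. pd j (v t) x $ j) = 0"
proof -
  have "C1s (v t)" using assms by (auto simp: euler_reynolds_def intro: C1s_Ck_st)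
  then have "pd j (v t) x $ j = dx j (\<lambda>t x. v t x $ j) t x" for j
    by (simp add: dx_pd pd_nth C1sD)
  then show ?thesis using assms by (simp add: euler_reynolds_def)
qed

text \<open>Removes the pressure from the energy balance; with a test function in the role of
  \<open>p\<close> it also gives the weak incompressibility of every stage.\<close>

lemma torus_integral_grad_div_free:
  assumes p: "C1s p" and V: "C1s V" and div: "\<And>x. (\<Sum>j\<in>UNIV. pd j V x $ j) = 0"
  shows "torus_integral (\<lambda>x. \<Sum>l\<in>UNIV. pd l p x * V x $ l) = 0"
proof -
  note [continuous_intros] = C1sD(3,4)[OF p] C1sD(3,4)[OF V]
  have "torus_integral (\<lambda>x. \<Sum>l\<in>UNIV. pd l p x * V x $ l)
      = (\<Sum>l\<in>UNIV. torus_integral (\<lambda>x. pd l p x * V x $ l))"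
    by (intro torus_integral_sum continuous_intros) auto
  also have "\<dots> = (\<Sum>l\<in>UNIV. - torus_integral (\<lambda>x. p x * pd l V x $ l))"
    using torus_integral_by_parts[OF p C1s_nth[OF V]] by (simp add: pd_nth C1sD[OF V])
  also have "\<dots> = - torus_integral (\<lambda>x. \<Sum>l\<in>UNIV. p x * pd l V x $ l)"
    unfolding sum_negf by (subst torus_integral_sum) (auto intro!: continuous_intros)
  also have "\<dots> = 0"
    unfolding sum_distrib_left[symmetric] div by (simp add: torus_integral_const)
  finally show ?thesis .
qed

lemma advect_adv: "advect v f t x = dt f t x + adv (v t) (f t) x"
  by (simp add: advect_def adv_def dx_pd)

lemma continuous_on_snd_slice:
  "continuous_on UNIV g \<Longrightarrow> continuous_on UNIV (\<lambda>(s::real, x). g x)"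
  unfolding split_beta by (rule continuous_on_compose2[of UNIV g]) (auto intro: continuous_intros)

lemma continuous_on_adv:
  assumes "continuous_on UNIV U" "continuous_on UNIV X" "\<And>j. continuous_on UNIV (pd j X)"
  shows "continuous_on UNIV (adv U X)"
  unfolding adv_def by (intro continuous_intros assms)

lemma continuous_on_curl_defect:
  assumes "C1s U" "\<And>i. C1s (pd i U)"
  shows "continuous_on UNIV (curl_defect U)"
proof -
  have "curl_defect U = (\<lambda>x. scurl (adv U U) x - adv U (scurl U) x)"
    using scurl_adv[OF assms] by auto
  then show ?thesis
    using C1sD(3)[OF C1s_adv[OF assms]] C1sD(3,4)[OF C1s_scurl[OF assms(2)]] C1sD(4)[OF assms(1)]
    by (auto intro!: continuous_on_diff continuous_on_scurl continuous_on_adv)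
qed

lemma continuous_on_divR:
  assumes "Ck_space 1 R"
  shows "continuous_on UNIV (divR R t)"
proof -
  have "continuous_on UNIV (dx j R t)" for j
    using assms continuous_on_slice[of "dx j R" t] by simp
  then show ?thesis unfolding divR_def
    by (intro continuous_on_vec_lambda continuous_on_sum continuous_on_component)
qed

text \<open>
  Moving the curl from \<open>W\<close> onto \<open>v\<close> gains the factor by which \<open>W\<close> is smaller than \<open>V\<close>. As \<open>W\<close> is only
  $C^1$, the derivative $\partial_t V = \partial_t \nabla \times W$ is first moved outside the integral, with
  \<open>v\<close> frozen at time \<open>t\<close>.
\<close>

lemma cross_energy_derivative:
  assumes ER: "euler_reynolds v p R" and v2: "Ck_space 2 v"
    and perV: "periodic V" and V1: "Ck_st 1 V" and perW: "periodic W" and W1: "Ck_st 1 W"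
    and VW: "V = curl W" and divV: "\<And>t x. (\<Sum>j\<in>UNIV. pd j (V t) x $ j) = 0"
  defines "F' \<equiv> \<lambda>t. torus_integral (\<lambda>x. scurl (v t) x \<bullet> advect v W t x)
      - torus_integral (\<lambda>x. curl_defect (v t) x \<bullet> W t x) + torus_integral (\<lambda>x. divR R t x \<bullet> V t x)"
  shows "((\<lambda>t. torus_integral (\<lambda>x. v t x \<bullet> V t x)) has_vector_derivative F' t) (at t)"
    and "continuous_on UNIV F'"
proof -
  have perv: "periodic v" and v1: "Ck_st 1 v" and perp: "periodic p" and p1: "Ck_space 1 p"
    and R1: "Ck_space 1 R"
    using ER by (auto simp: euler_reynolds_def)
  have cv: "C1s (v t)" and cv2: "C1s (pd i (v t))" for t i using C1s_pd_Ck_space[OF perv v2] by auto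
  have cV: "C1s (V t)" and cW: "C1s (W t)" for t using C1s_Ck_st perV V1 perW W1 by auto
  have cp: "C1s (p t)" for t using C1s_Ck_space perp p1 by auto
  have cdt: "continuous_on UNIV (dt f t)" if "Ck_st 1 f" for f :: "(real^3) field" and t
    using Ck_st_1D(7)[OF that] by (rule continuous_on_slice)
  have joint: "continuous_on UNIV (\<lambda>z. f (fst z) (snd z))" "continuous_on UNIV (\<lambda>z. dt f (fst z) (snd z))"
    if "Ck_st 1 f" for f :: "(real^3) field"
    using Ck_st_1D(6,7)[OF that] by (auto simp: split_beta)
  note cs = C1sD(4)[OF cv] C1sD(3)[OF cv] C1sD(4)[OF cV] C1sD(4)[OF cW] C1sD(3)[OF cW]
    cdt[OF v1] cdt[OF V1] cdt[OF W1] C1sD(3)[OF cp] continuous_on_divR[OF R1]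
    continuous_on_curl_defect[OF cv cv2]
    continuous_on_scurl[OF C1sD(3)[OF cv]]
    continuous_on_adv[OF C1sD(4)[OF cv] C1sD(4)[OF cv] C1sD(3)[OF cv]]
    continuous_on_adv[OF C1sD(4)[OF cv] C1sD(4)[OF cW] C1sD(3)[OF cW]]
  have VW': "V t x = scurl (W t) x" for t x
    unfolding VW using C1sD(2)[OF cW] by (rule curl_eq_scurl)
  have step1: "torus_integral (\<lambda>x. v t x \<bullet> dt V t x) = torus_integral (\<lambda>x. scurl (v t) x \<bullet> dt W t x)" for t
  proof -
    have 1: "((\<lambda>s. torus_integral (\<lambda>x. v t x \<bullet> V s x)) has_vector_derivative torus_integral (\<lambda>x. v t x \<bullet> dt V s x)) (at s)" for s
    proof (rule torus_integral_leibniz)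
      show "((\<lambda>s. v t x \<bullet> V s x) has_vector_derivative v t x \<bullet> dt V s x) (at s)" for s x
        by (rule bounded_linear.has_vector_derivative[OF bounded_linear_inner_right Ck_st_1D(2)[OF V1]])
      show "continuous_on UNIV (\<lambda>(s, x). v t x \<bullet> V s x)" "continuous_on UNIV (\<lambda>(s, x). v t x \<bullet> dt V s x)"
        using continuous_on_snd_slice[OF C1sD(4)[OF cv], of t]
        by (auto simp: split_beta intro!: continuous_on_inner joint V1)
    qed
    have 2: "((\<lambda>s. torus_integral (\<lambda>x. scurl (v t) x \<bullet> W s x)) has_vector_derivative torus_integral (\<lambda>x. scurl (v t) x \<bullet> dt W s x)) (at s)" for s
    proof (rule torus_integral_leibniz)
      show "((\<lambda>s. scurl (v t) x \<bullet> W s x) has_vector_derivative scurl (v t) x \<bullet> dt W s x) (at s)" for s x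
        by (rule bounded_linear.has_vector_derivative[OF bounded_linear_inner_right Ck_st_1D(2)[OF W1]])
      show "continuous_on UNIV (\<lambda>(s, x). scurl (v t) x \<bullet> W s x)" "continuous_on UNIV (\<lambda>(s, x). scurl (v t) x \<bullet> dt W s x)"
        using continuous_on_snd_slice[OF continuous_on_scurl[OF C1sD(3)[OF cv]], of t]
        by (auto simp: split_beta intro!: continuous_on_inner joint W1)
    qed
    have eq: "(\<lambda>s. torus_integral (\<lambda>x. v t x \<bullet> V s x)) = (\<lambda>s. torus_integral (\<lambda>x. scurl (v t) x \<bullet> W s x))"
      unfolding VW' using torus_integral_scurl[OF cv cW] by blast
    show ?thesis by (rule vector_derivative_unique_at[OF 1[of t, unfolded eq] 2[of t]])
  qed
  \<comment> \<open>The equation for \<open>dt v\<close> is inserted: the pressure gradient is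
    orthogonal to \<open>V\<close>, and the nonlinear term is handed to
    \<open>torus_integral_adv_scurl\<close>, since \<open>V\<close> is a curl.\<close>
  have step2: "torus_integral (\<lambda>x. dt v t x \<bullet> V t x)
      = - torus_integral (\<lambda>x. curl_defect (v t) x \<bullet> W t x)
        + torus_integral (\<lambda>x. scurl (v t) x \<bullet> adv (v t) (W t) x)
        + torus_integral (\<lambda>x. divR R t x \<bullet> V t x)" for t
  proof -
    have "dt v t x \<bullet> V t x = divR R t x \<bullet> V t x - adv (v t) (v t) x \<bullet> V t x
        - (\<Sum>l\<in>UNIV. pd l (p t) x * V t x $ l)" for x
      unfolding inner_vec_def by (simp add: euler_reynolds_dt[OF ER] algebra_simps sum.distrib sum_subtractf)
    then have "torus_integral (\<lambda>x. dt v t x \<bullet> V t x)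
      = torus_integral (\<lambda>x. divR R t x \<bullet> V t x) - torus_integral (\<lambda>x. adv (v t) (v t) x \<bullet> V t x)
        - torus_integral (\<lambda>x. \<Sum>l\<in>UNIV. pd l (p t) x * V t x $ l)"
      by (simp add: torus_integral_diff continuous_on_diff continuous_on_inner continuous_on_sum
          continuous_on_mult continuous_on_component cs)
    also have "torus_integral (\<lambda>x. \<Sum>l\<in>UNIV. pd l (p t) x * V t x $ l) = 0"
      by (rule torus_integral_grad_div_free[OF cp cV divV])
    also have "torus_integral (\<lambda>x. adv (v t) (v t) x \<bullet> V t x)
        = torus_integral (\<lambda>x. curl_defect (v t) x \<bullet> W t x) - torus_integral (\<lambda>x. scurl (v t) x \<bullet> adv (v t) (W t) x)"
      unfolding VW' by (rule torus_integral_adv_scurl[OF cv cv2 cW euler_reynolds_div[OF ER]])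
    finally show ?thesis by simp
  qed
  let ?X' = "\<lambda>t x. v t x \<bullet> dt V t x + dt v t x \<bullet> V t x"
  \<comment> \<open>\<open>dt W\<close> from the first step and \<open>adv (v t) (W t)\<close> from
    the second are paired with the same \<open>scurl (v t)\<close>, so they combine to
    \<open>advect v W\<close>, which the correction estimates control.\<close>
  have F': "F' t = torus_integral (?X' t)" for t
  proof -
    have "torus_integral (?X' t) = torus_integral (\<lambda>x. scurl (v t) x \<bullet> dt W t x)
       + (- torus_integral (\<lambda>x. curl_defect (v t) x \<bullet> W t x)
        + torus_integral (\<lambda>x. scurl (v t) x \<bullet> adv (v t) (W t) x)
        + torus_integral (\<lambda>x. divR R t x \<bullet> V t x))"
      by (subst torus_integral_add) (simp_all only: step1 step2 continuous_on_inner cs)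
    moreover have "torus_integral (\<lambda>x. scurl (v t) x \<bullet> advect v W t x)
      = torus_integral (\<lambda>x. scurl (v t) x \<bullet> dt W t x) + torus_integral (\<lambda>x. scurl (v t) x \<bullet> adv (v t) (W t) x)"
      unfolding advect_adv inner_add_right by (rule torus_integral_add) (intro continuous_on_inner cs)+
    ultimately show ?thesis by (simp add: F'_def)
  qed
  have cX': "continuous_on UNIV (\<lambda>(t, x). ?X' t x)"
    by (auto simp: split_beta intro!: continuous_on_inner continuous_on_add joint v1 V1)
  show "((\<lambda>t. torus_integral (\<lambda>x. v t x \<bullet> V t x)) has_vector_derivative F' t) (at t)"
    unfolding F'
  proof (rule torus_integral_leibniz[OF _ _ cX'])
    show "((\<lambda>s. v s x \<bullet> V s x) has_vector_derivative ?X' t x) (at t)" for t x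
      by (rule bounded_bilinear.has_vector_derivative[OF bounded_bilinear_inner Ck_st_1D(2)[OF v1] Ck_st_1D(2)[OF V1]])
    show "continuous_on UNIV (\<lambda>(t, x). v t x \<bullet> V t x)"
      by (auto simp: split_beta intro!: continuous_on_inner joint v1 V1)
  qed
  show "continuous_on UNIV F'"
    unfolding F' by (rule continuous_on_torus_integral[OF cX'])
qed

lemma abs_inner_le:
  fixes a b :: "'a::real_inner"
  assumes "norm a \<le> A" "norm b \<le> B"
  shows "\<bar>a \<bullet> b\<bar> \<le> A * B"
  using Cauchy_Schwarz_ineq2[of a b] mult_mono[OF assms order.trans[OF norm_ge_zero assms(1)] norm_ge_zero] by linarith

text \<open>The constants count terms: a component of the curl has two derivatives, a component of
  \<open>curl_defect\<close> three times two products, a component of the divergence three summands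
  of size \<open>r\<close>. Passing from components to the norm costs a factor 3.\<close>

lemma cross_energy_derivative_bound:
  assumes ER: "euler_reynolds v p R" and v2: "Ck_space 2 v"
    and V1: "periodic V" "Ck_st 1 V" and W1: "periodic W" "Ck_st 1 W"
    and G: "\<And>i t x. norm (dx i v t x) \<le> G" and a: "\<And>t x. norm (advect v W t x) \<le> a"
    and w: "\<And>t x. norm (W t x) \<le> w" and r: "\<And>i t x. norm (dx i R t x) \<le> r" and b: "\<And>t x. norm (V t x) \<le> b"
  shows "\<bar>torus_integral (\<lambda>x. scurl (v t) x \<bullet> advect v W t x)
      - torus_integral (\<lambda>x. curl_defect (v t) x \<bullet> W t x) + torus_integral (\<lambda>x. divR R t x \<bullet> V t x)\<bar>
    \<le> 6 * G * a + 18 * G\<^sup>2 * w + 9 * r * b"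
proof -
  have perv: "periodic v" and v1: "Ck_st 1 v" and R1: "Ck_space 1 R"
    using ER by (auto simp: euler_reynolds_def)
  have cv: "C1s (v t)" and cv2: "C1s (pd i (v t))" for i using C1s_pd_Ck_space[OF perv v2] by auto
  have cV: "C1s (V t)" and cW: "C1s (W t)" using C1s_Ck_st V1 W1 by auto
  have cdt: "continuous_on UNIV (dt W t)"
    using Ck_st_1D(7)[OF W1(2)] by (rule continuous_on_slice)
  note cs = continuous_on_divR[OF R1] continuous_on_curl_defect[OF cv cv2]
    continuous_on_scurl[OF C1sD(3)[OF cv]] C1sD(4)[OF cV] C1sD(4)[OF cW] cdt
    continuous_on_adv[OF C1sD(4)[OF cv] C1sD(4)[OF cW] C1sD(3)[OF cW]]
  have g: "\<bar>pd i (v t) x $ l\<bar> \<le> G" for i l x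
    using component_le_norm_cart[of "pd i (v t) x" l] G[of i t x] by (simp add: dx_pd)
  have G0: "0 \<le> G" using g[of 1 0 1] by linarith
  have "\<bar>scurl (v t) x $ l\<bar> \<le> 2 * G" for x l
  proof -
    have "\<bar>pd i (v t) x $ k - pd j (v t) x $ m\<bar> \<le> 2 * G" for i j k m
      using g[of i x k] g[of j x m] by linarith
    then show ?thesis using exhaust_3[of l] by (elim disjE) (simp_all only: scurl_nth)
  qed
  then have n1: "norm (scurl (v t) x) \<le> 6 * G" for x using norm_le_3[of "scurl (v t) x" "2 * G"] by simp
  have "\<bar>curl_defect (v t) x $ l\<bar> \<le> 6 * G\<^sup>2" for x l
  proof -
    have gg: "\<bar>pd i (v t) x $ j * pd j (v t) x $ k\<bar> \<le> G\<^sup>2" for i j k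
      unfolding abs_mult power2_eq_square by (intro mult_mono g G0) simp
    have "\<bar>\<Sum>j\<in>UNIV. pd i (v t) x $ j * pd j (v t) x $ k - pd m (v t) x $ j * pd j (v t) x $ n\<bar> \<le> 6 * G\<^sup>2" for i k m n
    proof -
      have "\<bar>pd i (v t) x $ j * pd j (v t) x $ k - pd m (v t) x $ j * pd j (v t) x $ n\<bar> \<le> 2 * G\<^sup>2" for j
        using gg[of i j k] gg[of m j n] by linarith
      then have "(\<Sum>j\<in>UNIV. \<bar>pd i (v t) x $ j * pd j (v t) x $ k - pd m (v t) x $ j * pd j (v t) x $ n\<bar>)
          \<le> (\<Sum>j\<in>(UNIV :: 3 set). 2 * G\<^sup>2)" by (intro sum_mono)
      from order.trans[OF sum_abs this] show ?thesis by simp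
    qed
    then show ?thesis using exhaust_3[of l] unfolding curl_defect_def by (elim disjE) (simp_all only: vector_3)
  qed
  then have n2: "norm (curl_defect (v t) x) \<le> 18 * G\<^sup>2" for x using norm_le_3[of "curl_defect (v t) x" "6 * G\<^sup>2"] by simp
  have "\<bar>divR R t x $ l\<bar> \<le> 3 * r" for x l
  proof -
    have "\<bar>dx j R t x $ j $ l\<bar> \<le> r" for j
      using component_le_norm_cart[of "dx j R t x $ j" l] Finite_Cartesian_Product.norm_nth_le[of "dx j R t x" j] r[of j t x] by linarith
    then have "(\<Sum>j\<in>UNIV. \<bar>dx j R t x $ j $ l\<bar>) \<le> (\<Sum>j\<in>(UNIV::3 set). r)" by (intro sum_mono)
    from order.trans[OF sum_abs this] show ?thesis by (simp add: divR_def)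
  qed
  then have n3: "norm (divR R t x) \<le> 9 * r" for x using norm_le_3[of "divR R t x" "3 * r"] by simp
  have "\<bar>torus_integral (\<lambda>x. scurl (v t) x \<bullet> advect v W t x)\<bar> \<le> (6 * G) * a"
    by (intro torus_integral_bound abs_inner_le n1 a) (unfold advect_adv, intro continuous_on_inner continuous_on_add cs)
  moreover have "\<bar>torus_integral (\<lambda>x. curl_defect (v t) x \<bullet> W t x)\<bar> \<le> (18 * G\<^sup>2) * w"
    by (intro torus_integral_bound abs_inner_le n2 w continuous_on_inner cs)
  moreover have "\<bar>torus_integral (\<lambda>x. divR R t x \<bullet> V t x)\<bar> \<le> (9 * r) * b"
    by (intro torus_integral_bound abs_inner_le n3 b continuous_on_inner cs)
  ultimately show ?thesis by linarith
qed

section \<open>Weak limits of Euler--Reynolds flows\<close>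

lemma cbox_time_cube: "{-T..T} \<times> cbox 0 (1::real^3) = cbox (-T, 0) (T::real, 1)"
  by (auto simp: cbox_Pair_eq)

text \<open>Compact support in time replaces the unbounded slab by a box, where continuity is enough
  to iterate the integral.\<close>

lemma integral_spacetime:
  fixes f :: "real field"
  assumes c: "continuous_on UNIV (\<lambda>(t, x). f t x)" and z: "\<And>t x. \<bar>t\<bar> > T \<Longrightarrow> f t x = 0"
  shows "integral (UNIV \<times> cbox 0 1) (\<lambda>(t, x). f t x) = integral {-T..T} (\<lambda>t. torus_integral (f t))"
proof -
  have "integral (UNIV \<times> cbox 0 1) (\<lambda>(t, x). f t x)
      = integral UNIV (\<lambda>z. if z \<in> UNIV \<times> cbox 0 1 then (\<lambda>(t, x). f t x) z else 0)"
    by (rule integral_restrict_UNIV[symmetric])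
  also have "\<dots> = integral UNIV (\<lambda>z. if z \<in> {-T..T} \<times> cbox 0 1 then (\<lambda>(t, x). f t x) z else 0)"
    using z by (intro arg_cong[where f="integral UNIV"] ext) (force simp: abs_if split: if_splits)
  also have "\<dots> = integral (cbox (-T, 0) (T, 1)) (\<lambda>(t, x). f t x)"
    unfolding cbox_time_cube by (rule integral_restrict_UNIV)
  also have "\<dots> = integral (cbox (-T) T) (\<lambda>t. integral (cbox 0 1) (\<lambda>x. (\<lambda>(t, x). f t x) (t, x)))"
    by (rule integral_prod_continuous) (rule continuous_on_subset[OF c], simp)
  finally show ?thesis by (simp add: torus_integral_def)
qed

lemma time_integral_bound:
  assumes c: "continuous_on UNIV (\<lambda>(t, x). f t x)" and T: "0 \<le> T"
    and B: "\<And>t x. \<bar>t\<bar> \<le> T \<Longrightarrow> x \<in> cbox 0 1 \<Longrightarrow> \<bar>f t x\<bar> \<le> B" and per: "periodic f"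
  shows "\<bar>integral {-T..T} (\<lambda>t. torus_integral (f t))\<bar> \<le> 2 * T * B"
proof -
  have "\<bar>torus_integral (f t)\<bar> \<le> B" if "t \<in> {-T..T}" for t
  proof -
    have "f t integrable_on cbox 0 1" by (intro torus_integrable continuous_on_slice[OF c])
    moreover have "(\<lambda>x. B) integrable_on cbox 0 (1::real^3)" by (intro torus_integrable continuous_intros)
    moreover have "norm (f t x) \<le> B" if "x \<in> cbox 0 1" for x
      using that B[of t x] \<open>t \<in> {-T..T}\<close> by auto
    ultimately have "norm (integral (cbox 0 1) (f t)) \<le> integral (cbox 0 1) (\<lambda>x::real^3. B)"
      by (rule Henstock_Kurzweil_Integration.integral_norm_bound_integral)
    then show ?thesis using torus_integral_const[of B] by (simp only: torus_integral_def real_norm_def)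
  qed
  then have "norm (integral {-T..T} (\<lambda>t. torus_integral (f t))) \<le> B * (T - - T)"
    using T by (intro integral_bound continuous_on_subset[OF continuous_on_torus_integral[OF c]]) auto
  then show ?thesis by (simp add: algebra_simps)
qed

definition momentum_integrand :: "(real^3) field \<Rightarrow> real field \<Rightarrow> real field \<Rightarrow> 3 \<Rightarrow> real field" where
  "momentum_integrand v p \<phi> l t x = v t x $ l * dt \<phi> t x
     + (\<Sum>j\<in>UNIV. v t x $ j * v t x $ l * dx j \<phi> t x) + p t x * dx l \<phi> t x"

lemma continuous_on_momentum_integrand:
  assumes v: "continuous_on UNIV (\<lambda>(t, x). v t x)" and p: "continuous_on UNIV (\<lambda>(t, x). p t x)"
    and \<phi>: "Ck_st 1 \<phi>"
  shows "continuous_on UNIV (\<lambda>(t, x). momentum_integrand v p \<phi> l t x)"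
proof -
  note v[unfolded split_beta, continuous_intros] p[unfolded split_beta, continuous_intros]
    Ck_st_1D(6-8)[OF \<phi>, unfolded split_beta, continuous_intros]
  show ?thesis unfolding momentum_integrand_def split_beta by (intro continuous_intros)
qed

lemma test_functionD:
  assumes "test_function \<phi>"
  obtains T where "0 \<le> T" "\<And>t x. \<bar>t\<bar> \<ge> T \<Longrightarrow> \<phi> t x = 0" "\<And>t x. \<bar>t\<bar> > T \<Longrightarrow> dt \<phi> t x = 0"
    "\<And>t x j. \<bar>t\<bar> > T \<Longrightarrow> dx j \<phi> t x = 0"
proof -
  obtain T0 where T0: "\<And>t x. \<bar>t\<bar> > T0 \<Longrightarrow> \<phi> t x = 0" using assms by (auto simp: test_function_def)
  have c1: "Ck_st 1 \<phi>" using assms by (auto simp: test_function_def)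
  \<comment> \<open>The margin 1 makes \<phi> vanish at the end points \<open>T\<close> and
    \<open>-T\<close> themselves, so that integrating a time derivative leaves no boundary
    terms.\<close>
  define T where "T = max T0 0 + 1"
  have T: "0 \<le> T" "\<And>t x. \<bar>t\<bar> \<ge> T \<Longrightarrow> \<phi> t x = 0" using T0 by (auto simp: T_def)
  show ?thesis
  proof (rule that[OF T])
    fix t x assume t: "\<bar>t\<bar> > T"
    have "((\<lambda>s. \<phi> s x) has_vector_derivative 0) (at t)"
    proof (rule has_vector_derivative_transform_within_open[of "\<lambda>_. 0" _ _ "{s. \<bar>s\<bar> > T}"])
      show "open {s. \<bar>s\<bar> > T}" by (intro open_Collect_less continuous_intros)
    qed (use t T in auto)
    then show "dt \<phi> t x = 0" unfolding dt_def by (rule vector_derivative_at)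
  next
    fix t x j assume t: "\<bar>t\<bar> > T"
    have "\<phi> t = (\<lambda>_. 0)" using T(2) t by auto
    then show "dx j \<phi> t x = 0" by (simp add: dx_def)
  qed
qed

text \<open>A classical flow satisfies the weak momentum equation up to its stress paired with the
  gradient of \<phi>: what else occurs is the time derivative of the integral of
  \<open>v t x $ l * \<phi> t x\<close>, and exact spatial derivatives.\<close>

lemma momentum_integrand_reynolds:
  assumes ER: "euler_reynolds v p R" and \<phi>: "test_function \<phi>"
    and T: "0 \<le> T" "\<And>t x. \<bar>t\<bar> \<ge> T \<Longrightarrow> \<phi> t x = 0"
  shows "integral {-T..T} (\<lambda>t. torus_integral (momentum_integrand v p \<phi> l t))
    = integral {-T..T} (\<lambda>t. torus_integral (\<lambda>x. \<Sum>j\<in>UNIV. R t x $ j $ l * dx j \<phi> t x))"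
proof -
  have per: "periodic v" "periodic p" "periodic R" and v1: "Ck_st 1 v" and p1: "Ck_space 1 p" and R1: "Ck_space 1 R"
    using ER by (auto simp: euler_reynolds_def)
  have \<phi>1: "Ck_st 1 \<phi>" and per\<phi>: "periodic \<phi>" using \<phi> by (auto simp: test_function_def)
  have cv: "C1s (v t)" and cp: "C1s (p t)" and cR: "C1s (R t)" and c\<phi>: "C1s (\<phi> t)" for t
    using C1s_Ck_st C1s_Ck_space per v1 p1 R1 per\<phi> \<phi>1 by blast+
  have jv: "continuous_on UNIV (\<lambda>(t, x). v t x)" and jp: "continuous_on UNIV (\<lambda>(t, x). p t x)"
    and jR: "continuous_on UNIV (\<lambda>(t, x). R t x)"
    using Ck_st_1D(6)[OF v1] p1 R1 by auto
  define Q where "Q t x = (\<Sum>j\<in>UNIV. R t x $ j $ l * dx j \<phi> t x)" for t x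
  have jQ: "continuous_on UNIV (\<lambda>(t, x). Q t x)"
  proof -
    note jR[unfolded split_beta, continuous_intros] Ck_st_1D(6-8)[OF \<phi>1, unfolded split_beta, continuous_intros]
    show ?thesis unfolding Q_def split_beta by (intro continuous_intros)
  qed
  have jM: "continuous_on UNIV (\<lambda>(t, x). momentum_integrand v p \<phi> l t x)"
    by (rule continuous_on_momentum_integrand[OF jv jp \<phi>1])
  let ?X' = "\<lambda>t x. v t x $ l * dt \<phi> t x + dt v t x $ l * \<phi> t x"
  have jX': "continuous_on UNIV (\<lambda>(t, x). ?X' t x)"
  proof -
    note Ck_st_1D(6-8)[OF v1, unfolded split_beta, continuous_intros] Ck_st_1D(6-8)[OF \<phi>1, unfolded split_beta, continuous_intros]
    show ?thesis unfolding split_beta by (intro continuous_intros)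
  qed
  have G: "((\<lambda>t. torus_integral (\<lambda>x. v t x $ l * \<phi> t x)) has_vector_derivative torus_integral (?X' t)) (at t)" for t
  proof (rule torus_integral_leibniz[OF _ _ jX'])
    show "((\<lambda>s. v s x $ l * \<phi> s x) has_vector_derivative ?X' t x) (at t)" for t x
      by (rule has_vector_derivative_mult[OF bounded_linear.has_vector_derivative[OF bounded_linear_vec_nth Ck_st_1D(2)[OF v1]] Ck_st_1D(2)[OF \<phi>1]])
    note Ck_st_1D(6-8)[OF v1, unfolded split_beta, continuous_intros] Ck_st_1D(6-8)[OF \<phi>1, unfolded split_beta, continuous_intros]
    show "continuous_on UNIV (\<lambda>(t, x). v t x $ l * \<phi> t x)" unfolding split_beta by (intro continuous_intros)
  qed
  have key: "torus_integral (momentum_integrand v p \<phi> l t) - torus_integral (Q t) = torus_integral (?X' t)" for t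
  proof -
    note [continuous_intros] = C1sD(3,4)[OF cv] C1sD(3,4)[OF cp] C1sD(3,4)[OF cR] C1sD(3,4)[OF c\<phi>]
      continuous_on_slice[OF Ck_st_1D(7)[OF v1]] continuous_on_slice[OF Ck_st_1D(7)[OF \<phi>1]]
    \<comment> \<open>The momentum flux minus the stress, and the pressure, each multiplied by
      \<phi> and differentiated: exact derivatives, whose integrals vanish.\<close>
    let ?T = "\<lambda>j x. pd j (\<lambda>x. (v t x $ j * v t x $ l - R t x $ j $ l) * \<phi> t x) x"
    let ?P = "\<lambda>x. pd l (\<lambda>x. p t x * \<phi> t x) x"
    have T: "?T j x = (v t x $ j * v t x $ l - R t x $ j $ l) * dx j \<phi> t x
        + (v t x $ j * pd j (v t) x $ l + pd j (v t) x $ j * v t x $ l - pd j (R t) x $ j $ l) * \<phi> t x" for j x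
    proof -
      have d: "(\<lambda>x. v t x $ j * v t x $ l) differentiable at x" "(\<lambda>x. R t x $ j $ l) differentiable at x"
        using C1sD(2)[OF C1s_mult[OF C1s_nth[OF cv] C1s_nth[OF cv]]] C1sD(2)[OF C1s_nth[OF C1s_nth[OF cR]]] by auto
      show ?thesis
        by (subst pd_mult, intro differentiable_diff d, rule C1sD(2)[OF c\<phi>], subst pd_diff[OF d])
          (simp add: pd_mult pd_nth differentiable_nth C1sD(2)[OF cv] C1sD(2)[OF cR] dx_pd)
    qed
    have P: "?P x = p t x * dx l \<phi> t x + pd l (p t) x * \<phi> t x" for x
      by (simp add: pd_mult C1sD(2)[OF cp] C1sD(2)[OF c\<phi>] dx_pd)
    have cT: "continuous_on UNIV (?T j)" for j unfolding T dx_pd by (intro continuous_intros)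
    have cP: "continuous_on UNIV ?P" unfolding P dx_pd by (intro continuous_intros)
    have z: "torus_integral (?T j) = 0" for j
      by (intro torus_integral_pd C1s_mult C1s_diff C1s_nth cv cR c\<phi>)
    have zP: "torus_integral ?P = 0" by (intro torus_integral_pd C1s_mult cp c\<phi>)
    have S: "(\<Sum>j\<in>UNIV. ?T j x) + ?P x
        = (\<Sum>j\<in>UNIV. v t x $ j * v t x $ l * dx j \<phi> t x) - Q t x + p t x * dx l \<phi> t x - dt v t x $ l * \<phi> t x" for x
    proof -
      have "(\<Sum>j\<in>UNIV. ?T j x) = (\<Sum>j\<in>UNIV. v t x $ j * v t x $ l * dx j \<phi> t x) - Q t x
          + ((\<Sum>j\<in>UNIV. v t x $ j * pd j (v t) x $ l) + (\<Sum>j\<in>UNIV. pd j (v t) x $ j) * v t x $ l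
            - (\<Sum>j\<in>UNIV. pd j (R t) x $ j $ l)) * \<phi> t x"
        unfolding T Q_def by (simp add: algebra_simps sum.distrib sum_subtractf sum_distrib_left sum_distrib_right)
      moreover have "dt v t x $ l = - (\<Sum>j\<in>UNIV. v t x $ j * pd j (v t) x $ l) - pd l (p t) x + (\<Sum>j\<in>UNIV. pd j (R t) x $ j $ l)"
        unfolding euler_reynolds_dt[OF ER] by (simp add: adv_def divR_def dx_pd)
      ultimately show ?thesis by (simp only: P euler_reynolds_div[OF ER]) (simp add: algebra_simps)
    qed
    have "torus_integral (momentum_integrand v p \<phi> l t) - torus_integral (Q t)
        = torus_integral (\<lambda>x. momentum_integrand v p \<phi> l t x - Q t x)"
      by (rule torus_integral_diff[symmetric]) (intro continuous_on_slice[OF jM] continuous_on_slice[OF jQ])+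
    also have "\<dots> = torus_integral (\<lambda>x. ?X' t x + ((\<Sum>j\<in>UNIV. ?T j x) + ?P x))"
      unfolding S momentum_integrand_def by (intro arg_cong[where f=torus_integral] ext) (simp add: algebra_simps)
    also have "\<dots> = torus_integral (?X' t) + torus_integral (\<lambda>x. (\<Sum>j\<in>UNIV. ?T j x) + ?P x)"
      by (rule torus_integral_add) (intro continuous_intros cT cP)+
    also have "torus_integral (\<lambda>x. (\<Sum>j\<in>UNIV. ?T j x) + ?P x) = torus_integral (\<lambda>x. \<Sum>j\<in>UNIV. ?T j x) + torus_integral ?P"
      by (rule torus_integral_add) (intro continuous_on_sum cT cP)+
    also have "torus_integral (\<lambda>x. \<Sum>j\<in>UNIV. ?T j x) = (\<Sum>j\<in>UNIV. torus_integral (?T j))"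
      by (intro torus_integral_sum finite cT)
    finally show ?thesis by (simp add: z zP)
  qed
  have "((\<lambda>t. torus_integral (?X' t)) has_integral
     torus_integral (\<lambda>x. v T x $ l * \<phi> T x) - torus_integral (\<lambda>x. v (-T) x $ l * \<phi> (-T) x)) {-T..T}"
    using T(1) by (intro fundamental_theorem_of_calculus has_vector_derivative_at_within[OF G]) auto
  moreover have "\<phi> T = (\<lambda>_. 0)" "\<phi> (-T) = (\<lambda>_. 0)" using T by auto
  ultimately have "((\<lambda>t. torus_integral (?X' t)) has_integral 0) {-T..T}"
    by (simp add: torus_integral_const)
  then have "0 = integral {-T..T} (\<lambda>t. torus_integral (momentum_integrand v p \<phi> l t) - torus_integral (Q t))"
    unfolding key by (simp add: integral_unique)
  also have "\<dots> = integral {-T..T} (\<lambda>t. torus_integral (momentum_integrand v p \<phi> l t)) - integral {-T..T} (\<lambda>t. torus_integral (Q t))"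
    by (intro Henstock_Kurzweil_Integration.integral_diff integrable_continuous_real
        continuous_on_subset[OF continuous_on_torus_integral] jM jQ) auto
  finally show ?thesis by (simp add: Q_def[abs_def])
qed

lemma periodicI: "(\<And>t x k. \<forall>i. k $ i \<in> \<int> \<Longrightarrow> f t (x + k) = f t x) \<Longrightarrow> periodic f"
  by (simp add: periodic_def)

lemma periodicD: "periodic f \<Longrightarrow> \<forall>i. k $ i \<in> \<int> \<Longrightarrow> f t (x + k) = f t x"
  by (simp add: periodic_def)

lemma integral_le_eventually_zero:
  assumes "\<And>k. \<bar>I\<bar> \<le> (b k :: real)" "b \<longlonglongrightarrow> 0"
  shows "I = 0"
  using LIMSEQ_le_const[OF assms(2), of "\<bar>I\<bar>"] assms(1) by auto

text \<open>All derivatives fall on the test function and the nonlinearity is quadratic, so uniform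
  convergence of velocity and pressure with a common velocity bound \<open>M\<close> suffices. What
  separates each stage from a weak solution is its stress, of size \<open>r k\<close>.\<close>

lemma weak_euler_limit:
  fixes vs :: "nat \<Rightarrow> (real^3) field" and ps :: "nat \<Rightarrow> real field"
  assumes ER: "\<And>k. euler_reynolds (vs k) (ps k) (Rs k)"
    and M: "\<And>k t x. norm (vs k t x) \<le> M" "\<And>t x. norm (v t x) \<le> M"
    and va: "\<And>k t x. norm (vs k t x - v t x) \<le> a k" and pb: "\<And>k t x. norm (ps k t x - p t x) \<le> b k"
    and Rr: "\<And>k t x. norm (Rs k t x) \<le> r k"
    and lim: "a \<longlonglongrightarrow> 0" "b \<longlonglongrightarrow> 0" "r \<longlonglongrightarrow> 0"
  shows "weak_euler v p" and "continuous_on UNIV (\<lambda>(t, x). v t x)" and "continuous_on UNIV (\<lambda>(t, x). p t x)"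
proof -
  have perk: "periodic (vs k)" "periodic (ps k)" and vk1: "Ck_st 1 (vs k)" and pk1: "Ck_space 1 (ps k)"
    and Rk1: "Ck_space 1 (Rs k)" for k
    using ER[of k] by (auto simp: euler_reynolds_def)
  have limv: "(\<lambda>k. vs k t x) \<longlonglongrightarrow> v t x" for t x
    using va by (intro LIM_zero_cancel[OF tendsto_0_le[OF lim(1), of _ 1]]) (auto simp: order.trans[OF _ abs_ge_self])
  have limp: "(\<lambda>k. ps k t x) \<longlonglongrightarrow> p t x" for t x
    using pb by (intro LIM_zero_cancel[OF tendsto_0_le[OF lim(2), of _ 1]]) (auto simp: order.trans[OF _ abs_ge_self])
  have perv: "periodic v" unfolding periodic_def
  proof (intro allI impI)
    fix t x and k :: "real^3" assume "\<forall>i. k $ i \<in> \<int>"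
    then have "(\<lambda>n. vs n t (x + k)) = (\<lambda>n. vs n t x)" using perk(1) by (auto simp: periodic_def)
    with limv[of t "x + k"] limv[of t x] show "v t (x + k) = v t x" using LIMSEQ_unique by metis
  qed
  have perp: "periodic p" unfolding periodic_def
  proof (intro allI impI)
    fix t x and k :: "real^3" assume "\<forall>i. k $ i \<in> \<int>"
    then have "(\<lambda>n. ps n t (x + k)) = (\<lambda>n. ps n t x)" using perk(2) by (auto simp: periodic_def)
    with limp[of t "x + k"] limp[of t x] show "p t (x + k) = p t x" using LIMSEQ_unique by metis
  qed
  have uv: "uniform_limit UNIV (\<lambda>k (t, x). vs k t x) (\<lambda>(t, x). v t x) sequentially"
    unfolding uniform_limit_iff
  proof (intro allI impI)
    fix e :: real assume "e > 0"
    from order_tendstoD(2)[OF lim(1) this]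
    show "\<forall>\<^sub>F k in sequentially. \<forall>z\<in>UNIV. dist (case z of (t, x) \<Rightarrow> vs k t x) (case z of (t, x) \<Rightarrow> v t x) < e"
      by eventually_elim (auto simp: dist_norm intro: le_less_trans[OF va])
  qed
  show cv: "continuous_on UNIV (\<lambda>(t, x). v t x)"
    by (rule uniform_limit_theorem[OF _ uv]) (auto simp: Ck_st_1D(6)[OF vk1])
  have up: "uniform_limit UNIV (\<lambda>k (t, x). ps k t x) (\<lambda>(t, x). p t x) sequentially"
    unfolding uniform_limit_iff
  proof (intro allI impI)
    fix e :: real assume "e > 0"
    from order_tendstoD(2)[OF lim(2) this]
    show "\<forall>\<^sub>F k in sequentially. \<forall>z\<in>UNIV. dist (case z of (t, x) \<Rightarrow> ps k t x) (case z of (t, x) \<Rightarrow> p t x) < e"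
      by eventually_elim (auto simp: dist_norm intro: le_less_trans[OF pb[unfolded real_norm_def]])
  qed
  show cp: "continuous_on UNIV (\<lambda>(t, x). p t x)"
    by (rule uniform_limit_theorem[OF _ up]) (use pk1 in auto)
  have int: "(\<lambda>(t, x). v t x) absolutely_integrable_on ({-T..T} \<times> cbox 0 1) \<and>
      (\<lambda>(t, x). (norm (v t x))\<^sup>2) absolutely_integrable_on ({-T..T} \<times> cbox 0 1) \<and>
      (\<lambda>(t, x). p t x) absolutely_integrable_on ({-T..T} \<times> cbox 0 1)" for T
    unfolding cbox_time_cube
  proof (intro conjI absolutely_integrable_continuous)
    note v[continuous_intros] = cv[unfolded split_beta]
    have "continuous_on UNIV (\<lambda>(t, x). (norm (v t x))\<^sup>2)" unfolding split_beta by (intro continuous_intros)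
    then show "continuous_on (cbox (-T, 0) (T, 1)) (\<lambda>(t, x). (norm (v t x))\<^sup>2)" by (rule continuous_on_subset) simp
  qed (auto intro: continuous_on_subset[OF cv] continuous_on_subset[OF cp])
  have bound: "\<exists>B. \<forall>t x. \<bar>t\<bar> \<le> T \<longrightarrow> x \<in> cbox 0 1 \<longrightarrow> \<bar>dt \<phi> t x\<bar> \<le> B \<and> (\<forall>j. \<bar>dx j \<phi> t x\<bar> \<le> B)"
    if \<phi>: "Ck_st 1 \<phi>" for \<phi> :: "real field" and T
  proof -
    have bd: "\<exists>B. \<forall>t x. \<bar>t\<bar> \<le> T \<longrightarrow> x \<in> cbox 0 1 \<longrightarrow> \<bar>f t x\<bar> \<le> B"
      if f: "continuous_on UNIV (\<lambda>(t, x). f t x)" for f :: "real field"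
    proof -
      have "compact ((\<lambda>(t, x). f t x) ` cbox (-T, 0) (T, 1))"
        by (intro compact_continuous_image continuous_on_subset[OF f]) auto
      then obtain B where B: "\<And>z. z \<in> cbox (-T, 0) (T, 1) \<Longrightarrow> norm (case z of (t, x) \<Rightarrow> f t x) \<le> B"
        using compact_imp_bounded bounded_iff by (metis imageI)
      have "\<bar>f t x\<bar> \<le> B" if "\<bar>t\<bar> \<le> T" "x \<in> cbox 0 1" for t x
        using B[of "(t, x)"] that by (auto simp: cbox_Pair_eq abs_le_iff)
      then show ?thesis by blast
    qed
    obtain B0 where B0: "\<And>t x. \<bar>t\<bar> \<le> T \<Longrightarrow> x \<in> cbox 0 1 \<Longrightarrow> \<bar>dt \<phi> t x\<bar> \<le> B0"
      using bd[OF Ck_st_1D(7)[OF \<phi>]] by blast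
    have "\<forall>j. \<exists>B. \<forall>t x. \<bar>t\<bar> \<le> T \<longrightarrow> x \<in> cbox 0 1 \<longrightarrow> \<bar>dx j \<phi> t x\<bar> \<le> B"
      using bd[OF Ck_st_1D(8)[OF \<phi>]] by blast
    then obtain Bj where Bj: "\<And>j t x. \<bar>t\<bar> \<le> T \<Longrightarrow> x \<in> cbox 0 1 \<Longrightarrow> \<bar>dx j \<phi> t x\<bar> \<le> Bj j"
      by metis
    define B where "B = Max (insert B0 (range Bj))"
    have "B0 \<le> B" "Bj j \<le> B" for j unfolding B_def by (rule Max_ge; simp)+
    then show ?thesis using B0 Bj by (intro exI[of _ B]) (meson order.trans)
  qed
  have mom: "integral (UNIV \<times> cbox 0 1) (\<lambda>(t, x). momentum_integrand v p \<phi> l t x) = 0" if \<phi>: "test_function \<phi>" for \<phi> l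
  proof -
    obtain T where T: "0 \<le> T" "\<And>t x. \<bar>t\<bar> \<ge> T \<Longrightarrow> \<phi> t x = 0" "\<And>t x. \<bar>t\<bar> > T \<Longrightarrow> dt \<phi> t x = 0"
      "\<And>t x j. \<bar>t\<bar> > T \<Longrightarrow> dx j \<phi> t x = 0" using test_functionD[OF \<phi>] by metis
    have \<phi>1: "Ck_st 1 \<phi>" and per\<phi>: "periodic \<phi>" using \<phi> by (auto simp: test_function_def)
    obtain B where B: "\<And>t x. \<bar>t\<bar> \<le> T \<Longrightarrow> x \<in> cbox 0 1 \<Longrightarrow> \<bar>dt \<phi> t x\<bar> \<le> B"
      "\<And>t x j. \<bar>t\<bar> \<le> T \<Longrightarrow> x \<in> cbox 0 1 \<Longrightarrow> \<bar>dx j \<phi> t x\<bar> \<le> B"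
      using bound[OF \<phi>1, of T] by metis
    have B0: "0 \<le> B" using B(1)[of 0 0] T(1) by (auto simp: mem_box_cart)
    have cm: "continuous_on UNIV (\<lambda>(t, x). momentum_integrand v p \<phi> l t x)"
      by (rule continuous_on_momentum_integrand[OF cv cp \<phi>1])
    have cmk: "continuous_on UNIV (\<lambda>(t, x). momentum_integrand (vs k) (ps k) \<phi> l t x)" for k
      by (rule continuous_on_momentum_integrand[OF Ck_st_1D(6)[OF vk1] _ \<phi>1]) (use pk1 in auto)
    let ?I = "integral {-T..T} (\<lambda>t. torus_integral (momentum_integrand v p \<phi> l t))"
    have I: "integral (UNIV \<times> cbox 0 1) (\<lambda>(t, x). momentum_integrand v p \<phi> l t x) = ?I"
      by (rule integral_spacetime[OF cm]) (simp add: momentum_integrand_def T)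
    have a0: "0 \<le> a k" for k using order.trans[OF norm_ge_zero va] by blast
    have M0: "0 \<le> M" using order.trans[OF norm_ge_zero M(2)] by blast
    \<comment> \<open>The first summand compares the integrands of stage \<open>k\<close> and of the
      limit, with the quadratic term split as a difference of products; the second is the stress
      remaining at stage \<open>k\<close>.\<close>
    have "\<bar>?I\<bar> \<le> 2 * T * (a k * B + 3 * (2 * M * a k * B) + b k * B) + 2 * T * (3 * (r k * B))" for k
    proof -
      let ?J = "integral {-T..T} (\<lambda>t. torus_integral (momentum_integrand (vs k) (ps k) \<phi> l t))"
      let ?d = "\<lambda>t x. momentum_integrand (vs k) (ps k) \<phi> l t x - momentum_integrand v p \<phi> l t x"
      have cd: "continuous_on UNIV (\<lambda>(t, x). ?d t x)"
        using continuous_on_diff[OF cmk cm] by (simp add: split_beta)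
      have "\<bar>integral {-T..T} (\<lambda>t. torus_integral (?d t))\<bar> \<le> 2 * T * (a k * B + 3 * (2 * M * a k * B) + b k * B)"
      proof (rule time_integral_bound[OF cd T(1)])
        fix t x assume tx: "\<bar>t\<bar> \<le> T" "x \<in> cbox 0 (1::real^3)"
        have vc: "\<bar>vs k t x $ j - v t x $ j\<bar> \<le> a k" for j
          using component_le_norm_cart[of "vs k t x - v t x" j] va[of k t x] by simp
        have vM: "\<bar>vs k t x $ j\<bar> \<le> M" "\<bar>v t x $ j\<bar> \<le> M" for j
          by (rule order.trans[OF component_le_norm_cart M(1)], rule order.trans[OF component_le_norm_cart M(2)])
        have 1: "\<bar>(vs k t x $ l - v t x $ l) * dt \<phi> t x\<bar> \<le> a k * B"
          unfolding abs_mult by (intro mult_mono vc B tx a0) simp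
        have 2: "\<bar>(vs k t x $ j * vs k t x $ l - v t x $ j * v t x $ l) * dx j \<phi> t x\<bar> \<le> 2 * M * a k * B" for j
        proof -
          have "vs k t x $ j * vs k t x $ l - v t x $ j * v t x $ l
            = vs k t x $ j * (vs k t x $ l - v t x $ l) + (vs k t x $ j - v t x $ j) * v t x $ l"
            by (simp add: algebra_simps)
          also have "\<bar>\<dots>\<bar> \<le> M * a k + a k * M"
            by (intro order.trans[OF abs_triangle_ineq] add_mono; unfold abs_mult; intro mult_mono vc vM a0 M0) auto
          finally show ?thesis unfolding abs_mult
            using a0[of k] M0 by (intro mult_mono B tx) (auto simp: algebra_simps)
        qed
        have 3: "\<bar>(ps k t x - p t x) * dx l \<phi> t x\<bar> \<le> b k * B"
          unfolding abs_mult using pb[of k t x] order.trans[OF norm_ge_zero pb]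
          by (intro mult_mono B tx) auto
        have "?d t x = (vs k t x $ l - v t x $ l) * dt \<phi> t x
            + (\<Sum>j\<in>UNIV. (vs k t x $ j * vs k t x $ l - v t x $ j * v t x $ l) * dx j \<phi> t x)
            + (ps k t x - p t x) * dx l \<phi> t x"
          by (simp add: momentum_integrand_def algebra_simps sum_subtractf)
        also have "\<bar>\<dots>\<bar> \<le> a k * B + (\<Sum>j\<in>(UNIV::3 set). 2 * M * a k * B) + b k * B"
          by (intro order.trans[OF abs_triangle_ineq] add_mono 1 3 order.trans[OF sum_abs] sum_mono 2)
        finally show "\<bar>?d t x\<bar> \<le> a k * B + 3 * (2 * M * a k * B) + b k * B" by simp
      next
        have "periodic (dt \<phi>)" "periodic (dx j \<phi>)" for j
        proof -
          show "periodic (dt \<phi>)" using per\<phi> by (simp add: periodic_def dt_def)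
          show "periodic (dx j \<phi>)"
            using per3_pd[OF per3_periodic[OF per\<phi>] Ck_st_1D(3)[OF \<phi>1]]
            unfolding periodic_def dx_pd per3_def by blast
        qed
        then show "periodic ?d"
          by (intro periodicI) (simp add: momentum_integrand_def periodicD perk perv perp)
      qed
      moreover have "integral {-T..T} (\<lambda>t. torus_integral (?d t)) = ?J - ?I"
      proof -
        have "torus_integral (?d t) = torus_integral (momentum_integrand (vs k) (ps k) \<phi> l t) - torus_integral (momentum_integrand v p \<phi> l t)" for t
          by (rule torus_integral_diff[OF continuous_on_slice[OF cmk] continuous_on_slice[OF cm]])
        then have "integral {-T..T} (\<lambda>t. torus_integral (?d t)) = integral {-T..T} (\<lambda>t.
            torus_integral (momentum_integrand (vs k) (ps k) \<phi> l t) - torus_integral (momentum_integrand v p \<phi> l t))"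
          by presburger
        also have "\<dots> = ?J - ?I"
          by (intro Henstock_Kurzweil_Integration.integral_diff integrable_continuous_real
            continuous_on_subset[OF continuous_on_torus_integral] cm cmk) auto
        finally show ?thesis .
      qed
      moreover have "?J = integral {-T..T} (\<lambda>t. torus_integral (\<lambda>x. \<Sum>j\<in>UNIV. Rs k t x $ j $ l * dx j \<phi> t x))"
        by (rule momentum_integrand_reynolds[OF ER \<phi> T(1)]) (rule T(2))
      moreover have "\<bar>integral {-T..T} (\<lambda>t. torus_integral (\<lambda>x. \<Sum>j\<in>UNIV. Rs k t x $ j $ l * dx j \<phi> t x))\<bar> \<le> 2 * T * (3 * (r k * B))"
      proof (rule time_integral_bound[where f="\<lambda>t x. \<Sum>j\<in>UNIV. Rs k t x $ j $ l * dx j \<phi> t x", OF _ T(1)])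
        note [continuous_intros] = Ck_st_1D(8)[OF \<phi>1, unfolded split_beta]
        have "continuous_on UNIV (\<lambda>z. Rs k (fst z) (snd z))" using Rk1[of k] by (simp add: split_beta)
        note [continuous_intros] = this
        show "continuous_on UNIV (\<lambda>(t, x). \<Sum>j\<in>UNIV. Rs k t x $ j $ l * dx j \<phi> t x)"
          unfolding split_beta by (intro continuous_intros)
      next
        fix t x assume tx: "\<bar>t\<bar> \<le> T" "x \<in> cbox 0 (1::real^3)"
        have "\<bar>Rs k t x $ j $ l * dx j \<phi> t x\<bar> \<le> r k * B" for j
          unfolding abs_mult
          using component_le_norm_cart[of "Rs k t x $ j" l] Finite_Cartesian_Product.norm_nth_le[of "Rs k t x" j] Rr[of k t x]
          by (intro mult_mono B tx) auto
        then have "(\<Sum>j\<in>UNIV. \<bar>Rs k t x $ j $ l * dx j \<phi> t x\<bar>) \<le> (\<Sum>j\<in>(UNIV::3 set). r k * B)"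
          by (intro sum_mono)
        from order.trans[OF sum_abs this]
        show "\<bar>\<Sum>j\<in>UNIV. Rs k t x $ j $ l * dx j \<phi> t x\<bar> \<le> 3 * (r k * B)" by simp
      next
        have "periodic (dx j \<phi>)" for j
          using per3_pd[OF per3_periodic[OF per\<phi>] Ck_st_1D(3)[OF \<phi>1]]
          unfolding periodic_def dx_pd per3_def by blast
        moreover have "periodic (Rs k)" using ER[of k] by (simp add: euler_reynolds_def)
        ultimately show "periodic (\<lambda>t x. \<Sum>j\<in>UNIV. Rs k t x $ j $ l * dx j \<phi> t x)"
          by (intro periodicI) (simp add: periodicD)
      qed
      ultimately show ?thesis by linarith
    qed
    then have "?I = 0"
      by (rule integral_le_eventually_zero) (auto intro!: tendsto_eq_intros lim)
    with I show ?thesis by simp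
  qed
  have divz: "integral (UNIV \<times> cbox 0 1) (\<lambda>(t, x). \<Sum>j\<in>UNIV. v t x $ j * dx j \<phi> t x) = 0" if \<phi>: "test_function \<phi>" for \<phi>
  proof -
    obtain T where T: "\<And>t x j. \<bar>t\<bar> > T \<Longrightarrow> dx j \<phi> t x = 0" using test_functionD[OF \<phi>] by metis
    have \<phi>1: "Ck_st 1 \<phi>" and per\<phi>: "periodic \<phi>" using \<phi> by (auto simp: test_function_def)
    have c\<phi>: "C1s (\<phi> t)" for t using C1s_Ck_st per\<phi> \<phi>1 by blast
    note [continuous_intros] = Ck_st_1D(8)[OF \<phi>1, unfolded split_beta] cv[unfolded split_beta]
    have c: "continuous_on UNIV (\<lambda>(t, x). \<Sum>j\<in>UNIV. v t x $ j * dx j \<phi> t x)"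
      unfolding split_beta by (intro continuous_intros)
    \<comment> \<open>Incompressibility passes to the limit at each time separately, by uniform
      convergence on the cube.\<close>
    have z: "torus_integral (\<lambda>x. \<Sum>j\<in>UNIV. v t x $ j * dx j \<phi> t x) = 0" for t
    proof -
      have czk: "torus_integral (\<lambda>x. \<Sum>j\<in>UNIV. vs k t x $ j * dx j \<phi> t x) = 0" for k
        using torus_integral_grad_div_free[OF c\<phi> C1s_Ck_st[OF perk(1) vk1] euler_reynolds_div[OF ER]]
        by (simp add: dx_pd mult.commute)
      have "bounded (pd j (\<phi> t) ` cbox 0 1)" for j
        by (intro compact_imp_bounded compact_continuous_image continuous_on_subset[OF C1sD(3)[OF c\<phi>]]) auto
      then have "\<forall>j. \<exists>B. \<forall>x\<in>cbox 0 1. \<bar>pd j (\<phi> t) x\<bar> \<le> B" by (auto simp: bounded_iff)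
      then obtain B where B: "\<And>j x. x \<in> cbox 0 1 \<Longrightarrow> \<bar>pd j (\<phi> t) x\<bar> \<le> B j" by metis
      have u: "uniform_limit (cbox 0 1) (\<lambda>k x. \<Sum>j\<in>UNIV. vs k t x $ j * dx j \<phi> t x)
          (\<lambda>x. \<Sum>j\<in>UNIV. v t x $ j * dx j \<phi> t x) sequentially"
        unfolding uniform_limit_iff
      proof (intro allI impI)
        fix e :: real assume e: "e > 0"
        have "(\<lambda>k. (\<Sum>j\<in>UNIV. a k * B j)) \<longlonglongrightarrow> 0"
          by (auto intro!: tendsto_eq_intros lim)
        from order_tendstoD(2)[OF this e]
        show "\<forall>\<^sub>F k in sequentially. \<forall>x\<in>cbox 0 1. dist (\<Sum>j\<in>UNIV. vs k t x $ j * dx j \<phi> t x)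
            (\<Sum>j\<in>UNIV. v t x $ j * dx j \<phi> t x) < e"
        proof (eventually_elim, intro ballI)
          fix k and x :: "real^3" assume s: "(\<Sum>j\<in>UNIV. a k * B j) < e" and x: "x \<in> cbox 0 1"
          have "\<bar>(vs k t x $ j - v t x $ j) * dx j \<phi> t x\<bar> \<le> a k * B j" for j
            unfolding abs_mult dx_pd
            using component_le_norm_cart[of "vs k t x - v t x" j] va[of k t x] norm_ge_zero[of "vs k t x - v t x"]
            by (intro mult_mono B x) auto
          then have "(\<Sum>j\<in>UNIV. \<bar>(vs k t x $ j - v t x $ j) * dx j \<phi> t x\<bar>) \<le> (\<Sum>j\<in>UNIV. a k * B j)"
            by (intro sum_mono)
          from order.trans[OF sum_abs this] s
          show "dist (\<Sum>j\<in>UNIV. vs k t x $ j * dx j \<phi> t x) (\<Sum>j\<in>UNIV. v t x $ j * dx j \<phi> t x) < e"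
            by (simp add: dist_real_def sum_subtractf[symmetric] left_diff_distrib)
        qed
      qed
      obtain I J where IJ: "\<And>k. ((\<lambda>x. \<Sum>j\<in>UNIV. vs k t x $ j * dx j \<phi> t x) has_integral I k) (cbox 0 1)"
        "((\<lambda>x. \<Sum>j\<in>UNIV. v t x $ j * dx j \<phi> t x) has_integral J) (cbox 0 1)" "I \<longlonglongrightarrow> J"
      proof (rule uniform_limit_integral_cbox[OF u])
        show "continuous_on (cbox 0 1) (\<lambda>x. \<Sum>j\<in>UNIV. vs k t x $ j * dx j \<phi> t x)" for k
          unfolding dx_pd
          by (intro continuous_on_sum continuous_on_mult continuous_on_component
              continuous_on_subset[OF C1sD(4)[OF C1s_Ck_st[OF perk(1) vk1]]] continuous_on_subset[OF C1sD(3)[OF c\<phi>]]) auto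
      qed auto
      have "I = (\<lambda>_. 0)" using czk integral_unique[OF IJ(1)] by (auto simp: torus_integral_def)
      with IJ(3) have "J = 0" by (simp add: LIMSEQ_const_iff)
      then show ?thesis using integral_unique[OF IJ(2)] by (simp add: torus_integral_def)
    qed
    have "integral (UNIV \<times> cbox 0 1) (\<lambda>(t, x). \<Sum>j\<in>UNIV. v t x $ j * dx j \<phi> t x)
        = integral {-T..T} (\<lambda>t. torus_integral (\<lambda>x. \<Sum>j\<in>UNIV. v t x $ j * dx j \<phi> t x))"
      by (rule integral_spacetime[OF c]) (simp add: T)
    then show ?thesis by (simp add: z)
  qed
  show "weak_euler v p"
    unfolding weak_euler_def using perv perp int mom[unfolded momentum_integrand_def] divz by blast
qed

section \<open>Hoelder series and cutoffs in time\<close>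

text \<open>An increment of a term is at most twice its sup bound and at most its Lipschitz constant
  times the distance; the geometric mean of the two, with weights 1 - \<alpha> and \<alpha>, is the
  summable Hoelder bound.\<close>

lemma holder_series:
  fixes U :: "nat \<Rightarrow> 'a::banach field"
  assumes \<alpha>: "0 < \<alpha>" "\<alpha> < 1"
    and A: "\<And>k t x. norm (U k t x) \<le> A k"
    and L: "\<And>k t x s y. norm (U k t x - U k s y) \<le> L k * dist (t, x) (s, y)" and L0: "\<And>k. 0 \<le> L k"
    and sA: "summable A" and sL: "summable (\<lambda>k. A k powr (1 - \<alpha>) * L k powr \<alpha>)"
  shows "holder_st \<alpha> (\<lambda>t x. \<Sum>k. U k t x)"
proof -
  have A0: "0 \<le> A k" for k using order.trans[OF norm_ge_zero A] by blast
  have sU: "summable (\<lambda>k. norm (U k t x))" for t x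
    by (rule summable_comparison_test'[OF sA]) (simp add: A)
  define S where "S = 2 powr (1 - \<alpha>) * (\<Sum>k. A k powr (1 - \<alpha>) * L k powr \<alpha>)"
  have incr: "norm (U k t x - U k s y) \<le> 2 powr (1 - \<alpha>) * (A k powr (1 - \<alpha>) * L k powr \<alpha>) * dist (t, x) (s, y) powr \<alpha>"
    for k t x s y
  proof -
    let ?n = "norm (U k t x - U k s y)" and ?d = "dist (t, x) (s, y)"
    have n: "?n \<le> 2 * A k" using norm_triangle_ineq4[of "U k t x" "U k s y"] A[of k t x] A[of k s y] by linarith
    have "?n = ?n powr (1 - \<alpha>) * ?n powr \<alpha>"
      by (cases "?n = 0") (simp_all add: powr_add[symmetric])
    also have "\<dots> \<le> (2 * A k) powr (1 - \<alpha>) * (L k * ?d) powr \<alpha>"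
      using \<alpha> n L by (intro mult_mono powr_mono2) auto
    also have "\<dots> = 2 powr (1 - \<alpha>) * (A k powr (1 - \<alpha>) * L k powr \<alpha>) * ?d powr \<alpha>"
      using A0[of k] L0[of k] by (simp add: powr_mult)
    finally show ?thesis .
  qed
  have bound: "norm (\<Sum>k. U k t x) \<le> suminf A" for t x
  proof -
    have "(\<Sum>k. norm (U k t x)) \<le> suminf A" by (rule suminf_le) (rule A, rule sU, rule sA)
    with summable_norm[OF sU, of t x] show ?thesis by (rule order.trans)
  qed
  have diff: "norm ((\<Sum>k. U k t x) - (\<Sum>k. U k s y)) \<le> S * dist (t, x) (s, y) powr \<alpha>" for t x s y
  proof -
    have sm: "summable (\<lambda>k. 2 powr (1 - \<alpha>) * (A k powr (1 - \<alpha>) * L k powr \<alpha>) * dist (t, x) (s, y) powr \<alpha>)"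
      by (intro summable_mult summable_mult2 sL)
    have sd: "summable (\<lambda>k. norm (U k t x - U k s y))"
      by (rule summable_comparison_test'[OF sm]) (use incr in simp)
    have "(\<Sum>k. U k t x) - (\<Sum>k. U k s y) = (\<Sum>k. U k t x - U k s y)"
      by (rule suminf_diff[OF summable_norm_cancel[OF sU] summable_norm_cancel[OF sU]])
    also have "norm \<dots> \<le> (\<Sum>k. norm (U k t x - U k s y))" by (rule summable_norm[OF sd])
    also have "\<dots> \<le> (\<Sum>k. 2 powr (1 - \<alpha>) * (A k powr (1 - \<alpha>) * L k powr \<alpha>) * dist (t, x) (s, y) powr \<alpha>)"
      by (rule suminf_le) (rule incr, rule sd, rule sm)
    also have "\<dots> = S * dist (t, x) (s, y) powr \<alpha>"
      unfolding S_def by (simp only: suminf_mult2[OF summable_mult[OF sL], symmetric] suminf_mult[OF sL])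
    finally show ?thesis .
  qed
  show ?thesis unfolding holder_st_def C0_le_def
  proof (intro exI[of _ "max (suminf A) S"] conjI allI)
    show "norm (\<Sum>k. U k t x) \<le> max (suminf A) S" for t x using bound[of t x] by simp
    show "norm ((\<Sum>k. U k t x) - (\<Sum>k. U k s y)) \<le> max (suminf A) S * dist (t, x) (s, y) powr \<alpha>" for t x s y
      by (rule order.trans[OF diff mult_right_mono]) auto
  qed
qed

section \<open>Cutoffs in time and energy profiles\<close>

text \<open>A truncated power stays differentiable at 0 when its exponent is at least 2, the
  difference quotient there being dominated by a positive power of the increment. Used twice, it
  shows that truncated cubes are C^2.\<close>

lemma DERIV_max_0_power:
  "((\<lambda>z::real. (max 0 z) ^ Suc (Suc n)) has_real_derivative real (Suc (Suc n)) * (max 0 z) ^ Suc n) (at z)"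
proof (cases z "0::real" rule: linorder_cases)
  case less
  have "((\<lambda>z::real. 0) has_real_derivative 0) (at z)" by simp
  then show ?thesis
    by (rule has_field_derivative_transform_within_open[of _ _ _ "{..<0}", THEN DERIV_cong]) (use less in auto)
next
  case greater
  have "((\<lambda>z::real. z ^ Suc (Suc n)) has_real_derivative real (Suc (Suc n)) * z ^ Suc n) (at z)"
    using DERIV_pow[of "Suc (Suc n)" z] by simp
  then show ?thesis
    by (rule has_field_derivative_transform_within_open[of _ _ _ "{0<..}", THEN DERIV_cong]) (use greater in auto)
next
  case equal
  have "((\<lambda>h::real. \<bar>h\<bar> ^ Suc n) \<longlongrightarrow> 0) (at 0)"
    by (auto intro!: tendsto_eq_intros)
  then have "((\<lambda>h::real. max 0 h ^ Suc (Suc n) / h) \<longlongrightarrow> 0) (at 0)"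
  proof (rule tendsto_0_le[of _ _ _ 1], intro always_eventually allI)
    fix h :: real
    show "norm (max 0 h ^ Suc (Suc n) / h) \<le> norm (\<bar>h\<bar> ^ Suc n) * 1"
    proof (cases "h \<le> 0")
      case True
      then show ?thesis by (simp add: max_absorb1)
    next
      case False
      then show ?thesis by (simp add: max_absorb2)
    qed
  qed
  then show ?thesis by (simp add: DERIV_def equal)
qed

text \<open>A C^2 bump from truncated cubes: the inner ones act only beyond \<open>a\<close> and
  below \<open>- a\<close>, and the outer one smooths the place where 1 minus their sum reaches 0.
  Order C^2 is what \<open>energy_profile\<close> asks of the square root.\<close>

definition cutoff :: "real \<Rightarrow> real \<Rightarrow> real \<Rightarrow> real" where
  "cutoff a \<tau> t = (max 0 (1 - (max 0 ((t - a) / \<tau>)) ^ 3 - (max 0 ((- t - a) / \<tau>)) ^ 3)) ^ 3"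

text \<open>Where the inner function \<open>u\<close> is positive, it is at most 1, its first
  derivative is at most 3 / \<tau> and its second at most 12 / \<tau>^2. The chain rule for the
  outer cube gives 3 * 3 = 9 and 6 * 9 + 3 * 12 = 90, both below the 1000 allowed for an energy
  profile.\<close>

lemma cutoff_derivatives:
  assumes \<tau>: "0 < \<tau>"
  obtains \<psi>' \<psi>'' where "\<And>t. (cutoff a \<tau> has_real_derivative \<psi>' t) (at t)"
    "\<And>t. (\<psi>' has_real_derivative \<psi>'' t) (at t)" "continuous_on UNIV \<psi>''"
    "\<And>t. \<bar>\<psi>' t\<bar> \<le> 9 / \<tau>" "\<And>t. \<bar>\<psi>'' t\<bar> \<le> 90 / \<tau>\<^sup>2"
proof -
  define y z u u' u'' where "y t = max 0 ((t - a) / \<tau>)" and "z t = max 0 ((- t - a) / \<tau>)"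
    and "u t = 1 - y t ^ 3 - z t ^ 3" and "u' t = 3 * (z t ^ 2 - y t ^ 2) / \<tau>"
    and "u'' t = - (6 * (z t + y t)) / \<tau>\<^sup>2" for t
  have m3: "((\<lambda>x::real. max 0 x ^ 3) has_real_derivative 3 * max 0 x ^ 2) (at x)" for x
    using DERIV_max_0_power[of 1 x] by (simp add: numeral_eq_Suc)
  have m2: "((\<lambda>x::real. max 0 x ^ 2) has_real_derivative 2 * max 0 x) (at x)" for x
    using DERIV_max_0_power[of 0 x] by (simp add: numeral_eq_Suc)
  have ly: "((\<lambda>t. (t - a) / \<tau>) has_real_derivative 1 / \<tau>) (at t)"
    and lz: "((\<lambda>t. (- t - a) / \<tau>) has_real_derivative - 1 / \<tau>) (at t)" for t
    using \<tau> by (auto intro!: derivative_eq_intros)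
  have y3: "((\<lambda>t. y t ^ 3) has_real_derivative 3 * y t ^ 2 * (1 / \<tau>)) (at t)"
    and y2: "((\<lambda>t. y t ^ 2) has_real_derivative 2 * y t * (1 / \<tau>)) (at t)"
    and z3: "((\<lambda>t. z t ^ 3) has_real_derivative 3 * z t ^ 2 * (- 1 / \<tau>)) (at t)"
    and z2: "((\<lambda>t. z t ^ 2) has_real_derivative 2 * z t * (- 1 / \<tau>)) (at t)" for t
    unfolding y_def z_def by (rule DERIV_chain2[OF m3 ly] DERIV_chain2[OF m2 ly] DERIV_chain2[OF m3 lz] DERIV_chain2[OF m2 lz])+
  have du: "(u has_real_derivative u' t) (at t)" for t
    unfolding u_def u'_def using \<tau>
    by (intro DERIV_cong[OF DERIV_diff[OF DERIV_diff[OF DERIV_const y3] z3]]) (simp add: field_simps)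
  have du': "(u' has_real_derivative u'' t) (at t)" for t
    unfolding u'_def u''_def using \<tau>
    by (intro DERIV_cong[OF DERIV_cdivide[OF DERIV_cmult[OF DERIV_diff[OF z2 y2]]]])
      (simp add: field_simps power2_eq_square)
  have cut: "cutoff a \<tau> = (\<lambda>t. max 0 (u t) ^ 3)"
    by (auto simp: cutoff_def u_def y_def z_def)
  define \<psi>' \<psi>'' where "\<psi>' t = 3 * max 0 (u t) ^ 2 * u' t"
    and "\<psi>'' t = 6 * max 0 (u t) * (u' t)\<^sup>2 + 3 * max 0 (u t) ^ 2 * u'' t" for t
  have d1: "(cutoff a \<tau> has_real_derivative \<psi>' t) (at t)" for t
    unfolding cut \<psi>'_def by (rule DERIV_chain2[OF m3 du])
  have d2: "(\<psi>' has_real_derivative \<psi>'' t) (at t)" for t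
    unfolding \<psi>'_def \<psi>''_def
    by (rule DERIV_cong, rule DERIV_mult[OF DERIV_cmult[OF DERIV_chain2[OF m2 du]] du'])
      (simp add: power2_eq_square)
  have "continuous_on UNIV u" "continuous_on UNIV u'"
    using du du' by (auto intro: DERIV_isCont continuous_at_imp_continuous_on)
  moreover have "continuous_on UNIV u''"
    unfolding u''_def y_def z_def using \<tau> by (intro continuous_intros) auto
  ultimately have c: "continuous_on UNIV \<psi>''"
    unfolding \<psi>''_def by (intro continuous_intros)
  have yz0: "0 \<le> y t" "0 \<le> z t" for t by (auto simp: y_def z_def)
  have bounds: "\<bar>\<psi>' t\<bar> \<le> 9 / \<tau> \<and> \<bar>\<psi>'' t\<bar> \<le> 90 / \<tau>\<^sup>2" for t
  proof (cases "u t \<le> 0")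
    case True
    then show ?thesis using \<tau> by (simp add: \<psi>'_def \<psi>''_def)
  next
    case False
    have "y t ^ 3 \<le> 1 ^ 3" "z t ^ 3 \<le> 1 ^ 3"
      using False zero_le_power[OF yz0(1)[of t], of 3] zero_le_power[OF yz0(2)[of t], of 3] unfolding u_def power_one by linarith+
    then have yz1: "y t \<le> 1" "z t \<le> 1" using yz0 by (simp_all add: power_le_one_iff)
    have u1: "0 \<le> u t" "u t \<le> 1"
      using False zero_le_power[OF yz0(1)[of t], of 3] zero_le_power[OF yz0(2)[of t], of 3] unfolding u_def by linarith+
    then have mu: "max 0 (u t) = u t" by simp
    have uu: "u t ^ 2 \<le> 1" using u1 by (simp add: power_le_one)
    have sq: "y t ^ 2 \<le> 1" "z t ^ 2 \<le> 1" "0 \<le> y t ^ 2" "0 \<le> z t ^ 2" using yz0 yz1 by (auto simp: power_le_one)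
    have "\<bar>z t ^ 2 - y t ^ 2\<bar> \<le> 1" using sq by linarith
    then have bu': "\<bar>u' t\<bar> \<le> 3 / \<tau>"
      unfolding u'_def using \<tau> by (simp add: abs_mult field_simps)
    have bu'': "\<bar>u'' t\<bar> \<le> 12 / \<tau>\<^sup>2"
      unfolding u''_def using \<tau> yz0[of t] yz1 by (simp add: abs_mult divide_right_mono)
    have "\<bar>\<psi>' t\<bar> \<le> 3 * 1 * (3 / \<tau>)"
      unfolding \<psi>'_def mu abs_mult using uu bu' \<tau> by (intro mult_mono) auto
    moreover have "\<bar>\<psi>'' t\<bar> \<le> 6 * 1 * (3 / \<tau>)\<^sup>2 + 3 * 1 * (12 / \<tau>\<^sup>2)"
    proof -
      have "(u' t)\<^sup>2 \<le> (3 / \<tau>)\<^sup>2" using bu' \<tau> by (intro abs_le_square_iff[THEN iffD1]) auto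
      then have "\<bar>6 * u t * (u' t)\<^sup>2\<bar> \<le> 6 * 1 * (3 / \<tau>)\<^sup>2"
        unfolding abs_mult using u1 by (intro mult_mono) auto
      moreover have "\<bar>3 * u t ^ 2 * u'' t\<bar> \<le> 3 * 1 * (12 / \<tau>\<^sup>2)"
        unfolding abs_mult using uu bu'' \<tau> by (intro mult_mono) auto
      ultimately show ?thesis unfolding \<psi>''_def mu by linarith
    qed
    ultimately show ?thesis by (simp add: power_divide)
  qed
  show ?thesis by (rule that[OF d1 d2 c]) (use bounds in auto)
qed

lemma cutoff_bounds: "0 \<le> cutoff a \<tau> t" "cutoff a \<tau> t \<le> 1"
proof -
  let ?u = "max 0 (1 - (max 0 ((t - a) / \<tau>)) ^ 3 - (max 0 ((- t - a) / \<tau>)) ^ 3)"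
  have "0 \<le> (max 0 ((t - a) / \<tau>)) ^ 3" "0 \<le> (max 0 ((- t - a) / \<tau>)) ^ 3" by simp_all
  then have "1 - (max 0 ((t - a) / \<tau>)) ^ 3 - (max 0 ((- t - a) / \<tau>)) ^ 3 \<le> 1" by linarith
  then have "?u \<le> 1" by (intro max.boundedI) auto
  then show "0 \<le> cutoff a \<tau> t" "cutoff a \<tau> t \<le> 1"
    unfolding cutoff_def by (auto intro!: power_le_one)
qed

lemma cutoff_eq_1: "0 < \<tau> \<Longrightarrow> \<bar>t\<bar> \<le> a \<Longrightarrow> cutoff a \<tau> t = 1"
proof -
  assume *: "0 < \<tau>" "\<bar>t\<bar> \<le> a"
  then have "(t - a) / \<tau> \<le> 0" "(- t - a) / \<tau> \<le> 0" by (auto simp: field_simps)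
  then show ?thesis by (simp add: cutoff_def)
qed

lemma cutoff_eq_0: "0 < \<tau> \<Longrightarrow> \<bar>t\<bar> \<ge> a + \<tau> \<Longrightarrow> cutoff a \<tau> t = 0"
proof -
  assume *: "0 < \<tau>" "\<bar>t\<bar> \<ge> a + \<tau>"
  let ?y = "max 0 ((t - a) / \<tau>)" and ?z = "max 0 ((- t - a) / \<tau>)"
  have "1 \<le> (t - a) / \<tau> \<or> 1 \<le> (- t - a) / \<tau>" using * by (auto simp: field_simps abs_if split: if_splits)
  then have "1 \<le> ?y \<or> 1 \<le> ?z" by auto
  then have "1 \<le> ?y ^ 3 \<or> 1 \<le> ?z ^ 3" using one_le_power by blast
  moreover have "0 \<le> ?y ^ 3" "0 \<le> ?z ^ 3" by simp_all
  ultimately have "1 - ?y ^ 3 - ?z ^ 3 \<le> 0" by linarith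
  then have "max 0 (1 - ?y ^ 3 - ?z ^ 3) = 0" by (rule max_absorb1)
  then show ?thesis unfolding cutoff_def by (simp only: power_zero_numeral)
qed

text \<open>A constant times the square of a cutoff, with a plateau that covers the thickened
  interval. The derivative bounds only ask that \<tau> be no shorter than the natural time scale, so
  the transition may be much slower, and then the derivative of \<open>e\<close> is smaller.\<close>

lemma energy_profile_exists:
  assumes K: "0 < K" and e\<^sub>R: "0 < e\<^sub>R" and \<Xi>: "0 < \<Xi>" and e\<^sub>v: "0 < e\<^sub>v" and T: "0 \<le> T"
    and \<tau>: "1 / (\<Xi> * sqrt e\<^sub>v) \<le> \<tau>"
  obtains e e' where "energy_profile K \<Xi> e\<^sub>v e\<^sub>R {-T..T} e"
    "closure {t. e t \<noteq> 0} \<subseteq> {-(T + 2 * \<tau>)..T + 2 * \<tau>}"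
    "\<And>t. (e has_real_derivative e' t) (at t)" "continuous_on UNIV e'"
    "\<And>t. \<bar>e' t\<bar> \<le> 18 * (K * e\<^sub>R) / \<tau>" "e 0 = K * e\<^sub>R"
proof -
  define \<theta> where "\<theta> = 1 / (\<Xi> * sqrt e\<^sub>v)"
  define \<omega> where "\<omega> = \<Xi> * sqrt e\<^sub>v"
  have \<omega>: "0 < \<omega>" using \<Xi> e\<^sub>v by (simp add: \<omega>_def)
  have \<theta>: "0 < \<theta>" "\<theta> \<le> \<tau>" using \<omega> \<tau> by (simp_all add: \<theta>_def \<omega>_def)
  then have \<tau>0: "0 < \<tau>" by linarith
  have \<tau>\<omega>: "1 / \<tau> \<le> \<omega>" using \<tau> \<tau>0 \<omega> by (simp add: \<omega>_def field_simps)
  define s where "s = sqrt (K * e\<^sub>R)"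
  have s: "0 < s" "s\<^sup>2 = K * e\<^sub>R" using K e\<^sub>R by (simp_all add: s_def)
  let ?\<psi> = "cutoff (T + \<theta>) \<tau>"
  obtain \<psi>' \<psi>'' where \<psi>: "\<And>t. (?\<psi> has_real_derivative \<psi>' t) (at t)"
    "\<And>t. (\<psi>' has_real_derivative \<psi>'' t) (at t)" "continuous_on UNIV \<psi>''"
    "\<And>t. \<bar>\<psi>' t\<bar> \<le> 9 / \<tau>" "\<And>t. \<bar>\<psi>'' t\<bar> \<le> 90 / \<tau>\<^sup>2"
    using cutoff_derivatives[OF \<tau>0, of "T + \<theta>"] by blast
  \<comment> \<open>Defined as a square: \<open>sqrt (e t)\<close> is then \<open>s\<close> times
    the cutoff, and C^2 even where \<open>e\<close> vanishes.\<close>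
  define e where "e t = (s * ?\<psi> t)\<^sup>2" for t
  define e' where "e' t = 2 * (s * ?\<psi> t) * (s * \<psi>' t)" for t
  have sq: "(\<lambda>t. sqrt (e t)) = (\<lambda>t. s * ?\<psi> t)"
    unfolding e_def using s(1) cutoff_bounds(1) by (auto simp: abs_mult)
  have D1: "((\<lambda>t. s * ?\<psi> t) has_real_derivative s * \<psi>' t) (at t)" for t
    by (rule DERIV_cmult[OF \<psi>(1)])
  have D2: "((\<lambda>t. s * \<psi>' t) has_real_derivative s * \<psi>'' t) (at t)" for t
    by (rule DERIV_cmult[OF \<psi>(2)])
  have d1: "deriv (\<lambda>t. s * ?\<psi> t) = (\<lambda>t. s * \<psi>' t)" using DERIV_imp_deriv[OF D1] by auto
  have d2: "deriv (\<lambda>t. s * \<psi>' t) = (\<lambda>t. s * \<psi>'' t)" using DERIV_imp_deriv[OF D2] by auto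
  have c\<psi>': "continuous_on UNIV \<psi>'" using \<psi>(2) by (auto intro: DERIV_isCont continuous_at_imp_continuous_on)
  have c\<psi>: "continuous_on UNIV ?\<psi>" using \<psi>(1) by (auto intro: DERIV_isCont continuous_at_imp_continuous_on)
  have ep: "energy_profile K \<Xi> e\<^sub>v e\<^sub>R {-T..T} e"
    unfolding energy_profile_def sq
  proof (intro conjI allI ballI)
    show "0 \<le> e t" for t by (simp add: e_def)
    show "K * e\<^sub>R \<le> e t" if "t \<in> thicken {-T..T} (1 / (\<Xi> * sqrt e\<^sub>v))" for t
    proof -
      have "\<bar>t\<bar> \<le> T + \<theta>" using that by (auto simp: thicken_def \<theta>_def)
      then show ?thesis using cutoff_eq_1[OF \<tau>0, of t "T + \<theta>"] s by (simp add: e_def)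
    qed
    show "(\<lambda>t. s * ?\<psi> t) C1_differentiable_on UNIV"
      unfolding C1_differentiable_on_def
      using D1 by (intro exI[of _ "\<lambda>t. s * \<psi>' t"]) (auto intro!: continuous_intros c\<psi>' simp: has_real_derivative_iff_has_vector_derivative)
    show "deriv (\<lambda>t. s * ?\<psi> t) C1_differentiable_on UNIV"
      unfolding C1_differentiable_on_def d1
      using D2 by (intro exI[of _ "\<lambda>t. s * \<psi>'' t"]) (auto intro!: continuous_intros \<psi>(3) simp: has_real_derivative_iff_has_vector_derivative)
    fix r :: nat and t assume "r \<in> {0, 1, 2}"
    then consider "r = 0" | "r = 1" | "r = 2" by auto
    then show "\<bar>(deriv ^^ r) (\<lambda>t. s * ?\<psi> t) t\<bar> \<le> 1000 * (\<Xi> * sqrt e\<^sub>v) ^ r * sqrt (K * e\<^sub>R)"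
    proof cases
      case 1
      have "s * ?\<psi> t \<le> s * 1" using s(1) cutoff_bounds(2) by (intro mult_left_mono) auto
      then show ?thesis using 1 s(1) cutoff_bounds(1)[of "T + \<theta>" \<tau> t] by (simp add: s_def[symmetric] abs_mult)
    next
      case 2
      have "\<bar>\<psi>' t\<bar> \<le> 9 * \<omega>" using \<psi>(4)[of t] \<tau>\<omega> by simp
      then have "\<bar>\<psi>' t\<bar> \<le> 1000 * \<omega>" using \<omega> by linarith
      then have "s * \<bar>\<psi>' t\<bar> \<le> s * (1000 * \<omega>)" using s(1) by (intro mult_left_mono) auto
      then show ?thesis using 2 s(1) by (simp add: d1 s_def[symmetric] abs_mult \<omega>_def mult_ac)
    next
      case 3
      have "(1 / \<tau>)\<^sup>2 \<le> \<omega>\<^sup>2" using \<tau>\<omega> \<tau>0 by (intro power_mono) auto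
      then have "\<bar>\<psi>'' t\<bar> \<le> 90 * \<omega>\<^sup>2" using \<psi>(5)[of t] by (simp add: power_one_over)
      then have "\<bar>\<psi>'' t\<bar> \<le> 1000 * \<omega>\<^sup>2" using zero_le_power2[of \<omega>] by linarith
      then have "s * \<bar>\<psi>'' t\<bar> \<le> s * (1000 * \<omega>\<^sup>2)" using s(1) by (intro mult_left_mono) auto
      then show ?thesis using 3 s(1)
        by (simp add: numeral_2_eq_2 d1 d2 s_def[symmetric] abs_mult \<omega>_def mult_ac)
    qed
  qed
  have z: "e t = 0" if "\<bar>t\<bar> \<ge> T + \<theta> + \<tau>" for t using cutoff_eq_0[OF \<tau>0 that] by (simp add: e_def)
  have "{t. e t \<noteq> 0} \<subseteq> {-(T + 2 * \<tau>)..T + 2 * \<tau>}"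
  proof
    fix t assume "t \<in> {t. e t \<noteq> 0}"
    then have "\<bar>t\<bar> < T + \<theta> + \<tau>" using z[of t] by force
    then show "t \<in> {-(T + 2 * \<tau>)..T + 2 * \<tau>}" using \<theta> by auto
  qed
  then have cl: "closure {t. e t \<noteq> 0} \<subseteq> {-(T + 2 * \<tau>)..T + 2 * \<tau>}" by (rule closure_minimal) simp
  have de: "(e has_real_derivative e' t) (at t)" for t
    unfolding e_def e'_def using DERIV_power[OF D1, of 2 t] by (simp add: mult_ac)
  have ce: "continuous_on UNIV e'" unfolding e'_def by (intro continuous_intros c\<psi> c\<psi>')
  have be: "\<bar>e' t\<bar> \<le> 18 * (K * e\<^sub>R) / \<tau>" for t
  proof -
    have "\<bar>e' t\<bar> = 2 * (K * e\<^sub>R) * (?\<psi> t * \<bar>\<psi>' t\<bar>)"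
      using s cutoff_bounds(1)[of "T + \<theta>" \<tau> t] by (simp add: e'_def abs_mult s(2)[symmetric] power2_eq_square)
    also have "\<dots> \<le> 2 * (K * e\<^sub>R) * (1 * (9 / \<tau>))"
      using cutoff_bounds K e\<^sub>R \<psi>(4) by (intro mult_left_mono mult_mono) auto
    finally show ?thesis by simp
  qed
  have "e 0 = K * e\<^sub>R" using cutoff_eq_1[OF \<tau>0, of 0 "T + \<theta>"] T \<theta> s by (simp add: e_def)
  then show ?thesis by (rule that[OF ep cl de ce be])
qed

section \<open>Frequency and energy parameters\<close>

text \<open>The lower bounds on \<open>q\<^sub>0\<close> have separate uses: \<open>2 / C\<close>
  makes the natural time scales at least halve in every step (\<open>time_scale_le\<close>),
  \<open>C \<le> sqrt q\<^sub>0\<close> absorbs the constant in the growth of the frequencies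
  (\<open>Xi_le\<close>), and 4 makes \<open>sqrt (er k)\<close> at least halve
  (\<open>sqrt_er_tail\<close>).\<close>

locale iteration_parameters =
  fixes \<delta> C q\<^sub>0 :: real
  assumes \<delta>: "0 < \<delta>" and C: "0 < C" and q0: "4 \<le> q\<^sub>0" "2 / C \<le> q\<^sub>0" "C \<le> sqrt q\<^sub>0"
begin

text \<open>
  Here \<open>ev\<close>, \<open>er\<close>, \<open>Xi\<close> are the levels $e_v$, $e_R$, $\Xi$ of the \<open>k\<close>-th stage, \<open>freq_step\<close> is $N$, and
  \<open>q\<close> is the ratio $e_v / e_R$. The exponent $3/2 + \delta$ of $N$ is what makes \<open>q (Suc k)\<close> equal to
  \<open>q k powr (1 + \<delta>)\<close>.
\<close>

definition q :: "nat \<Rightarrow> real" where "q k = q\<^sub>0 powr ((1 + \<delta>) ^ k)"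

primrec er :: "nat \<Rightarrow> real" where
  "er 0 = 1"
| "er (Suc k) = er k / q k powr (1 + \<delta>)"

definition ev :: "nat \<Rightarrow> real" where "ev k = q k * er k"

definition freq_step :: "nat \<Rightarrow> real" where "freq_step k = q k powr (3 / 2 + \<delta>)"

primrec Xi :: "nat \<Rightarrow> real" where
  "Xi 0 = 2"
| "Xi (Suc k) = C * freq_step k * Xi k"

lemma q_ge: "q\<^sub>0 \<le> q k"
proof -
  have "q\<^sub>0 powr 1 \<le> q\<^sub>0 powr ((1 + \<delta>) ^ k)" using q0(1) \<delta> by (intro powr_mono one_le_power) auto
  then show ?thesis using q0(1) by (simp add: q_def)
qed

lemma q_pos [simp]: "0 < q k" and q_ge_4: "4 \<le> q k" and q_nonzero [simp]: "q k \<noteq> 0"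
  using q_ge[of k] q0(1) by auto

lemma q_Suc: "q (Suc k) = q k powr (1 + \<delta>)"
  by (simp add: q_def powr_powr mult.commute)

lemma er_pos [simp]: "0 < er k"
  by (induction k) simp_all

lemma er_nonzero [simp]: "er k \<noteq> 0" and abs_er [simp]: "\<bar>er k\<bar> = er k"
  using er_pos[of k] by linarith+

lemma er_Suc_le: "er (Suc k) \<le> er k / q\<^sub>0"
proof -
  have "q k powr 1 \<le> q k powr (1 + \<delta>)" using q_ge_4[of k] \<delta> by (intro powr_mono) auto
  then have "q\<^sub>0 \<le> q k powr (1 + \<delta>)" using q_ge[of k] by simp
  then show ?thesis
    using q0(1) less_imp_le[OF er_pos[of k]] unfolding er.simps by (intro divide_left_mono) auto
qed

lemma er_le_1: "er k \<le> 1"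
proof (induction k)
  case (Suc k)
  have "er k / q\<^sub>0 \<le> er k" using q0(1) er_pos[of k] by (simp add: divide_le_eq mult_left_mono[of 1 q\<^sub>0 "er k", simplified])
  then show ?case using er_Suc_le[of k] Suc by linarith
qed simp

lemma ev_pos [simp]: "0 < ev k"
  by (simp add: ev_def)

lemma ev_Suc: "ev (Suc k) = er k"
  using q_pos[of k] by (simp add: ev_def q_Suc)

lemma er_le_ev: "er k \<le> ev k"
  using q_ge_4[of k] er_pos[of k] by (simp add: ev_def)

lemma ev_le: "ev k \<le> q\<^sub>0"
proof (cases k)
  case 0
  then show ?thesis using q0(1) by (simp add: ev_def q_def)
next
  case (Suc n)
  then show ?thesis using er_le_1[of n] q0(1) by (simp add: ev_Suc)
qed

lemma sqrt_q: "sqrt (q k) = q k powr (1 / 2)"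
  by (simp add: powr_half_sqrt less_imp_le)

lemma sqrt_ev: "sqrt (ev k) = sqrt (q k) * sqrt (er k)"
  by (simp add: ev_def real_sqrt_mult)

lemma freq_step_pos [simp]: "0 < freq_step k" and freq_step_nonzero [simp]: "freq_step k \<noteq> 0"
  by (simp_all add: freq_step_def)

lemma freq_step_ge_q: "q k \<le> freq_step k"
proof -
  have "q k powr 1 \<le> q k powr (3 / 2 + \<delta>)" using q_ge_4[of k] \<delta> by (intro powr_mono) auto
  then show ?thesis by (simp add: freq_step_def less_imp_le)
qed

text \<open>The left-hand side is the new stress level that the hypothesis returns; with N = q^(3/2
  + \<delta>) it becomes e_R / q^(1 + \<delta>), the recursion of \<open>er\<close>.\<close>

lemma next_er: "sqrt (ev k) * sqrt (er k) / freq_step k = er (Suc k)"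
proof -
  have "freq_step k = sqrt (q k) * q k powr (1 + \<delta>)"
    unfolding freq_step_def sqrt_q by (simp add: powr_add[symmetric])
  then show ?thesis
    using er_pos[of k] q_pos[of k] by (simp add: sqrt_ev field_simps)
qed

lemma freq_step_ge_ratio: "(ev k / er k) powr (3 / 2) \<le> freq_step k"
proof -
  have "ev k / er k = q k" using er_pos[of k] by (simp add: ev_def)
  then show ?thesis unfolding freq_step_def using q_ge_4[of k] \<delta> by (auto intro!: powr_mono)
qed

lemma Xi_pos [simp]: "0 < Xi k"
  by (induction k) (simp_all add: C)

lemma Xi_nonzero [simp]: "Xi k \<noteq> 0"
  using Xi_pos[of k] by linarith

section \<open>Growth of the frequencies and decay of the time scales\<close>

text \<open>The solution of 2 + \<delta> + M = (1 + \<delta>) M: one step multiplies the frequency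
  by at most \<open>q k powr (2 + \<delta>)\<close>, while the exponent \<open>M\<close> of
  \<open>q k\<close> grows to (1 + \<delta>) M.\<close>

definition M :: real where "M = (2 + \<delta>) / \<delta>"

lemma Xi_le: "Xi k \<le> q k powr M"
proof (induction k)
  case 0
  have "1 \<le> M" using \<delta> by (simp add: M_def)
  then have "q 0 powr 1 \<le> q 0 powr M" using q_ge_4[of 0] by (intro powr_mono) auto
  then show ?case using q_ge_4[of 0] by simp
next
  case (Suc k)
  have "C \<le> q k powr (1 / 2)"
    using q0(3) real_sqrt_le_mono[OF q_ge[of k]] unfolding sqrt_q[symmetric] by linarith
  then have "C * freq_step k * Xi k \<le> q k powr (1 / 2) * q k powr (3 / 2 + \<delta>) * q k powr M"
    using Suc C Xi_pos[of k] by (intro mult_mono) (auto simp: freq_step_def less_imp_le)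
  also have "\<dots> = q k powr (2 + \<delta> + M)" by (simp add: powr_add[symmetric])
  also have "2 + \<delta> + M = (1 + \<delta>) * M" using \<delta> by (simp add: M_def field_simps)
  finally show ?case by (simp add: q_Suc powr_powr)
qed

text \<open>Supplies the condition N \<ge> \<Xi>^\<eta> with an \<eta> in which neither
  \<open>C\<close> nor \<open>q\<^sub>0\<close> occurs.\<close>

lemma freq_step_ge_Xi: "Xi k powr ((3 / 2 + \<delta>) / M) \<le> freq_step k"
proof -
  have M: "0 < M" using \<delta> by (simp add: M_def)
  have "Xi k powr ((3 / 2 + \<delta>) / M) \<le> (q k powr M) powr ((3 / 2 + \<delta>) / M)"
    using Xi_le[of k] Xi_pos[of k] \<delta> M by (intro powr_mono2) (auto simp: less_imp_le)
  also have "\<dots> = freq_step k" using M by (simp add: powr_powr freq_step_def)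
  finally show ?thesis .
qed

text \<open>One step multiplies \<open>Xi k * sqrt (ev k)\<close> by
  \<open>C * q k powr (1 + \<delta>)\<close>, which is at least 2. Hence the width
  \<open>(1 / 2) ^ k\<close> is admissible in \<open>energy_profile_exists\<close> at every
  stage.\<close>

lemma time_scale_le: "1 / (Xi k * sqrt (ev k)) \<le> (1 / 2) ^ k"
proof (induction k)
  case 0
  have "1 \<le> sqrt (ev 0)" using q0(1) by (simp add: ev_def q_def)
  then have "1 \<le> 2 * sqrt (ev 0)" by linarith
  then show ?case by simp
next
  case (Suc k)
  have "2 \<le> C * q\<^sub>0" using q0(2) C by (simp add: field_simps)
  also have "\<dots> \<le> C * q k" using q_ge[of k] C by simp
  also have "q k \<le> q k powr (1 + \<delta>)" using q_ge_4[of k] \<delta> powr_mono[of 1 "1 + \<delta>" "q k"] by simp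
  finally have 2: "2 \<le> C * q k powr (1 + \<delta>)" using C by simp
  have s: "freq_step k = sqrt (q k) * q k powr (1 + \<delta>)"
    unfolding freq_step_def sqrt_q by (simp add: powr_add[symmetric])
  have "Xi (Suc k) * sqrt (ev (Suc k)) = (C * q k powr (1 + \<delta>)) * (Xi k * sqrt (ev k))"
    unfolding ev_Suc sqrt_ev s Xi.simps by (simp add: mult_ac)
  then have "1 / (Xi (Suc k) * sqrt (ev (Suc k))) = 1 / (C * q k powr (1 + \<delta>)) * (1 / (Xi k * sqrt (ev k)))"
    by simp
  also have "\<dots> \<le> 1 / 2 * (1 / 2) ^ k"
    using 2 Suc Xi_pos[of k] ev_pos[of k] by (intro mult_mono divide_left_mono) (auto simp: less_imp_le)
  finally show ?case by simp
qed

section \<open>Summability along the iteration\<close>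

text \<open>Since \<open>q k\<close> tends to infinity, a negative power of it outweighs any
  constant \<open>c\<close>, and the ratio is eventually below 1/2. The factors \<open>C\<close>
  collected in every step are therefore harmless.\<close>

lemma summable_q_ratio:
  fixes f :: "nat \<Rightarrow> real"
  assumes s: "0 < s" and f: "\<And>k. f (Suc k) = c * q k powr (- s) * f k"
  shows "summable f"
proof -
  have lim: "(\<lambda>k. \<bar>c\<bar> * q k powr (- s)) \<longlonglongrightarrow> 0"
  proof -
    have "filterlim (\<lambda>k. (1 + \<delta>) ^ k) at_top sequentially"
      using \<delta> filterlim_realpow_sequentially_gt1[of "1 + \<delta>"]
      by (intro filterlim_at_infinity_imp_filterlim_at_top) auto
    then have "filterlim (\<lambda>k. - s * (1 + \<delta>) ^ k) at_bot sequentially"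
      using s filterlim_tendsto_neg_mult_at_bot[OF tendsto_const, of "-s"] by simp
    then have "(\<lambda>k. exp (ln q\<^sub>0 * (- s * (1 + \<delta>) ^ k))) \<longlonglongrightarrow> 0"
      using q0(1) by (intro filterlim_compose[OF exp_at_bot] filterlim_tendsto_pos_mult_at_bot[OF tendsto_const _ \<open>filterlim _ at_bot _\<close>]) auto
    then have "(\<lambda>k. q k powr (- s)) \<longlonglongrightarrow> 0"
      using q0(1) by (simp add: q_def powr_powr) (simp add: powr_def mult_ac)
    then show ?thesis by (rule tendsto_mult_right_zero)
  qed
  obtain n where n: "\<And>k. k \<ge> n \<Longrightarrow> \<bar>c\<bar> * q k powr (- s) < 1 / 2"
    using order_tendstoD(2)[OF lim, of "1 / 2"] by (auto simp: eventually_sequentially)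
  show ?thesis
  proof (rule summable_ratio_test[of "1 / 2" n])
    show "norm (f (Suc k)) \<le> 1 / 2 * norm (f k)" if "k \<ge> n" for k
      using mult_right_mono[OF less_imp_le[OF n[OF that]], of "\<bar>f k\<bar>"] unfolding f by (simp add: abs_mult)
  qed simp
qed

text \<open>Passing to the next stage multiplies \<open>er k\<close> by
  \<open>q k powr - (1 + \<delta>)\<close> and \<open>freq_step k * Xi k\<close> by
  \<open>C * q k powr ((1 + \<delta>) * (3 / 2 + \<delta>))\<close>. The condition makes the total
  exponent of \<open>q k\<close> negative.\<close>

lemma summable_er_Xi:
  assumes "0 \<le> \<gamma>" "\<gamma> * (3 / 2 + \<delta>) < \<beta>"
  shows "summable (\<lambda>k. er k powr \<beta> * (freq_step k * Xi k) powr \<gamma>)"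
proof (rule summable_q_ratio[of "(1 + \<delta>) * (\<beta> - \<gamma> * (3 / 2 + \<delta>))" _ "C powr \<gamma>"])
  show "0 < (1 + \<delta>) * (\<beta> - \<gamma> * (3 / 2 + \<delta>))" using \<delta> assms by simp
  fix k
  have q: "0 < q k" by simp
  have "freq_step (Suc k) = q k powr ((1 + \<delta>) * (3 / 2 + \<delta>))"
    by (simp add: freq_step_def q_Suc powr_powr)
  then have "(freq_step (Suc k) * Xi (Suc k)) powr \<gamma>
      = q k powr ((1 + \<delta>) * (3 / 2 + \<delta>) * \<gamma>) * C powr \<gamma> * (freq_step k * Xi k) powr \<gamma>"
    using C by (simp add: powr_mult powr_powr less_imp_le)
  moreover have "er (Suc k) powr \<beta> = er k powr \<beta> * q k powr (- ((1 + \<delta>) * \<beta>))"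
    by (simp add: powr_divide powr_powr less_imp_le powr_minus_divide)
  ultimately show "er (Suc k) powr \<beta> * (freq_step (Suc k) * Xi (Suc k)) powr \<gamma>
      = C powr \<gamma> * q k powr - ((1 + \<delta>) * (\<beta> - \<gamma> * (3 / 2 + \<delta>))) * (er k powr \<beta> * (freq_step k * Xi k) powr \<gamma>)"
  proof -
    assume A: "(freq_step (Suc k) * Xi (Suc k)) powr \<gamma>
      = q k powr ((1 + \<delta>) * (3 / 2 + \<delta>) * \<gamma>) * C powr \<gamma> * (freq_step k * Xi k) powr \<gamma>"
      and B: "er (Suc k) powr \<beta> = er k powr \<beta> * q k powr (- ((1 + \<delta>) * \<beta>))"
    have "q k powr (- ((1 + \<delta>) * \<beta>)) * q k powr ((1 + \<delta>) * (3 / 2 + \<delta>) * \<gamma>)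
        = q k powr - ((1 + \<delta>) * (\<beta> - \<gamma> * (3 / 2 + \<delta>)))"
      unfolding powr_add[symmetric] by (rule arg_cong[where f="\<lambda>e. q k powr e"]) (simp add: algebra_simps)
    then show ?thesis unfolding A B by (simp add: mult_ac)
  qed
qed

lemma summable_er: "summable er"
  using summable_er_Xi[of 0 1] by (simp add: less_imp_le)

lemma summable_sqrt_er: "summable (\<lambda>k. sqrt (er k))"
  using summable_er_Xi[of 0 "1 / 2"] by (simp add: powr_half_sqrt less_imp_le)

text \<open>Equal to \<open>Xi k * er k * sqrt (er k)\<close>, the size of the stress gradient times
  the correction (\<open>reynolds_eq_Y\<close>); it also bounds the other terms in the derivative of
  the cross energy and the derivative of the profile error, up to constants.\<close>

definition Y :: "nat \<Rightarrow> real" where "Y k = Xi k * sqrt (ev k) * er k / sqrt (q k)"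

text \<open>Without the last factor \<open>1 / sqrt (q k)\<close> consecutive terms would have the constant ratio \<open>C\<close>.\<close>

lemma summable_Y: "summable Y"
proof (rule summable_q_ratio[of "\<delta> / 2" _ C])
  show "0 < \<delta> / 2" using \<delta> by simp
  fix k
  have s: "freq_step k = sqrt (q k) * q k powr (1 + \<delta>)"
    unfolding freq_step_def sqrt_q by (simp add: powr_add[symmetric])
  have "sqrt (q (Suc k)) = q k powr ((1 + \<delta>) / 2)"
    unfolding sqrt_q by (simp add: q_Suc powr_powr)
  also have "\<dots> = sqrt (q k) * q k powr (\<delta> / 2)"
    unfolding sqrt_q by (simp add: powr_add[symmetric] add_divide_distrib)
  finally have t: "sqrt (q (Suc k)) = sqrt (q k) * q k powr (\<delta> / 2)" .
  have "Y (Suc k) = (C * (sqrt (q k) * q k powr (1 + \<delta>)) * Xi k) * sqrt (er k) * (er k / q k powr (1 + \<delta>))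
     / (sqrt (q k) * q k powr (\<delta> / 2))"
    unfolding Y_def ev_Suc t s[symmetric] by simp
  also have "\<dots> = C * q k powr - (\<delta> / 2) * Y k"
    using q_pos[of k] unfolding Y_def sqrt_ev by (simp add: powr_minus field_simps)
  finally show "Y (Suc k) = C * q k powr - (\<delta> / 2) * Y k" .
qed

text \<open>Derivatives of the energy profiles are of size \<open>er k\<close> divided by the cutoff
  width \<open>(1 / 2) ^ k\<close>.\<close>

lemma summable_er_2: "summable (\<lambda>k. er k * 2 ^ k)"
proof (rule summable_q_ratio[of "1 + \<delta>" _ 2])
  show "0 < 1 + \<delta>" using \<delta> by simp
  show "er (Suc k) * 2 ^ Suc k = 2 * q k powr - (1 + \<delta>) * (er k * 2 ^ k)" for k
    unfolding powr_minus_divide by simp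
qed

lemma Y_pos [simp]: "0 < Y k"
  by (simp add: Y_def)

text \<open>Without \<open>freq_step k\<close> the left-hand side is \<open>Y k * q k\<close>. The
  factor 1 / N in the bounds for \<open>W\<close> and its advective derivative is what compensates
  \<open>q k\<close>.\<close>

lemma defect_le_Y: "Xi k * ev k * sqrt (er k) / freq_step k \<le> Y k"
proof -
  have s: "sqrt (q k) * sqrt (q k) = q k" "sqrt (er k) * sqrt (er k) = er k" by (simp_all add: less_imp_le)
  have "Xi k * ev k * sqrt (er k) = Y k * q k"
  proof -
    have "Y k * q k = Xi k * sqrt (er k) * er k * q k" unfolding Y_def sqrt_ev by simp
    also have "\<dots> = Xi k * ev k * sqrt (er k)" by (simp add: ev_def)
    finally show ?thesis by simp
  qed
  moreover have "Y k * q k / freq_step k \<le> Y k"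
    using freq_step_ge_q[of k] freq_step_pos[of k] Y_pos[of k] by (simp add: divide_le_eq)
  ultimately show ?thesis by simp
qed

lemma reynolds_eq_Y: "Xi k * er k * sqrt (er k) = Y k"
  unfolding Y_def sqrt_ev using q_pos[of k] by simp

lemma profile_le_Y: "Xi k * sqrt (ev k) * er k / freq_step k \<le> Y k"
proof -
  have "sqrt (q k) \<le> q k" using q_ge_4[of k] by (simp add: real_le_lsqrt real_sqrt_le_iff sqrt_le_D power2_eq_square)
  then have "sqrt (q k) \<le> freq_step k" using freq_step_ge_q[of k] by linarith
  then show ?thesis unfolding Y_def by (intro divide_left_mono) (auto simp: less_imp_le)
qed

text \<open>The factor \<open>1 / sqrt q\<^sub>0\<close> makes all later corrections together small
  against the first one, which decides that the energy at time 0 is positive.\<close>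

lemma sqrt_er_tail: "sqrt (er (Suc k)) \<le> (1 / sqrt q\<^sub>0) * (1 / 2) ^ k"
proof (induction k)
  case 0
  show ?case using real_sqrt_le_mono[OF er_Suc_le[of 0]] by (simp add: real_sqrt_divide)
next
  case (Suc k)
  have "sqrt (er (Suc (Suc k))) \<le> sqrt (er (Suc k)) / sqrt q\<^sub>0"
    using real_sqrt_le_mono[OF er_Suc_le[of "Suc k"]] by (simp only: real_sqrt_divide)
  also have "\<dots> \<le> sqrt (er (Suc k)) / 2"
    using q0(1) real_sqrt_le_mono[OF q0(1)] by (intro divide_left_mono) (auto simp: less_imp_le)
  also have "\<dots> \<le> (1 / sqrt q\<^sub>0) * (1 / 2) ^ k / 2" using Suc by (intro divide_right_mono) auto
  finally show ?case by simp
qed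

end

section \<open>The iteration\<close>

lemma levels_below_gradients:
  assumes "levels_below 2 \<Xi> e\<^sub>v e\<^sub>R v p R"
  shows "norm (dx i v t x) \<le> \<Xi> * sqrt e\<^sub>v" "norm (dx i R t x) \<le> \<Xi> * e\<^sub>R" "norm (R t x) \<le> e\<^sub>R"
proof -
  have 1: "C0_le (nabla_norm k v) (\<Xi> ^ k * sqrt e\<^sub>v)" if "k \<in> {1..2}" for k
    using assms that by (simp add: levels_below_def)
  have 2: "C0_le (nabla_norm k R) (\<Xi> ^ k * e\<^sub>R)" if "k \<in> {0..2}" for k
    using assms that by (simp add: levels_below_def)
  show "norm (dx i v t x) \<le> \<Xi> * sqrt e\<^sub>v"
    using order.trans[OF norm_dx_le_nabla order.trans[OF abs_ge_self 1[of 1, unfolded C0_le_def real_norm_def, rule_format]]]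
    by simp
  show "norm (dx i R t x) \<le> \<Xi> * e\<^sub>R"
    using order.trans[OF norm_dx_le_nabla order.trans[OF abs_ge_self 2[of 1, unfolded C0_le_def real_norm_def, rule_format]]]
    by simp
  have "{is :: 3 list. length is = 0} = {[]}" by auto
  then have "nabla_norm 0 R t x = norm (R t x)" by (simp add: nabla_norm_def)
  then show "norm (R t x) \<le> e\<^sub>R" using 2[of 0, unfolded C0_le_def, rule_format, of t x] by simp
qed

lemma C1_differentiable_on_deriv:
  fixes d :: "real \<Rightarrow> real"
  assumes "d C1_differentiable_on UNIV"
  shows "(d has_real_derivative deriv d t) (at t)" "continuous_on UNIV (deriv d)"
proof -
  obtain D where D: "\<And>t. (d has_vector_derivative D t) (at t)" "continuous_on UNIV D"
    using assms by (auto simp: C1_differentiable_on_def)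
  then have D': "(d has_real_derivative D t) (at t)" for t
    by (simp add: has_real_derivative_iff_has_vector_derivative)
  then have "deriv d = D" using DERIV_imp_deriv by blast
  then show "(d has_real_derivative deriv d t) (at t)" "continuous_on UNIV (deriv d)" using D' D(2) by auto
qed

lemma energy_add:
  assumes "continuous_on UNIV (v t)" "continuous_on UNIV (V t)"
  shows "energy (\<lambda>t x. v t x + V t x) t
    = energy v t + 1 / 2 * torus_integral (\<lambda>x. (norm (V t x))\<^sup>2) + torus_integral (\<lambda>x. v t x \<bullet> V t x)"
proof -
  note [continuous_intros] = assms
  have "(norm (v t x + V t x))\<^sup>2 = (norm (v t x))\<^sup>2 + (norm (V t x))\<^sup>2 + 2 * (v t x \<bullet> V t x)" for x
    unfolding power2_norm_eq_inner by (simp add: inner_add_left inner_add_right inner_commute)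
  then have "torus_integral (\<lambda>x. (norm (v t x + V t x))\<^sup>2)
     = torus_integral (\<lambda>x. (norm (v t x))\<^sup>2 + (norm (V t x))\<^sup>2 + 2 * (v t x \<bullet> V t x))" by simp
  also have "\<dots> = torus_integral (\<lambda>x. (norm (v t x))\<^sup>2 + (norm (V t x))\<^sup>2) + torus_integral (\<lambda>x. 2 * (v t x \<bullet> V t x))"
    by (rule torus_integral_add) (intro continuous_intros)+
  also have "torus_integral (\<lambda>x. (norm (v t x))\<^sup>2 + (norm (V t x))\<^sup>2)
      = torus_integral (\<lambda>x. (norm (v t x))\<^sup>2) + torus_integral (\<lambda>x. (norm (V t x))\<^sup>2)"
    by (rule torus_integral_add) (intro continuous_intros)+
  finally show ?thesis by (simp add: energy_def torus_integral_cmult)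
qed

text \<open>
  The cutoffs in time have width \<open>(1 / 2) ^ k\<close> and not the smaller natural time scale
  $\Xi^{-1} e_v^{-1/2}$: with the latter the derivatives of the energy profiles would not be summable.
\<close>

definition time_radius :: "nat \<Rightarrow> real" where "time_radius k = 6 * (1 - (1 / 2) ^ k)"

text \<open>The increment pays twice the cutoff width for the support of the profile, and once more
  for the spread of the new stress by the natural time scale. All increments add up to 6.\<close>

lemma time_radius_Suc: "time_radius (Suc k) = time_radius k + 3 * (1 / 2) ^ k"
  by (simp add: time_radius_def algebra_simps)

lemma time_radius_nonneg: "0 \<le> time_radius k" and time_radius_le: "time_radius k \<le> 6"
  by (simp_all add: time_radius_def power_le_one)

text \<open>The hypothesis with its constants fixed, because every stage has to run with the same
  \<open>K\<close> and \<open>C\<close>.\<close>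

definition ideal_case_step :: "real \<Rightarrow> nat \<Rightarrow> real \<Rightarrow> real \<Rightarrow> bool" where
  "ideal_case_step K L \<eta> C \<longleftrightarrow>
     (\<forall>\<Xi> e\<^sub>v e\<^sub>R v p R I e N.
        levels_below L \<Xi> e\<^sub>v e\<^sub>R v p R \<longrightarrow> union_of_intervals I \<longrightarrow>
        st_support R \<subseteq> I \<times> UNIV \<longrightarrow> energy_profile K \<Xi> e\<^sub>v e\<^sub>R I e \<longrightarrow>
        N \<ge> \<Xi> powr \<eta> \<longrightarrow> N \<ge> (e\<^sub>v / e\<^sub>R) powr (3 / 2) \<longrightarrow>
        (\<exists>V P W R\<^sub>1.
           periodic V \<and> periodic P \<and> periodic W \<and> Ck_st 1 V \<and> Ck_st 1 P \<and> Ck_st 1 W \<and>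
           levels_below L (C * N * \<Xi>) e\<^sub>R (sqrt e\<^sub>v * sqrt e\<^sub>R / N)
             (\<lambda>t x. v t x + V t x) (\<lambda>t x. p t x + P t x) R\<^sub>1 \<and>
           st_support R\<^sub>1 \<subseteq> thicken (closure {t. e t \<noteq> 0}) (1 / (\<Xi> * sqrt e\<^sub>v)) \<times> UNIV \<and>
           st_support V \<union> st_support P \<subseteq> closure {t. e t \<noteq> 0} \<times> UNIV \<and>
           V = curl W \<and> correction_estimates C N \<Xi> e\<^sub>v e\<^sub>R e v V P W))"

lemma ideal_case_hypothesis_step:
  assumes "ideal_case_hypothesis"
  obtains K where "0 < K" "\<And>L \<eta>. 2 \<le> L \<Longrightarrow> 0 < \<eta> \<Longrightarrow> \<exists>C>0. ideal_case_step K L \<eta> C"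
proof -
  have "\<exists>K>0. \<forall>L\<ge>2. \<forall>\<eta>>0. \<exists>C>0. ideal_case_step K L \<eta> C"
    using assms unfolding ideal_case_hypothesis_def ideal_case_step_def .
  then show ?thesis using that by blast
qed

context iteration_parameters
begin

text \<open>What the limit keeps from one stage. The profile and the potential \<open>W\<close> have
  been eliminated; they survive only in the lower bound at time 0 and in the derivative of the
  energy increment.\<close>

definition admissible_correction ::
  "real \<Rightarrow> nat \<Rightarrow> (real^3) field \<Rightarrow> (real^3) field \<Rightarrow> real field \<Rightarrow> bool" where
  "admissible_correction K k v V P \<longleftrightarrow>
     Ck_st 1 V \<and> Ck_st 1 P \<and> st_support V \<union> st_support P \<subseteq> {-6..6} \<times> UNIV \<and>
     C0_le V (C * sqrt (er k)) \<and> C0_le (nabla_norm 1 V) (C * freq_step k * Xi k * sqrt (er k)) \<and>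
     C0_le (advect v V) (C * Xi k * sqrt (ev k) * sqrt (er k)) \<and>
     C0_le P (C * er k) \<and> C0_le (nabla_norm 1 P) (C * freq_step k * Xi k * er k) \<and>
     C0_le (advect v P) (C * Xi k * sqrt (ev k) * er k) \<and>
     K * er k - C * er k / freq_step k \<le> torus_integral (\<lambda>x. (norm (V 0 x))\<^sup>2) \<and>
     (\<exists>D. continuous_on UNIV D \<and> (\<forall>t. \<bar>D t\<bar> \<le> 9 * K * (er k * 2 ^ k) + 34 * C * Y k) \<and>
       (\<forall>t. ((\<lambda>t. energy (\<lambda>t x. v t x + V t x) t - energy v t) has_real_derivative D t) (at t)))"

text \<open>The hypothesis is applied with \<open>I\<close> the interval that carries the stress and
  a profile of transition width \<open>(1 / 2) ^ k\<close>. Its output levels are the parameters of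
  the next stage by \<open>next_er\<close> and \<open>ev_Suc\<close>.\<close>

lemma iteration_step:
  assumes K: "0 < K"
    and H: "ideal_case_step K 2 ((3 / 2 + \<delta>) / M) C"
    and lv: "levels_below 2 (Xi k) (ev k) (er k) v p R"
    and supp: "st_support R \<subseteq> {- time_radius k..time_radius k} \<times> UNIV"
  obtains V P R' where "admissible_correction K k v V P"
    "levels_below 2 (Xi (Suc k)) (ev (Suc k)) (er (Suc k)) (\<lambda>t x. v t x + V t x) (\<lambda>t x. p t x + P t x) R'"
    "st_support R' \<subseteq> {- time_radius (Suc k)..time_radius (Suc k)} \<times> UNIV"
proof -
  define \<tau> :: real where "\<tau> = (1 / 2) ^ k"
  define \<theta> where "\<theta> = 1 / (Xi k * sqrt (ev k))"
  have \<theta>: "\<theta> \<le> \<tau>" "0 < \<tau>" using time_scale_le[of k] by (simp_all add: \<theta>_def \<tau>_def)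
  let ?I = "{- time_radius k..time_radius k}"
  obtain e e' where e: "energy_profile K (Xi k) (ev k) (er k) ?I e"
    "closure {t. e t \<noteq> 0} \<subseteq> {-(time_radius k + 2 * \<tau>)..time_radius k + 2 * \<tau>}"
    "\<And>t. (e has_real_derivative e' t) (at t)" "continuous_on UNIV e'"
    "\<And>t. \<bar>e' t\<bar> \<le> 18 * (K * er k) / \<tau>" "e 0 = K * er k"
    by (rule energy_profile_exists[OF K er_pos[of k] Xi_pos[of k] ev_pos[of k] time_radius_nonneg[of k]
          time_scale_le[of k], folded \<tau>_def], rule that)
  have uI: "union_of_intervals ?I"
    unfolding union_of_intervals_def using time_radius_nonneg[of k]
    by (intro exI[of _ "{?I}"]) (auto simp: is_interval_cc)
  obtain V P W R' where VPW: "periodic V" "periodic P" "periodic W" "Ck_st 1 V" "Ck_st 1 P" "Ck_st 1 W"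
    and lv': "levels_below 2 (C * freq_step k * Xi k) (er k) (sqrt (ev k) * sqrt (er k) / freq_step k)
               (\<lambda>t x. v t x + V t x) (\<lambda>t x. p t x + P t x) R'"
    and sR': "st_support R' \<subseteq> thicken (closure {t. e t \<noteq> 0}) (1 / (Xi k * sqrt (ev k))) \<times> UNIV"
    and sVP: "st_support V \<union> st_support P \<subseteq> closure {t. e t \<noteq> 0} \<times> UNIV"
    and VW: "V = curl W" and est: "correction_estimates C (freq_step k) (Xi k) (ev k) (er k) e v V P W"
    using H[unfolded ideal_case_step_def, rule_format, OF lv uI supp e(1) freq_step_ge_Xi freq_step_ge_ratio]
    by (elim exE conjE) (rule that)
  have lv'': "levels_below 2 (Xi (Suc k)) (ev (Suc k)) (er (Suc k)) (\<lambda>t x. v t x + V t x) (\<lambda>t x. p t x + P t x) R'"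
    using lv' by (simp only: next_er ev_Suc Xi.simps)
  have "thicken (closure {t. e t \<noteq> 0}) (1 / (Xi k * sqrt (ev k))) \<subseteq> {- time_radius (Suc k)..time_radius (Suc k)}"
  proof
    fix t assume "t \<in> thicken (closure {t. e t \<noteq> 0}) (1 / (Xi k * sqrt (ev k)))"
    then obtain a where a: "a \<in> closure {t. e t \<noteq> 0}" "\<bar>t - a\<bar> \<le> \<theta>" by (auto simp: thicken_def \<theta>_def)
    have "a \<in> {-(time_radius k + 2 * \<tau>)..time_radius k + 2 * \<tau>}" using a(1) e(2) by blast
    then show "t \<in> {- time_radius (Suc k)..time_radius (Suc k)}"
      using a(2) \<theta>(1) unfolding time_radius_Suc \<tau>_def[symmetric] by auto
  qed
  then have sR'': "st_support R' \<subseteq> {- time_radius (Suc k)..time_radius (Suc k)} \<times> UNIV" using sR' by blast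
  have "closure {t. e t \<noteq> 0} \<subseteq> {-6..6}"
    using e(2) time_radius_Suc[of k] time_radius_le[of "Suc k"] \<theta>(2) unfolding \<tau>_def[symmetric] by auto
  then have sVP': "st_support V \<union> st_support P \<subseteq> {-6..6} \<times> UNIV" using sVP by blast
  have ER: "euler_reynolds v p R" and ER': "euler_reynolds (\<lambda>t x. v t x + V t x) (\<lambda>t x. p t x + P t x) R'"
    and v2: "Ck_space 2 v"
    using lv lv'' by (auto simp: levels_below_def)
  have perv: "periodic v" and v1: "Ck_st 1 v" using ER by (auto simp: euler_reynolds_def)
  have cv: "C1s (v t)" and cV: "C1s (V t)" for t using C1s_Ck_st perv v1 VPW by auto
  \<comment> \<open>\<open>V\<close> is a curl, but of a potential that is only C^1; its divergence
    is therefore computed as that of the difference of two incompressible flows.\<close>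
  have divV: "(\<Sum>j\<in>UNIV. pd j (V t) x $ j) = 0" for t x
  proof -
    have "(\<Sum>j\<in>UNIV. pd j (\<lambda>x. v t x + V t x) x $ j) = 0" using euler_reynolds_div[OF ER'] .
    then show ?thesis using euler_reynolds_div[OF ER, of t x]
      by (simp add: pd_add C1sD(2)[OF cv] C1sD(2)[OF cV] sum.distrib)
  qed
  define F' where "F' = (\<lambda>t. torus_integral (\<lambda>x. scurl (v t) x \<bullet> advect v W t x)
      - torus_integral (\<lambda>x. curl_defect (v t) x \<bullet> W t x) + torus_integral (\<lambda>x. divR R t x \<bullet> V t x))"
  have F: "((\<lambda>t. torus_integral (\<lambda>x. v t x \<bullet> V t x)) has_vector_derivative F' t) (at t)" "continuous_on UNIV F'" for t
    unfolding F'_def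
    using cross_energy_derivative[OF ER v2 VPW(1,4,3,6) VW divV] by auto
  define d where "d = (\<lambda>t. torus_integral (\<lambda>x. (norm (V t x))\<^sup>2) - torus_integral (\<lambda>x. e t))"
  have d: "d C1_differentiable_on UNIV" "\<And>t. \<bar>d t\<bar> \<le> C * er k / freq_step k"
    "\<And>t. \<bar>deriv d t\<bar> \<le> C * Xi k * sqrt (ev k) * er k / freq_step k"
    using est unfolding correction_estimates_def Let_def d_def by blast+
  have C0: "C0_le V (C * sqrt (er k))" "C0_le (nabla_norm 1 V) (C * freq_step k * Xi k * sqrt (er k))"
     "C0_le (advect v V) (C * Xi k * sqrt (ev k) * sqrt (er k))"
     "C0_le P (C * er k)" "C0_le (nabla_norm 1 P) (C * freq_step k * Xi k * er k)"
     "C0_le (advect v P) (C * Xi k * sqrt (ev k) * er k)"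
     and W: "C0_le W (C * sqrt (er k) / (Xi k * freq_step k))" "C0_le (advect v W) (C * sqrt (ev k) * sqrt (er k) / freq_step k)"
    using est unfolding correction_estimates_def by blast+
  \<comment> \<open>The energy increment is \<open>1 / 2 * (d t + e t)\<close> plus the integral of
    v . V, because \<open>d t + e t\<close> is the integral of |V|^2, the torus having volume
    1.\<close>
  define D where "D t = 1 / 2 * (deriv d t + e' t) + F' t" for t
  have cD: "continuous_on UNIV D"
    unfolding D_def using C1_differentiable_on_deriv(2)[OF d(1)] e(4) F(2) by (intro continuous_intros)
  have dD: "((\<lambda>t. energy (\<lambda>t x. v t x + V t x) t - energy v t) has_real_derivative D t) (at t)" for t
  proof -
    have "(\<lambda>t. energy (\<lambda>t x. v t x + V t x) t - energy v t)
        = (\<lambda>t. 1 / 2 * (d t + e t) + torus_integral (\<lambda>x. v t x \<bullet> V t x))"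
      using energy_add[of v _ V, OF C1sD(4)[OF cv] C1sD(4)[OF cV]]
      by (simp add: d_def torus_integral_const)
    then show ?thesis
      unfolding D_def
      by (simp only:) (intro DERIV_add DERIV_cmult C1_differentiable_on_deriv(1)[OF d(1)] e(3)
          F(1)[folded has_real_derivative_iff_has_vector_derivative])
  qed
  \<comment> \<open>The cross term contributes 6 + 18 + 9 = 33, and half of \<open>deriv d t\<close>
    at most one more \<open>C * Y k\<close>; half of the 18 in the bound for \<open>e'\<close> is
    the 9 of the first summand.\<close>
  have bD: "\<bar>D t\<bar> \<le> 9 * K * (er k * 2 ^ k) + 34 * C * Y k" for t
  proof -
    let ?G = "Xi k * sqrt (ev k)"
    have "\<bar>F' t\<bar> \<le> 6 * ?G * (C * sqrt (ev k) * sqrt (er k) / freq_step k)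
        + 18 * ?G\<^sup>2 * (C * sqrt (er k) / (Xi k * freq_step k)) + 9 * (Xi k * er k) * (C * sqrt (er k))"
      unfolding F'_def
      by (rule cross_energy_derivative_bound[OF ER v2 VPW(1,4,3,6)])
        (use levels_below_gradients[OF lv] W C0 in \<open>auto simp: C0_le_def\<close>)
    also have "\<dots> = 24 * C * (Xi k * ev k * sqrt (er k) / freq_step k) + 9 * C * (Xi k * er k * sqrt (er k))"
    proof -
      have s: "sqrt (ev k) * sqrt (ev k) = ev k" by (simp add: less_imp_le)
      have m1: "6 * ?G * (C * sqrt (ev k) * sqrt (er k) / freq_step k)
          = 6 * C * (Xi k * (sqrt (ev k) * sqrt (ev k)) * sqrt (er k) / freq_step k)" by simp
      have m2: "18 * ?G\<^sup>2 * (C * sqrt (er k) / (Xi k * freq_step k))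
          = 18 * C * (Xi k * (sqrt (ev k) * sqrt (ev k)) * sqrt (er k) / freq_step k)"
        by (simp add: power2_eq_square)
      show ?thesis unfolding m1[unfolded s] m2[unfolded s] by simp
    qed
    also have "\<dots> \<le> 24 * C * Y k + 9 * C * Y k"
      unfolding reynolds_eq_Y using defect_le_Y[of k] C by (intro add_mono mult_left_mono) auto
    finally have b1: "\<bar>F' t\<bar> \<le> 33 * C * Y k" by simp
    have "C * Xi k * sqrt (ev k) * er k / freq_step k = C * (Xi k * sqrt (ev k) * er k / freq_step k)" by simp
    also have "\<dots> \<le> C * Y k" using profile_le_Y[of k] C by (intro mult_left_mono) auto
    finally have b2: "\<bar>deriv d t\<bar> \<le> C * Y k" using d(3)[of t] by linarith
    have b3: "\<bar>e' t\<bar> \<le> 18 * K * (er k * 2 ^ k)"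
      using e(5)[of t] by (simp add: \<tau>_def power_one_over mult_ac)
    have "0 \<le> C * Y k" using C by (simp add: less_imp_le)
    moreover have "\<bar>D t\<bar> \<le> 1 / 2 * \<bar>deriv d t\<bar> + 1 / 2 * \<bar>e' t\<bar> + \<bar>F' t\<bar>"
    proof -
      have "\<bar>D t\<bar> \<le> \<bar>1 / 2 * deriv d t\<bar> + \<bar>1 / 2 * e' t\<bar> + \<bar>F' t\<bar>"
        unfolding D_def distrib_left by (intro order.trans[OF abs_triangle_ineq] add_mono order_refl abs_triangle_ineq)
      then show ?thesis by (simp only: abs_mult) simp
    qed
    ultimately show ?thesis using b1 b2 b3 by (simp add: mult.assoc)
  qed
  \<comment> \<open>Time 0 lies on the plateau of the profile, so the integral of |V|^2 is known
    there up to the profile error.\<close>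
  have "K * er k - C * er k / freq_step k \<le> torus_integral (\<lambda>x. (norm (V 0 x))\<^sup>2)"
    using d(2)[of 0] e(6) by (simp add: d_def torus_integral_const abs_le_iff)
  then have "admissible_correction K k v V P"
    unfolding admissible_correction_def using VPW sVP' C0 cD bD dD by blast
  then show ?thesis using lv'' sR'' by (rule that)
qed

end

section \<open>The zero flow\<close>

lemma dx_zero [simp]: "dx i (\<lambda>_ _. 0) = (\<lambda>_ _. 0)"
  by (intro ext) (simp add: dx_def)

lemma dt_zero [simp]: "dt (\<lambda>_ _. 0) = (\<lambda>_ _. 0)"
  by (intro ext) (simp add: dt_def)

lemma advect_zero: "advect v (\<lambda>_ _. 0) = (\<lambda>_ _. 0)"
  by (intro ext) (simp add: advect_def)

lemma C0_le_nabla_zero: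
  assumes "0 \<le> B"
  shows "C0_le (nabla_norm k (\<lambda>_ _. 0)) B"
proof -
  have "foldr dx is (\<lambda>_ _. 0 :: 'a::real_normed_vector) = (\<lambda>_ _. 0)" for "is"
    by (induction "is") auto
  then show ?thesis using assms by (simp add: C0_le_def nabla_norm_def L2_set_def)
qed

lemma Ck_space_zero: "Ck_space k (\<lambda>_ _. 0)"
  by (induction k) (auto simp: split_beta)

lemma Ck_st_zero: "Ck_st 1 (\<lambda>_ _. 0)"
proof -
  have "(\<lambda>(t::real, x::real^3). 0 :: 'a::real_normed_vector) = (\<lambda>_. 0)" by auto
  then show ?thesis by (simp add: Ck_st_def)
qed

text \<open>The starting flow imposes no relation between the levels beyond the standing
  restrictions, so the initial ratio is free to be large.\<close>

lemma levels_below_zero: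
  assumes "2 \<le> \<Xi>" "0 < e\<^sub>R" "e\<^sub>R \<le> e\<^sub>v"
  shows "levels_below 2 \<Xi> e\<^sub>v e\<^sub>R (\<lambda>_ _. 0) (\<lambda>_ _. 0) (\<lambda>_ _. 0)"
proof -
  have "euler_reynolds (\<lambda>_ _. 0) (\<lambda>_ _. 0) (\<lambda>_ _. 0)"
    unfolding euler_reynolds_def
    by (intro conjI Ck_st_zero Ck_space_zero) (simp_all add: periodic_def)
  then show ?thesis
    unfolding levels_below_def advect_zero using assms
    by (intro conjI ballI C0_le_nabla_zero Ck_st_zero Ck_space_zero) auto
qed

section \<open>Tails of series, energy differences and supports\<close>

lemma norm_partial_sum_diff_le:
  fixes U :: "nat \<Rightarrow> 'a::banach"
  assumes A: "\<And>k. norm (U k) \<le> A k" and s: "summable A"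
  shows "norm ((\<Sum>j<k. U j) - suminf U) \<le> suminf A - (\<Sum>j<k. A j)"
proof -
  have sn: "summable (\<lambda>k. norm (U k))"
    by (rule summable_comparison_test'[OF s]) (simp add: A)
  then have sU: "summable U" by (rule summable_norm_cancel)
  have "(\<Sum>j<k. U j) - suminf U = - (\<Sum>j. U (j + k))"
    using suminf_split_initial_segment[OF sU, of k] by simp
  also have "norm \<dots> \<le> (\<Sum>j. norm (U (j + k)))"
    unfolding norm_minus_cancel by (rule summable_norm) (rule summable_ignore_initial_segment[OF sn])
  also have "\<dots> \<le> (\<Sum>j. A (j + k))"
    by (rule suminf_le) (rule A, rule summable_ignore_initial_segment[OF sn], rule summable_ignore_initial_segment[OF s])
  also have "\<dots> = suminf A - (\<Sum>j<k. A j)"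
    using suminf_split_initial_segment[OF s, of k] by simp
  finally show ?thesis .
qed

lemma abs_energy_diff_le:
  assumes c: "continuous_on UNIV (v t)" "continuous_on UNIV (w t)"
    and M: "\<And>x. norm (v t x) \<le> M" "\<And>x. norm (w t x) \<le> M" and a: "\<And>x. norm (v t x - w t x) \<le> a"
  shows "\<bar>energy v t - energy w t\<bar> \<le> M * a"
proof -
  note [continuous_intros] = c
  have "\<bar>torus_integral (\<lambda>x. (norm (v t x))\<^sup>2 - (norm (w t x))\<^sup>2)\<bar> \<le> 2 * M * a"
  proof (rule torus_integral_bound)
    show "continuous_on UNIV (\<lambda>x. (norm (v t x))\<^sup>2 - (norm (w t x))\<^sup>2)" by (intro continuous_intros)
    fix x
    have "(norm (v t x))\<^sup>2 - (norm (w t x))\<^sup>2 = (norm (v t x) + norm (w t x)) * (norm (v t x) - norm (w t x))"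
      by (simp add: power2_eq_square algebra_simps)
    also have "\<bar>\<dots>\<bar> \<le> (2 * M) * a"
      unfolding abs_mult using M[of x] a[of x] norm_triangle_ineq3[of "v t x" "w t x"]
        order.trans[OF norm_ge_zero M(1)[of x]]
      by (intro mult_mono) auto
    finally show "\<bar>(norm (v t x))\<^sup>2 - (norm (w t x))\<^sup>2\<bar> \<le> 2 * M * a" .
  qed
  moreover have "torus_integral (\<lambda>x. (norm (v t x))\<^sup>2 - (norm (w t x))\<^sup>2)
      = torus_integral (\<lambda>x. (norm (v t x))\<^sup>2) - torus_integral (\<lambda>x. (norm (w t x))\<^sup>2)"
    by (rule torus_integral_diff) (intro continuous_intros)+
  ultimately show ?thesis by (simp add: energy_def right_diff_distrib[symmetric] abs_mult)
qed

lemma strict_mono_on_of_pos_deriv: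
  fixes E :: "real \<Rightarrow> real"
  assumes dE: "\<And>t. (E has_real_derivative E' t) (at t)" and cE: "continuous_on UNIV E'" and pos: "0 < E' z"
  shows "\<exists>a b. a < b \<and> strict_mono_on {a..b} E"
proof -
  have "isCont E' z" using cE by (simp add: continuous_on_eq_continuous_at)
  from order_tendstoD(1)[OF this[unfolded isCont_def] pos]
  obtain d where d: "d > 0" "\<And>t. t \<noteq> z \<Longrightarrow> dist t z < d \<Longrightarrow> 0 < E' t"
    by (auto simp: eventually_at)
  have p: "0 < E' t" if "t \<in> {z - d / 2..z + d / 2}" for t
    using d(2)[of t] pos d(1) that by (cases "t = z") (auto simp: dist_real_def abs_le_iff)
  have "strict_mono_on {z - d / 2..z + d / 2} E"
  proof (rule strict_mono_onI)
    fix r s assume rs: "r \<in> {z - d / 2..z + d / 2}" "s \<in> {z - d / 2..z + d / 2}" "r < s"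
    show "E r < E s"
      by (rule DERIV_pos_imp_increasing[OF rs(3)]) (use rs dE p in \<open>auto intro!: exI\<close>)
  qed
  then show ?thesis using d(1) by (intro exI[of _ "z - d / 2"] exI[of _ "z + d / 2"]) auto
qed

text \<open>The mean value theorem on both sides of 0 gives points with derivatives of either sign;
  continuity of the derivative spreads each sign to an interval.\<close>

lemma energy_increases_and_decreases:
  fixes E :: "real \<Rightarrow> real"
  assumes dE: "\<And>t. (E has_real_derivative E' t) (at t)" and cE: "continuous_on UNIV E'"
    and pos: "0 < E 0" and T: "0 < T" and z: "E T = 0" "E (-T) = 0"
  shows "\<exists>a b. a < b \<and> strict_mono_on {a..b} E" "\<exists>a b. a < b \<and> strict_antimono_on {a..b} E"
proof -
  obtain y where y: "E 0 - E (-T) = (0 - - T) * E' y" using MVT2[of "-T" 0 E E'] T dE by auto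
  then have "0 < E' y" using pos T z by (simp add: zero_less_mult_iff)
  then show "\<exists>a b. a < b \<and> strict_mono_on {a..b} E" by (rule strict_mono_on_of_pos_deriv[OF dE cE])
  obtain w where w: "E T - E 0 = (T - 0) * E' w" using MVT2[of 0 T E E'] T dE by auto
  have "T * - E' w > 0" using w pos z by simp
  then have "0 < - E' w" using T by (simp add: zero_less_mult_iff mult_less_0_iff)
  then obtain a b where ab: "a < b" "strict_mono_on {a..b} (\<lambda>t. - E t)"
    using strict_mono_on_of_pos_deriv[of "\<lambda>t. - E t" "\<lambda>t. - E' t" w] DERIV_minus[OF dE] continuous_on_minus[OF cE]
    by blast
  then have "strict_antimono_on {a..b} E" by (auto simp: monotone_on_def)
  with ab(1) show "\<exists>a b. a < b \<and> strict_antimono_on {a..b} E" by blast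
qed

lemma st_support_subset:
  assumes "\<And>t x. f t x \<noteq> 0 \<Longrightarrow> t \<in> {a..b}"
  shows "st_support f \<subseteq> {a..b} \<times> UNIV"
  unfolding st_support_def
  by (rule closure_minimal) (use assms in \<open>auto intro!: closed_Times\<close>)

lemma st_support_zero:
  assumes "st_support f \<subseteq> I \<times> UNIV" "t \<notin> I"
  shows "f t x = 0"
  using assms closure_subset[of "{(t, x). f t x \<noteq> 0}"] unfolding st_support_def by auto

section \<open>Hoelder regularity of the sums of corrections\<close>

context iteration_parameters
begin

text \<open>The time derivative is the advective derivative minus v . grad f. In units of the
  gradient bound, the advective part costs \<open>q\<^sub>0\<close>, because
  \<open>sqrt (ev k) \<le> q\<^sub>0\<close> and \<open>freq_step k\<close> is at least 1; transport
  costs 3 \<open>B\<close> and the spatial directions cost 3.\<close>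

lemma correction_lipschitz:
  fixes f :: "'a::real_normed_vector field"
  assumes f: "Ck_st 1 f" and v: "\<And>t x. norm (v t x) \<le> B" and s: "0 \<le> s"
    and n: "C0_le (nabla_norm 1 f) (C * freq_step k * Xi k * s)" and a: "C0_le (advect v f) (C * Xi k * sqrt (ev k) * s)"
  shows "norm (f t x - f t' y) \<le> (q\<^sub>0 + 3 * B + 3) * (C * freq_step k * Xi k * s) * dist (t, x) (t', y)"
proof -
  define G where "G = C * freq_step k * Xi k * s"
  have B0: "0 \<le> B" using order.trans[OF norm_ge_zero v] .
  have g: "norm (dx j f t x) \<le> G" for j t x
    using order.trans[OF norm_dx_le_nabla order.trans[OF abs_ge_self n[unfolded C0_le_def real_norm_def, rule_format]]]
    by (simp add: G_def)
  have "q\<^sub>0 * 1 \<le> q\<^sub>0 * q\<^sub>0" using q0(1) by (intro mult_left_mono) auto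
  then have "sqrt (ev k) \<le> sqrt (q\<^sub>0 * q\<^sub>0)"
    using ev_le[of k] by (intro real_sqrt_le_mono) linarith
  then have "sqrt (ev k) \<le> q\<^sub>0" using q0(1) by simp
  moreover have "1 \<le> freq_step k" using freq_step_ge_q[of k] q_ge_4[of k] by linarith
  ultimately have "sqrt (ev k) * 1 \<le> q\<^sub>0 * freq_step k" using q0(1) by (intro mult_mono) auto
  then have "(C * Xi k * s) * sqrt (ev k) \<le> (C * Xi k * s) * (q\<^sub>0 * freq_step k)"
    using C s Xi_pos[of k] by (intro mult_left_mono) (auto simp: less_imp_le)
  then have aG: "C * Xi k * sqrt (ev k) * s \<le> q\<^sub>0 * G" by (simp add: G_def mult_ac)
  have dtb: "norm (dt f t x) \<le> q\<^sub>0 * G + 3 * (B * G)" for t x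
  proof -
    have "norm ((v t x $ j) *\<^sub>R dx j f t x) \<le> B * G" for j
      unfolding norm_scaleR using component_le_norm_cart[of "v t x" j] v[of t x] B0 g[of j t x]
      by (intro mult_mono) auto
    then have "norm (\<Sum>j\<in>UNIV. (v t x $ j) *\<^sub>R dx j f t x) \<le> (\<Sum>j\<in>(UNIV::3 set). B * G)"
      by (rule sum_norm_le)
    moreover have "dt f t x = advect v f t x - (\<Sum>j\<in>UNIV. (v t x $ j) *\<^sub>R dx j f t x)" by (simp add: advect_def)
    moreover have "norm (advect v f t x) \<le> q\<^sub>0 * G" using a aG by (auto simp: C0_le_def intro: order.trans)
    ultimately show ?thesis using norm_triangle_ineq4[of "advect v f t x" "\<Sum>j\<in>UNIV. (v t x $ j) *\<^sub>R dx j f t x"] by simp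
  qed
  have "q\<^sub>0 * G + 3 * (B * G) + 3 * G = (q\<^sub>0 + 3 * B + 3) * G" by (simp add: algebra_simps)
  then show ?thesis
    using Ck_st_1_lipschitz[OF f dtb g, of t x t' y] unfolding G_def by metis
qed

text \<open>Velocity and pressure share this form, with \<beta> = 1/2 and \<beta> = 1. Sup bound and
  Lipschitz constant contain the same \<open>er k powr \<beta>\<close>, so interpolation returns it
  in full, times \<open>(freq_step k * Xi k) powr \<alpha>\<close>.\<close>

lemma holder_correction_series:
  fixes U :: "nat \<Rightarrow> 'a::banach field"
  assumes U: "\<And>k. Ck_st 1 (U k)" "\<And>k t x. norm (U k t x) \<le> C * er k powr \<beta>"
    and v: "\<And>k t x. norm (v k t x) \<le> B"
    and n: "\<And>k. C0_le (nabla_norm 1 (U k)) (C * freq_step k * Xi k * er k powr \<beta>)"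
    and a: "\<And>k. C0_le (advect (v k) (U k)) (C * Xi k * sqrt (ev k) * er k powr \<beta>)"
    and \<alpha>: "0 < \<alpha>" "\<alpha> < 1" "\<alpha> * (3 / 2 + \<delta>) < \<beta>"
  shows "holder_st \<alpha> (\<lambda>t x. \<Sum>k. U k t x)"
proof (rule holder_series[OF \<alpha>(1,2) U(2) correction_lipschitz[OF U(1) v powr_ge_zero n a]])
  have B0: "0 \<le> B" using order.trans[OF norm_ge_zero v] .
  define c where "c = (q\<^sub>0 + 3 * B + 3) * C"
  have c: "0 \<le> c" using B0 q0(1) C by (simp add: c_def)
  have "0 < \<alpha> * (3 / 2 + \<delta>)" using \<alpha>(1) \<delta> by (intro mult_pos_pos) auto
  then have \<beta>: "0 < \<beta>" using \<alpha>(3) by linarith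
  show "0 \<le> (q\<^sub>0 + 3 * B + 3) * (C * freq_step k * Xi k * er k powr \<beta>)" for k
  proof -
    have "0 \<le> q\<^sub>0 + 3 * B + 3" using B0 q0(1) by linarith
    then show ?thesis
      by (intro mult_nonneg_nonneg less_imp_le[OF C] less_imp_le[OF freq_step_pos] less_imp_le[OF Xi_pos] powr_ge_zero)
  qed
  have "0 * (3 / 2 + \<delta>) < \<beta>" using \<beta> by simp
  from summable_er_Xi[OF order_refl this] show "summable (\<lambda>k. C * er k powr \<beta>)"
    by (intro summable_mult) simp
  have "(C * er k powr \<beta>) powr (1 - \<alpha>) * ((q\<^sub>0 + 3 * B + 3) * (C * freq_step k * Xi k * er k powr \<beta>)) powr \<alpha>
      = C powr (1 - \<alpha>) * c powr \<alpha> * (er k powr \<beta> * (freq_step k * Xi k) powr \<alpha>)" for k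
  proof -
    have "(q\<^sub>0 + 3 * B + 3) * (C * freq_step k * Xi k * er k powr \<beta>) = c * ((freq_step k * Xi k) * er k powr \<beta>)"
      by (simp add: c_def mult_ac)
    then have "(C * er k powr \<beta>) powr (1 - \<alpha>) * ((q\<^sub>0 + 3 * B + 3) * (C * freq_step k * Xi k * er k powr \<beta>)) powr \<alpha>
      = (C powr (1 - \<alpha>) * (er k powr \<beta>) powr (1 - \<alpha>)) * (c powr \<alpha> * ((freq_step k * Xi k) powr \<alpha> * (er k powr \<beta>) powr \<alpha>))"
      using c C by (simp only: powr_mult)
    also have "\<dots> = C powr (1 - \<alpha>) * c powr \<alpha> * (((er k powr \<beta>) powr (1 - \<alpha>) * (er k powr \<beta>) powr \<alpha>) * (freq_step k * Xi k) powr \<alpha>)"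
      by (simp only: mult_ac)
    also have "(er k powr \<beta>) powr (1 - \<alpha>) * (er k powr \<beta>) powr \<alpha> = er k powr \<beta>"
      by (simp add: powr_add[symmetric])
    finally show ?thesis .
  qed
  then show "summable (\<lambda>k. (C * er k powr \<beta>) powr (1 - \<alpha>) * ((q\<^sub>0 + 3 * B + 3) * (C * freq_step k * Xi k * er k powr \<beta>)) powr \<alpha>)"
    by (simp only:) (intro summable_mult summable_er_Xi less_imp_le \<alpha>)
qed

end

section \<open>The sequence of flows and its limit\<close>

context iteration_parameters
begin

text \<open>Dependent choice is made for the flows only: each correction is the difference of
  consecutive flows, hence determined by them.\<close>

lemma iteration_sequence:
  assumes K: "0 < K" and H: "ideal_case_step K 2 ((3 / 2 + \<delta>) / M) C"
  obtains vs ps Rs Vs Ps where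
    "\<And>k. levels_below 2 (Xi k) (ev k) (er k) (vs k) (ps k) (Rs k)"
    "\<And>k. admissible_correction K k (vs k) (Vs k) (Ps k)"
    "\<And>k t x. vs k t x = (\<Sum>j<k. Vs j t x)" "\<And>k t x. ps k t x = (\<Sum>j<k. Ps j t x)"
proof -
  \<comment> \<open>The clause for \<open>k = 0\<close> fixes the zero flow as the start, so that
    the flows are the partial sums of the corrections.\<close>
  define Pr where "Pr k = (\<lambda>(v, p, R). levels_below 2 (Xi k) (ev k) (er k) v p R \<and>
      st_support R \<subseteq> {- time_radius k..time_radius k} \<times> UNIV \<and> (k = 0 \<longrightarrow> v = (\<lambda>_ _. 0) \<and> p = (\<lambda>_ _. 0)))" for k
  define Qr where "Qr k = (\<lambda>(v, p, R::(real^3^3) field) (v', p', R'::(real^3^3) field). \<exists>V P. admissible_correction K k v V P \<and>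
      v' = (\<lambda>t x. v t x + V t x) \<and> p' = (\<lambda>t x. p t x + P t x))" for k
  have "\<exists>s. \<forall>k. Pr k (s k) \<and> Qr k (s k) (s (Suc k))"
  proof (rule dependent_nat_choice)
    have "levels_below 2 (Xi 0) (ev 0) (er 0) (\<lambda>_ _. 0) (\<lambda>_ _. 0) (\<lambda>_ _. 0)"
      by (rule levels_below_zero) (use er_le_ev[of 0] in auto)
    then have "Pr 0 (\<lambda>_ _. 0, \<lambda>_ _. 0, \<lambda>_ _. 0)" by (auto simp: Pr_def st_support_def)
    then show "\<exists>s. Pr 0 s" by blast
  next
    fix s k assume "Pr k s"
    moreover obtain v p R where s: "s = (v, p, R)" by (cases s)
    ultimately have "levels_below 2 (Xi k) (ev k) (er k) v p R" "st_support R \<subseteq> {- time_radius k..time_radius k} \<times> UNIV"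
      by (auto simp: Pr_def)
    from iteration_step[OF K H this] obtain V P R' where
      "admissible_correction K k v V P"
      "levels_below 2 (Xi (Suc k)) (ev (Suc k)) (er (Suc k)) (\<lambda>t x. v t x + V t x) (\<lambda>t x. p t x + P t x) R'"
      "st_support R' \<subseteq> {- time_radius (Suc k)..time_radius (Suc k)} \<times> UNIV" .
    then have "Pr (Suc k) (\<lambda>t x. v t x + V t x, \<lambda>t x. p t x + P t x, R') \<and>
        Qr k s (\<lambda>t x. v t x + V t x, \<lambda>t x. p t x + P t x, R')"
      unfolding Pr_def Qr_def s by blast
    then show "\<exists>s'. Pr (Suc k) s' \<and> Qr k s s'" by blast
  qed
  then obtain s where s: "\<And>k. Pr k (s k)" "\<And>k. Qr k (s k) (s (Suc k))" by blast
  define vs ps Rs where "vs k = fst (s k)" and "ps k = fst (snd (s k))" and "Rs k = snd (snd (s k))" for k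
  have sk: "s k = (vs k, ps k, Rs k)" for k by (simp add: vs_def ps_def Rs_def)
  have lv: "levels_below 2 (Xi k) (ev k) (er k) (vs k) (ps k) (Rs k)" for k
    using s(1)[of k] unfolding sk Pr_def by simp
  have z: "vs 0 = (\<lambda>_ _. 0)" "ps 0 = (\<lambda>_ _. 0)" using s(1)[of 0] unfolding sk Pr_def by simp_all
  define Vs Ps where "Vs k t x = vs (Suc k) t x - vs k t x" and "Ps k t x = ps (Suc k) t x - ps k t x" for k t x
  have adm: "admissible_correction K k (vs k) (Vs k) (Ps k)" for k
  proof -
    obtain V P where VP: "admissible_correction K k (vs k) V P"
      "vs (Suc k) = (\<lambda>t x. vs k t x + V t x)" "ps (Suc k) = (\<lambda>t x. ps k t x + P t x)"
      using s(2)[of k] unfolding sk Qr_def by auto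
    have "V = Vs k" "P = Ps k" by (intro ext, simp add: Vs_def Ps_def VP(2,3))+
    then show ?thesis using VP(1) by simp
  qed
  have "vs k t x = (\<Sum>j<k. Vs j t x)" "ps k t x = (\<Sum>j<k. Ps j t x)" for k t x
    by (induction k) (simp_all add: z Vs_def Ps_def)
  then show ?thesis by (rule that[OF lv adm])
qed

text \<open>The assumption \<open>large\<close> compares, at time 0, the integral \<open>K\<close>
  prescribed for the first correction with its error \<open>C / q\<^sub>0\<close> and with the
  contribution \<open>8 * C\<^sup>2 / q\<^sub>0\<close> of all later corrections.\<close>

lemma euler_flow_exists:
  assumes K: "0 < K" and H: "ideal_case_step K 2 ((3 / 2 + \<delta>) / M) C"
    and large: "C / q\<^sub>0 + 8 * C\<^sup>2 / q\<^sub>0 < K"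
  shows "\<exists>v p.
    weak_euler v p \<and>
    (\<exists>t x. v t x \<noteq> 0) \<and>
    (\<forall>\<alpha>. 0 < \<alpha> \<and> \<alpha> < 1 / (3 + 2 * \<delta>) \<longrightarrow> holder_st \<alpha> v \<and> holder_st (2 * \<alpha>) p) \<and>
    (\<exists>a b. st_support v \<union> st_support p \<subseteq> {a..b} \<times> UNIV) \<and>
    energy v C1_differentiable_on UNIV \<and>
    (\<exists>a b. a < b \<and> strict_mono_on {a..b} (energy v)) \<and>
    (\<exists>a b. a < b \<and> strict_antimono_on {a..b} (energy v))"
proof -
  obtain vs ps Rs Vs Ps where lv: "\<And>k. levels_below 2 (Xi k) (ev k) (er k) (vs k) (ps k) (Rs k)"
    and adm: "\<And>k. admissible_correction K k (vs k) (Vs k) (Ps k)"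
    and vsum: "\<And>k t x. vs k t x = (\<Sum>j<k. Vs j t x)" and psum: "\<And>k t x. ps k t x = (\<Sum>j<k. Ps j t x)"
    by (rule iteration_sequence[OF K H], rule that)
  have V1: "Ck_st 1 (Vs k)" and P1: "Ck_st 1 (Ps k)" for k
    using adm[of k] by (auto simp: admissible_correction_def)
  have supp: "st_support (Vs k) \<subseteq> {-6..6} \<times> UNIV" "st_support (Ps k) \<subseteq> {-6..6} \<times> UNIV" for k
    using adm[of k] by (auto simp: admissible_correction_def)
  have bV: "C0_le (Vs k) (C * sqrt (er k))" "C0_le (nabla_norm 1 (Vs k)) (C * freq_step k * Xi k * sqrt (er k))"
     "C0_le (advect (vs k) (Vs k)) (C * Xi k * sqrt (ev k) * sqrt (er k))"
    and bP: "C0_le (Ps k) (C * er k)" "C0_le (nabla_norm 1 (Ps k)) (C * freq_step k * Xi k * er k)"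
     "C0_le (advect (vs k) (Ps k)) (C * Xi k * sqrt (ev k) * er k)"
    and low: "K * er k - C * er k / freq_step k \<le> torus_integral (\<lambda>x. (norm (Vs k 0 x))\<^sup>2)" for k
    using adm[of k] unfolding admissible_correction_def by blast+
  have ER: "euler_reynolds (vs k) (ps k) (Rs k)" for k using lv[of k] by (simp add: levels_below_def)
  have vs1: "Ck_st 1 (vs k)" for k using ER[of k] by (simp add: euler_reynolds_def)
  define A where "A k = C * sqrt (er k)" for k
  have sA: "summable A" unfolding A_def by (intro summable_mult summable_sqrt_er)
  have sB: "summable (\<lambda>k. C * er k)" by (intro summable_mult summable_er)
  have nV: "norm (Vs k t x) \<le> A k" and nP: "norm (Ps k t x) \<le> C * er k" for k t x
    using bV(1)[of k] bP(1)[of k] by (auto simp: C0_le_def A_def)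
  define v where "v t x = (\<Sum>k. Vs k t x)" for t x
  define p where "p t x = (\<Sum>k. Ps k t x)" for t x
  define a where "a k = suminf A - (\<Sum>j<k. A j)" for k
  have va: "norm (vs k t x - v t x) \<le> a k" for k t x
    unfolding vsum v_def a_def by (rule norm_partial_sum_diff_le[OF nV sA])
  have pb: "norm (ps k t x - p t x) \<le> (\<Sum>j. C * er j) - (\<Sum>j<k. C * er j)" for k t x
    unfolding psum p_def by (rule norm_partial_sum_diff_le[OF nP sB])
  have alim: "a \<longlonglongrightarrow> 0"
    using tendsto_diff[OF tendsto_const summable_LIMSEQ[OF sA], of "suminf A"] by (simp add: a_def[abs_def])
  have blim: "(\<lambda>k. (\<Sum>j. C * er j) - (\<Sum>j<k. C * er j)) \<longlonglongrightarrow> 0"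
    using tendsto_diff[OF tendsto_const summable_LIMSEQ[OF sB], of "\<Sum>j. C * er j"] by simp
  have A0: "0 \<le> A k" for k using order.trans[OF norm_ge_zero nV] .
  define B where "B = suminf A"
  have vsB: "norm (vs k t x) \<le> B" for k t x
  proof -
    have "norm (vs k t x) \<le> (\<Sum>j<k. A j)" unfolding vsum by (rule sum_norm_le) (rule nV)
    also have "\<dots> \<le> B" unfolding B_def by (rule sum_le_suminf[OF sA]) (auto simp: A0)
    finally show ?thesis .
  qed
  have vB: "norm (v t x) \<le> B" for t x
    using norm_partial_sum_diff_le[where k=0 and U="\<lambda>j. Vs j t x", OF nV sA] by (simp add: v_def B_def)
  have "weak_euler v p" and cv: "continuous_on UNIV (\<lambda>(t, x). v t x)"
    using weak_euler_limit[OF ER vsB vB va pb levels_below_gradients(3)[OF lv] alim blim summable_LIMSEQ_zero[OF summable_er]]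
    by auto
  have cvt: "continuous_on UNIV (v t)" and cvs: "continuous_on UNIV (vs k t)" for k t
    using continuous_on_slice[OF cv] continuous_on_slice[OF Ck_st_1D(6)[OF vs1]] by auto
  have holder: "holder_st \<alpha> v \<and> holder_st (2 * \<alpha>) p" if \<alpha>: "0 < \<alpha>" "\<alpha> < 1 / (3 + 2 * \<delta>)" for \<alpha>
  proof
    have \<alpha>': "\<alpha> * (3 + 2 * \<delta>) < 1" using \<alpha>(2) \<delta> by (simp add: pos_less_divide_eq)
    have "\<alpha> * 3 < \<alpha> * (3 + 2 * \<delta>)" using \<alpha>(1) \<delta> by simp
    \<comment> \<open>Needed so that the exponent 2 \<alpha> of the pressure stays below 1.\<close>
    then have \<alpha>3: "3 * \<alpha> < 1" using \<alpha>' by linarith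
    have r: "er k powr (1 / 2) = sqrt (er k)" "er k powr 1 = er k" for k by (simp_all add: powr_half_sqrt less_imp_le)
    show "holder_st \<alpha> v"
      unfolding v_def[abs_def]
      by (rule holder_correction_series[where \<beta>="1/2" and v=vs and B=B])
        (use V1 nV vsB bV \<alpha>(1) \<alpha>' \<alpha>3 in \<open>simp_all add: r A_def algebra_simps\<close>)
    show "holder_st (2 * \<alpha>) p"
      unfolding p_def[abs_def]
      by (rule holder_correction_series[where \<beta>=1 and v=vs and B=B])
        (use P1 nP vsB bP \<alpha>(1) \<alpha>' \<alpha>3 in \<open>simp_all add: r algebra_simps\<close>)
  qed
  have out: "v t x = 0" "p t x = 0" if "t \<notin> {-6..6}" for t x
    using st_support_zero[OF supp(1) that] st_support_zero[OF supp(2) that] by (simp_all add: v_def p_def)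
  have "st_support v \<subseteq> {-6..6} \<times> UNIV" by (rule st_support_subset) (use out in blast)
  moreover have "st_support p \<subseteq> {-6..6} \<times> UNIV" by (rule st_support_subset) (use out in blast)
  ultimately have sup: "\<exists>a b. st_support v \<union> st_support p \<subseteq> {a..b} \<times> UNIV" by blast
  have "\<exists>D. continuous_on UNIV D \<and> (\<forall>t. \<bar>D t\<bar> \<le> 9 * K * (er k * 2 ^ k) + 34 * C * Y k) \<and>
       (\<forall>t. ((\<lambda>t. energy (vs (Suc k)) t - energy (vs k) t) has_real_derivative D t) (at t))" for k
  proof -
    have "vs (Suc k) = (\<lambda>t x. vs k t x + Vs k t x)" by (intro ext) (simp add: vsum)
    then show ?thesis using adm[of k] unfolding admissible_correction_def by presburger
  qed
  then have "\<exists>D. \<forall>k. continuous_on UNIV (D k) \<and> (\<forall>t. \<bar>D k t\<bar> \<le> 9 * K * (er k * 2 ^ k) + 34 * C * Y k) \<and>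
       (\<forall>t. ((\<lambda>t. energy (vs (Suc k)) t - energy (vs k) t) has_real_derivative D k t) (at t))"
    by (intro choice allI)
  then obtain D where D: "\<And>k. continuous_on UNIV (D k)"
    "\<And>k t. \<bar>D k t\<bar> \<le> 9 * K * (er k * 2 ^ k) + 34 * C * Y k"
    "\<And>k t. ((\<lambda>t. energy (vs (Suc k)) t - energy (vs k) t) has_real_derivative D k t) (at t)"
    by blast
  have sD: "summable (\<lambda>k. 9 * K * (er k * 2 ^ k) + 34 * C * Y k)"
    by (intro summable_add summable_mult summable_er_2 summable_Y)
  have Elim: "(\<lambda>k. energy (vs k) t) \<longlonglongrightarrow> energy v t" for t
  proof (rule LIM_zero_cancel, rule tendsto_0_le[of "\<lambda>k. B * a k" _ _ 1])
    show "(\<lambda>k. B * a k) \<longlonglongrightarrow> 0" using tendsto_mult_right_zero[OF alim] .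
    show "\<forall>\<^sub>F k in sequentially. norm (energy (vs k) t - energy v t) \<le> norm (B * a k) * 1"
    proof (intro always_eventually allI)
      fix k
      show "norm (energy (vs k) t - energy v t) \<le> norm (B * a k) * 1"
        using abs_energy_diff_le[of "vs k" t v B "a k", OF cvs cvt vsB vB va] by simp
    qed
  qed
  have "energy (vs 0) t = 0" for t using vsum[of 0] by (simp add: energy_def torus_integral_const)
  then have Esum: "(\<lambda>k. energy (vs (Suc k)) t - energy (vs k) t) sums energy v t" for t
    using telescope_sums[OF Elim[of t]] by simp
  define E' where "E' t = (\<Sum>k. D k t)" for t
  \<comment> \<open>The bounds on the derivatives are uniform in time, so the series of energy
    increments may be differentiated term by term.\<close>
  have unif: "uniform_limit UNIV (\<lambda>n t. \<Sum>k<n. D k t) E' sequentially"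
    unfolding E'_def by (rule Weierstrass_m_test[OF _ sD]) (use D(2) in simp)
  have dE: "(energy v has_real_derivative E' t) (at t)" for t
  proof -
    have "uniformly_convergent_on UNIV (\<lambda>n t. \<Sum>k<n. D k t)" using unif by (auto simp: uniformly_convergent_on_def)
    note series = has_field_derivative_series'(2)[of UNIV "\<lambda>k t. energy (vs (Suc k)) t - energy (vs k) t" D, OF _ _ this UNIV_I sums_summable[OF Esum[of t]], of t]
    have "((\<lambda>t. \<Sum>k. energy (vs (Suc k)) t - energy (vs k) t) has_real_derivative E' t) (at t)"
      using series D(3) by (simp add: E'_def[symmetric])
    moreover have "(\<lambda>t. \<Sum>k. energy (vs (Suc k)) t - energy (vs k) t) = energy v"
      by (intro ext sums_unique[symmetric] Esum)
    ultimately show ?thesis by (simp only:)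
  qed
  have cE: "continuous_on UNIV E'"
    by (rule uniform_limit_theorem[OF _ unif], intro always_eventually allI continuous_on_sum D(1)) simp
  have C1: "energy v C1_differentiable_on UNIV"
    unfolding C1_differentiable_on_def
    using dE cE by (auto simp: has_real_derivative_iff_has_vector_derivative)
  have E0: "0 < energy v 0"
  proof -
    \<comment> \<open>The sum of all corrections after the first: \<open>C / sqrt q\<^sub>0\<close>
      times a geometric series with sum 2.\<close>
    define m where "m = 2 * C / sqrt q\<^sub>0"
    have "a 1 = (\<Sum>k. A (Suc k))" using suminf_split_initial_segment[OF sA, of 1] by (simp add: a_def)
    also have "\<dots> \<le> (\<Sum>k. C / sqrt q\<^sub>0 * (1 / 2) ^ k)"
    proof (rule suminf_le)
      show "A (Suc k) \<le> C / sqrt q\<^sub>0 * (1 / 2) ^ k" for k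
        using mult_left_mono[OF sqrt_er_tail[of k] less_imp_le[OF C]] by (simp add: A_def)
      show "summable (\<lambda>k. A (Suc k))" using sA by (simp only: summable_Suc_iff)
      show "summable (\<lambda>k. C / sqrt q\<^sub>0 * (1 / 2) ^ k)" by (intro summable_mult summable_geometric) simp
    qed
    also have "\<dots> = m" by (subst suminf_mult) (simp_all add: suminf_geometric summable_geometric m_def)
    finally have am: "a 1 \<le> m" .
    have V0: "norm (Vs 0 0 x - v 0 x) \<le> m" for x using va[of 1 0 x] am by (simp add: vsum)
    have "(norm (Vs 0 0 x))\<^sup>2 \<le> 2 * (norm (v 0 x))\<^sup>2 + 2 * m\<^sup>2" for x
    proof -
      have "norm (Vs 0 0 x) \<le> norm (v 0 x) + m" using V0[of x] norm_triangle_ineq2[of "Vs 0 0 x" "v 0 x"] by linarith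
      then have "(norm (Vs 0 0 x))\<^sup>2 \<le> (norm (v 0 x) + m)\<^sup>2" by (intro power_mono) auto
      also have "\<dots> \<le> 2 * (norm (v 0 x))\<^sup>2 + 2 * m\<^sup>2"
        using zero_le_power2[of "norm (v 0 x) - m"] by (simp add: power2_sum power2_diff)
      finally show ?thesis .
    qed
    then have "torus_integral (\<lambda>x. (norm (Vs 0 0 x))\<^sup>2) \<le> torus_integral (\<lambda>x. 2 * (norm (v 0 x))\<^sup>2 + 2 * m\<^sup>2)"
      by (intro torus_integral_mono continuous_intros cvt continuous_on_slice[OF Ck_st_1D(6)[OF V1]]) 
    also have "\<dots> = torus_integral (\<lambda>x. 2 * (norm (v 0 x))\<^sup>2) + torus_integral (\<lambda>x. 2 * m\<^sup>2)"
      by (intro torus_integral_add continuous_intros cvt)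
    also have "\<dots> = 4 * energy v 0 + 2 * m\<^sup>2" by (simp add: torus_integral_const torus_integral_cmult energy_def)
    finally have *: "K - C / freq_step 0 \<le> 4 * energy v 0 + 2 * m\<^sup>2" using low[of 0] by simp
    have "2 * m\<^sup>2 = 8 * C\<^sup>2 / q\<^sub>0" using q0(1) by (simp add: m_def power_divide power_mult_distrib)
    moreover have "C / freq_step 0 \<le> C / q\<^sub>0"
      using freq_step_ge_q[of 0] q_ge[of 0] q0(1) C by (intro divide_left_mono) auto
    ultimately show ?thesis using * large by linarith
  qed
  \<comment> \<open>The times 7 and -7 lie outside the common time support [-6, 6].\<close>
  have zero: "energy v 7 = 0" "energy v (-7) = 0"
    using out by (simp_all add: energy_def torus_integral_const)
  have nontriv: "\<exists>t x. v t x \<noteq> 0"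
  proof (rule ccontr)
    assume "\<nexists>t x. v t x \<noteq> 0"
    then have "energy v 0 = 0" by (simp add: energy_def torus_integral_const)
    with E0 show False by simp
  qed
  show ?thesis
    using \<open>weak_euler v p\<close> nontriv holder sup C1
      energy_increases_and_decreases[OF dE cE E0 _ zero] by (intro exI[of _ v] exI[of _ p]) auto
qed

end

theorem theorem13p1:
  fixes \<delta> :: real
  assumes "ideal_case_hypothesis"
    and "\<delta> > 0"
  shows "\<exists>v p.
    weak_euler v p \<and>
    (\<exists>t x. v t x \<noteq> 0) \<and>
    (\<forall>\<alpha>. 0 < \<alpha> \<and> \<alpha> < 1 / (3 + 2 * \<delta>) \<longrightarrow> holder_st \<alpha> v \<and> holder_st (2 * \<alpha>) p) \<and>
    (\<exists>a b. st_support v \<union> st_support p \<subseteq> {a..b} \<times> UNIV) \<and>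
    energy v C1_differentiable_on UNIV \<and>
    (\<exists>a b. a < b \<and> strict_mono_on {a..b} (energy v)) \<and>
    (\<exists>a b. a < b \<and> strict_antimono_on {a..b} (energy v))"
proof -
  obtain K where K: "0 < K" "\<And>L \<eta>. 2 \<le> L \<Longrightarrow> 0 < \<eta> \<Longrightarrow> \<exists>C>0. ideal_case_step K L \<eta> C"
    by (rule ideal_case_hypothesis_step[OF assms(1)]) blast
  \<comment> \<open>\<open>M\<close> is written out: \<eta> has to be chosen before \<open>C\<close>
    is known, hence before the locale can be interpreted.\<close>
  have "0 < (3 / 2 + \<delta>) / ((2 + \<delta>) / \<delta>)" using assms(2) by simp
  then obtain C where C_step: "0 < C" "ideal_case_step K 2 ((3 / 2 + \<delta>) / ((2 + \<delta>) / \<delta>)) C"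
    using K(2)[of 2] by blast
  \<comment> \<open>One summand for each requirement: 4 and \<open>2 / C\<close> as they stand,
    \<open>C\<^sup>2\<close> for \<open>C \<le> sqrt q\<^sub>0\<close>, and the last for the
    positivity of the energy at time 0.\<close>
  define q\<^sub>0 where "q\<^sub>0 = 4 + 2 / C + C\<^sup>2 + (C + 8 * C\<^sup>2) / K"
  have pos: "0 < 2 / C" "0 < C\<^sup>2" "0 < (C + 8 * C\<^sup>2) / K" using C_step(1) K(1) by (simp_all add: add_pos_pos)
  interpret iteration_parameters \<delta> C q\<^sub>0
  proof
    have "sqrt (C\<^sup>2) \<le> sqrt q\<^sub>0" using pos unfolding q\<^sub>0_def by (intro real_sqrt_le_mono) linarith
    then show "C \<le> sqrt q\<^sub>0" using C_step(1) by simp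
  qed (use assms(2) C_step(1) pos in \<open>simp_all add: q\<^sub>0_def\<close>)
  have "(C + 8 * C\<^sup>2) / K < q\<^sub>0" using pos unfolding q\<^sub>0_def by linarith
  then have "(C + 8 * C\<^sup>2) / q\<^sub>0 < K" using K(1) q0(1) by (simp add: divide_less_eq mult.commute)
  then have "C / q\<^sub>0 + 8 * C\<^sup>2 / q\<^sub>0 < K" by (simp add: add_divide_distrib)
  with K(1) C_step(2)[folded M_def] show ?thesis by (rule euler_flow_exists)
qed

end
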